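(* Let $s_0\in(0,1)$ be the unique solution of $2s_0\operatorname{arctanh}(s_0)=1$. Then the critical interaction parameter $p_\alpha$ of the two-urn process with power reinforcement $W(n)=n^\alpha$ satisfies $$\lim_{\alpha\downarrow1}\frac{p_\alpha}{\alpha-1}=\frac{1-s_0^2}{2s_0^2}.$$
   Context: There are two urns containing black and red balls; $B_n(i),R_n(i)$ are the numbers of black and red balls in urn $i\in\{1,2\}$ at time $n\ge0$. The initial configuration is deterministic and fixed, with $R_0(1)\ge1$ and $B_0(2)\ge1$. Put $B_n^*=B_n(1)+B_n(2)$, $R_n^*=R_n(1)+R_n(2)$, $\mathcal G_n=\sigma\{B_m(i),R_m(i):0\le m\le n,\ i=1,2\}$. Let $\alpha>1$, $W(n)=n^\alpha$ and $p\in[0,1]$. Conditionally on $\mathcal G_n$, $\xi_{n+1}(1),\xi_{n+1}(2)$ are independent Bernoulli variables with $$\mathbb P(\xi_{n+1}(i)=1\mid\mathcal G_n)=p\frac{W(B_n^* )}{W(B_n^* )+W(R_n^* )}+(1-p)\frac{W(B_n(i))}{W(B_n(i))+W(R_n(i))},$$ and $B_{n+1}(i)=B_n(i)+\xi_{n+1}(i)$, $R_{n+1}(i)=R_n(i)+1-\xi_{n+1}(i)$. The law of the process is denoted $\mathbb P_p^{(\alpha)}$. Set $x_n=\frac{B_n(1)}{n+B_0(1)+R_0(1)}$, $y_n=\frac{B_n(2)}{n+B_0(2)+R_0(2)}$, and $$\mathcal D=\left\{\lim_{n\to\infty}(x_n,y_n)=(0,0)\right\}\cup\left\{\lim_{n\to\infty}(x_n,y_n)=(1,1)\right\}.$$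 The critical parameter is $$p_\alpha=\inf\{q\in[0,1]:\mathbb P_p^{(\alpha)}(\mathcal D)=1\text{ for every }p\in[q,1]\}.$$ *)

theory Defs
  imports "HOL-Probability.Probability"
begin

text \<open>
  An urn is a pair (number of black balls, number of red balls); a configuration is the pair
  (urn 1, urn 2).
\<close>

type_synonym urn = "nat \<times> nat"
type_synonym config = "urn \<times> urn"

abbreviation black :: "urn \<Rightarrow> nat" where "black \<equiv> fst"
abbreviation red :: "urn \<Rightarrow> nat" where "red \<equiv> snd"

definition black_total :: "config \<Rightarrow> nat" where
  "black_total c = black (fst c) + black (snd c)"

definition red_total :: "config \<Rightarrow> nat" where
  "red_total c = red (fst c) + red (snd c)"

text \<open>Since \<open>0 powr \<alpha> = 0\<close>, this is also the intended weight of an absent colour.\<close>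

definition weight :: "real \<Rightarrow> nat \<Rightarrow> real" where
  "weight \<alpha> n = real n powr \<alpha>"

definition draw_prob :: "real \<Rightarrow> real \<Rightarrow> config \<Rightarrow> urn \<Rightarrow> real" where
  "draw_prob \<alpha> p c u =
     p * (weight \<alpha> (black_total c) / (weight \<alpha> (black_total c) + weight \<alpha> (red_total c)))
     + (1 - p) * (weight \<alpha> (black u) / (weight \<alpha> (black u) + weight \<alpha> (red u)))"

definition add_ball :: "bool \<Rightarrow> urn \<Rightarrow> urn" where
  "add_ball \<xi> u = (if \<xi> then (black u + 1, red u) else (black u, red u + 1))"

definition urn_step :: "real \<Rightarrow> real \<Rightarrow> config \<Rightarrow> config pmf" where
  "urn_step \<alpha> p c =
     map_pmf (\<lambda>(\<xi>1, \<xi>2). (add_ball \<xi>1 (fst c), add_ball \<xi>2 (snd c)))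
       (pair_pmf (bernoulli_pmf (draw_prob \<alpha> p c (fst c)))
                 (bernoulli_pmf (draw_prob \<alpha> p c (snd c))))"

text \<open>
  The law of the process lives on the space of configuration sequences. It is the projective limit
  given by the Ionescu-Tulcea theorem, for the kernels that send a past
  \<open>\<omega> 0, \<dots>, \<omega> (n - 1)\<close> to the conditional law of the configuration at time \<open>n\<close>.
\<close>

definition urn_kernel :: "real \<Rightarrow> real \<Rightarrow> config \<Rightarrow> nat \<Rightarrow> (nat \<Rightarrow> config) \<Rightarrow> config measure" where
  "urn_kernel \<alpha> p c0 n \<omega> =
     measure_pmf (case n of 0 \<Rightarrow> return_pmf c0 | Suc m \<Rightarrow> urn_step \<alpha> p (\<omega> m))"

definition urn_law :: "real \<Rightarrow> real \<Rightarrow> config \<Rightarrow> (nat \<Rightarrow> config) measure" where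
  "urn_law \<alpha> p c0 =
     projective_family.lim UNIV
       (Ionescu_Tulcea.CI (urn_kernel \<alpha> p c0) (\<lambda>_. count_space UNIV))
       (\<lambda>_. count_space UNIV)"

lemma Ionescu_Tulcea_urn: "Ionescu_Tulcea (urn_kernel \<alpha> p c0) (\<lambda>_. count_space UNIV)"
proof (rule Ionescu_Tulcea.intro)
  fix n
  show "urn_kernel \<alpha> p c0 n \<in> Pi\<^sub>M {0..<n} (\<lambda>_. count_space UNIV) \<rightarrow>\<^sub>M subprob_algebra (count_space UNIV)"
  proof (cases n)
    case 0
    then show ?thesis
      by (auto simp: urn_kernel_def[abs_def] space_subprob_algebra
          intro!: measurable_const measure_pmf.subprob_space_axioms)
  next
    case (Suc m)
    have 1: "(\<lambda>c. measure_pmf (urn_step \<alpha> p c)) \<in> count_space UNIV \<rightarrow>\<^sub>M subprob_algebra (count_space UNIV)"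
      by (auto simp: space_subprob_algebra intro!: measure_pmf.subprob_space_axioms)
    have 2: "(\<lambda>\<omega>. \<omega> m) \<in> Pi\<^sub>M {0..<n} (\<lambda>_. count_space UNIV) \<rightarrow>\<^sub>M count_space UNIV"
      using Suc by (intro measurable_component_singleton) auto
    show ?thesis
      using measurable_compose[OF 2 1] Suc by (simp add: urn_kernel_def[abs_def])
  qed
next
  fix n x
  show "prob_space (urn_kernel \<alpha> p c0 n x)"
    by (simp add: urn_kernel_def measure_pmf.prob_space_axioms)
qed

interpretation urn: Ionescu_Tulcea "urn_kernel \<alpha> p c0" "\<lambda>_. count_space UNIV"
  rewrites "projective_family.lim UNIV
       (Ionescu_Tulcea.CI (urn_kernel \<alpha> p c0) (\<lambda>_. count_space UNIV))
       (\<lambda>_. count_space UNIV) = urn_law \<alpha> p c0"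
  for \<alpha> p c0
  by (rule Ionescu_Tulcea_urn) (simp add: urn_law_def)

lemma sets_urn_law: "sets (urn_law \<alpha> p c0) = sets (Pi\<^sub>M UNIV (\<lambda>_. count_space UNIV))"
  using urn.PF.sets_lim[of \<alpha> p c0] by simp

lemma space_urn_law: "space (urn_law \<alpha> p c0) = UNIV"
  using urn.PF.space_lim[of \<alpha> p c0] by (simp add: space_PiM)

text \<open>
  The coordinate process under the law is the Markov chain started in \<open>c0\<close> with transition
  law \<open>urn_step\<close>.
\<close>

lemma emeasure_urn_law_path:
  "emeasure (urn_law \<alpha> p c0) {\<omega>. \<forall>k\<le>n. \<omega> k = a k} =
     (if a 0 = c0 then ennreal (\<Prod>k<n. pmf (urn_step \<alpha> p (a k)) (a (Suc k))) else 0)"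
proof -
  let ?M = "\<lambda>_::nat. count_space (UNIV :: config set)"
  let ?u = "\<lambda>x::nat. undefined :: config"
  let ?A = "\<lambda>m. PiE {0..<m} (\<lambda>k. {a k})"
  have A[measurable]: "?A m \<in> sets (Pi\<^sub>M {0..<m} ?M)" for m
    by (intro sets_PiM_I_finite) auto
  have u: "?u \<in> space (Pi\<^sub>M {0..<0} ?M)" by (simp add: space_PiM)
  have step: "emeasure (urn.C \<alpha> p c0 0 (Suc m) ?u) (?A (Suc m)) =
      emeasure (urn.C \<alpha> p c0 0 m ?u) (?A m) *
      emeasure (urn_kernel \<alpha> p c0 m (restrict a {0..<m})) {a m}" for m
  proof -
    have ne: "space (urn.C \<alpha> p c0 0 m ?u) \<noteq> {}"
      using prob_space.not_empty[OF urn.prob_space_C[OF u]] .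
    have "emeasure (urn.C \<alpha> p c0 0 (Suc m) ?u) (?A (Suc m)) =
       (\<integral>\<^sup>+x. emeasure (urn.eP \<alpha> p c0 m x) (?A (Suc m)) \<partial>urn.C \<alpha> p c0 0 m ?u)"
      apply simp
      apply (rule emeasure_bind[OF ne _ A])
      using urn.measurable_eP[of \<alpha> p c0 m] urn.sets_C[OF u, of \<alpha> p c0 m]
      by (simp cong: measurable_cong_sets)
    also have "\<dots> = (\<integral>\<^sup>+x. indicator (?A m) x *
        emeasure (urn_kernel \<alpha> p c0 m (restrict a {0..<m})) {a m} \<partial>urn.C \<alpha> p c0 0 m ?u)"
    proof (rule nn_integral_cong)
      fix x assume "x \<in> space (urn.C \<alpha> p c0 0 m ?u)"
      then have x: "x \<in> space (Pi\<^sub>M {0..<m} ?M)"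
        using urn.space_C[OF u, of \<alpha> p c0 m] by simp
      then have ext: "x k = undefined" if "k \<notin> {0..<m}" for k
        using that by (auto simp: space_PiM PiE_def extensional_def)
      have eq: "(\<lambda>y. x(m := y)) -` ?A (Suc m) = (if x \<in> ?A m then {a m} else {})"
      proof -
        have "x(m := y) \<in> ?A (Suc m) \<longleftrightarrow> x \<in> ?A m \<and> y = a m" for y
        proof -
          have "x \<in> ?A m \<longleftrightarrow> (\<forall>k<m. x k = a k)"
            using ext by (auto simp: PiE_iff extensional_def)
          moreover have "x(m := y) \<in> ?A (Suc m) \<longleftrightarrow> (\<forall>k<Suc m. (x(m:=y)) k = a k)"
            using ext by (auto simp: PiE_iff extensional_def)
          moreover have "\<dots> \<longleftrightarrow> (\<forall>k<m. x k = a k) \<and> y = a m"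
            by (auto simp: less_Suc_eq)
          ultimately show ?thesis by simp
        qed
        then show ?thesis by (cases "x \<in> ?A m") (simp_all add: vimage_def)
      qed
      have xa: "x = restrict a {0..<m}" if "x \<in> ?A m"
        using that by (auto simp: PiE_iff extensional_def restrict_def fun_eq_iff)
      show "emeasure (urn.eP \<alpha> p c0 m x) (?A (Suc m)) = indicator (?A m) x *
        emeasure (urn_kernel \<alpha> p c0 m (restrict a {0..<m})) {a m}"
        using xa by (auto simp: urn.emeasure_eP[OF x A] eq split: split_indicator)
    qed
    also have "\<dots> = emeasure (urn.C \<alpha> p c0 0 m ?u) (?A m) *
        emeasure (urn_kernel \<alpha> p c0 m (restrict a {0..<m})) {a m}"
    proof -
      have "?A m \<in> sets (urn.C \<alpha> p c0 0 m ?u)"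
        using urn.sets_C[OF u, of \<alpha> p c0 m] A[of m] by simp
      then show ?thesis
        by (subst nn_integral_multc) (auto simp: nn_integral_indicator)
    qed
    finally show ?thesis .
  qed
  have C: "emeasure (urn.C \<alpha> p c0 0 (Suc m) ?u) (?A (Suc m)) =
     (if a 0 = c0 then ennreal (\<Prod>k<m. pmf (urn_step \<alpha> p (a k)) (a (Suc k))) else 0)" for m
  proof (induction m)
    case 0
    show ?case
      unfolding step
      using A[of 0]
      by (auto simp: urn_kernel_def emeasure_pmf_single PiE_empty_domain emeasure_return
          split: split_indicator)
  next
    case (Suc m)
    show ?case
      unfolding step[of "Suc m"] Suc.IH
      by (auto simp: urn_kernel_def emeasure_pmf_single ennreal_mult'' prod_nonneg mult.commute)
  qed
  have "{\<omega>. \<forall>k\<le>n. \<omega> k = a k} = prod_emb UNIV ?M {0..<Suc n} (?A (Suc n))"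
    by (auto simp: prod_emb_def PiE_iff)
  then have "emeasure (urn_law \<alpha> p c0) {\<omega>. \<forall>k\<le>n. \<omega> k = a k} =
      emeasure (urn.CI \<alpha> p c0 {0..<Suc n}) (?A (Suc n))"
    using urn.lim[of "{0..<Suc n}" "?A (Suc n)" \<alpha> p c0] A by simp
  also have "\<dots> = emeasure (urn.C \<alpha> p c0 0 (Suc n) ?u) (?A (Suc n))"
    using urn.emeasure_CI[of "{0..<Suc n}" "Suc n" "?A (Suc n)" \<alpha> p c0] A
    by (simp del: urn.C.simps)
  finally show ?thesis unfolding C .
qed

text \<open>The argument \<open>u\<close> selects the urn: \<open>fst\<close> for urn 1, \<open>snd\<close> for urn 2.\<close>

definition black_prop :: "(config \<Rightarrow> urn) \<Rightarrow> (nat \<Rightarrow> config) \<Rightarrow> nat \<Rightarrow> real" where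
  "black_prop u \<omega> n =
     real (black (u (\<omega> n))) / (real n + real (black (u (\<omega> 0))) + real (red (u (\<omega> 0))))"

definition domination :: "(nat \<Rightarrow> config) set" where
  "domination =
     {\<omega>. (\<lambda>n. (black_prop fst \<omega> n, black_prop snd \<omega> n)) \<longlonglongrightarrow> (0, 0)} \<union>
     {\<omega>. (\<lambda>n. (black_prop fst \<omega> n, black_prop snd \<omega> n)) \<longlonglongrightarrow> (1, 1)}"

text \<open>
  The set contains \<open>q = 1\<close> whenever \<open>\<alpha> > 1\<close> and both colours are present initially,
  so the real infimum is the genuine one there.
\<close>

definition p_crit :: "real \<Rightarrow> config \<Rightarrow> real" where
  "p_crit \<alpha> c0 =
     Inf {q \<in> {0..1}. \<forall>p\<in>{q..1}. measure (urn_law \<alpha> p c0) domination = 1}"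

definition s0 :: real where
  "s0 = (THE s. s \<in> {0<..<1} \<and> 2 * s * artanh s = 1)"

end

theory Submission
  imports Defs
begin

text \<open>
  In the coordinates \<open>s, t \<in> [-1, 1]\<close>, the signed colour proportions of the two urns, the mean drift is a
  gradient field, so almost surely the process approaches its zeros. Writing \<open>s = tanh a\<close> turns the
  power reinforcement into \<open>a \<mapsto> \<alpha> a\<close>, and the zeros can be located exactly: if \<open>p\<close> exceeds
  \<open>(\<alpha> - 1) * 2 a\<^sub>1 / sinh (2 a\<^sub>1)\<close> to first order, where \<open>2 a\<^sub>1 tanh a\<^sub>1 < 1\<close>, every zero
  besides \<open>\<plusminus>(1, 1)\<close> has the form \<open>(s, -s)\<close> with \<open>\<bar>s\<bar> < tanh a\<^sub>1\<close>, and there the drift of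
  \<open>s + t\<close> points away from \<open>0\<close>; the noise then rules out convergence to it. Conversely, for
  \<open>2 a\<^sub>2 tanh a\<^sub>2 > 1\<close> the point \<open>(tanh a\<^sub>2, - tanh a\<^sub>2)\<close> is a stable zero for a parameter
  \<open>p \<sim> (\<alpha> - 1) * 2 a\<^sub>2 / sinh (2 a\<^sub>2)\<close>, and the process is trapped near it with positive
  probability. Both bounds meet at the solution of \<open>2 a tanh a = 1\<close>, that is at \<open>s\<^sub>0 = tanh a\<close>.
\<close>

section \<open>Hyperbolic functions and antisymmetric equilibria\<close>

text \<open>The escape argument is shaped by how weak the repulsion is. The segment of points
  \<open>(s, -s)\<close> may contain several zeros, no convergence along it is established, and near
  it the mean of \<open>s + t\<close> is only shown not to move towards \<open>0\<close>, without a
  uniform rate of growth. So nothing is linearised there. Instead the colour excess is compared with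
  the square root of the number of balls: the randomness of the draws drives it out of every window
  of this size, and outside a wide window the remaining fluctuations are too small to bring the
  proportion back to \<open>0\<close>. The number \<open>2 * a * tanh a\<close> enters through one
  slope. At \<open>tanh a\<close> the reinforcement map has slope
  \<open>al * (cosh a)^2 / (cosh (al * a))^2\<close>, whose derivative in \<open>al\<close> at
  \<open>al = 1\<close> is \<open>1 - 2 * a * tanh a\<close>. Its sign decides, for
  \<open>al\<close> close to \<open>1\<close>, whether \<open>s + t\<close> is repelled or attracted
  at \<open>(tanh a, - tanh a)\<close>. Conditioning on the past is done without filtrations:
  configurations are countably many, so one integral identity for functions of the past and the next
  state suffices.\<close>

lemma sinh_mult_ge:
  fixes c x :: real
  assumes "1 \<le> c" "0 \<le> x"
  shows "c * sinh x \<le> sinh (c * x)"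
proof -
  have "sinh (c * 0) - c * sinh 0 \<le> sinh (c * x) - c * sinh x"
  proof (rule DERIV_nonneg_imp_nondecreasing[OF assms(2)])
    fix y :: real assume "0 \<le> y" "y \<le> x"
    then have "cosh y \<le> cosh (c * y)"
      using assms(1) by (subst cosh_real_nonneg_le_iff) (auto simp: mult_le_cancel_right1)
    then have "0 \<le> c * cosh (c * y) - c * cosh y"
      using assms(1) by simp
    moreover have "((\<lambda>y. sinh (c * y) - c * sinh y) has_real_derivative c * cosh (c * y) - c * cosh y) (at y)"
      by (auto intro!: derivative_eq_intros)
    ultimately show "\<exists>D. ((\<lambda>y. sinh (c * y) - c * sinh y) has_real_derivative D) (at y) \<and> 0 \<le> D"
      by blast
  qed
  then show ?thesis by simp
qed

lemma two_cosh_cosh: "2 * (cosh x * cosh y) = cosh (x + y) + cosh (x - y)" for x y :: real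
  by (simp add: cosh_add cosh_diff)

lemma two_sinh_sinh: "2 * (sinh x * sinh y) = cosh (x + y) - cosh (x - y)" for x y :: real
  by (simp add: cosh_add cosh_diff)

lemma two_sinh_cosh: "2 * (sinh x * cosh y) = sinh (x + y) + sinh (x - y)" for x y :: real
  by (simp add: sinh_add sinh_diff)

lemma tanh_diff_eq: "tanh x - tanh y = sinh (x - y) / (cosh x * cosh y)" for x y :: real
  by (simp add: tanh_def sinh_diff field_simps)

lemma tanh_plus_eq: "tanh x + tanh y = sinh (x + y) / (cosh x * cosh y)" for x y :: real
  by (simp add: tanh_def sinh_add field_simps)

text \<open>After the addition formulas the sign of the derivative is that of
  \<open>(2 + e) * sinh ((2 - e) * z) - (2 - e) * sinh ((2 + e) * z)\<close>, which
  \<open>sinh_mult_ge\<close> settles with the factor \<open>(2 + e) / (2 - e)\<close>.\<close>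

lemma sinh_ratio_antimono:
  fixes e x y :: real
  assumes "0 < e" "e < 2" "0 < x" "x \<le> y"
  shows "sinh (e * y) / sinh (2 * y) \<le> sinh (e * x) / sinh (2 * x)"
proof (rule DERIV_nonpos_imp_nonincreasing[OF assms(4)])
  fix z :: real assume "x \<le> z" "z \<le> y"
  then have z: "0 < z" using assms by simp
  have c: "1 \<le> (2 + e) / (2 - e)" using assms by (simp add: field_simps)
  have "(2 + e) / (2 - e) * sinh ((2 - e) * z) \<le> sinh ((2 + e) / (2 - e) * ((2 - e) * z))"
    by (rule sinh_mult_ge[OF c]) (use assms z in auto)
  also have "(2 + e) / (2 - e) * ((2 - e) * z) = (2 + e) * z" using assms by simp
  finally have 1: "(2 + e) * sinh ((2 - e) * z) \<le> (2 - e) * sinh ((2 + e) * z)"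
    using assms by (simp add: field_simps)
  have 2: "sinh ((2 + e) * z) = sinh (2 * z) * cosh (e * z) + cosh (2 * z) * sinh (e * z)"
    "sinh ((2 - e) * z) = sinh (2 * z) * cosh (e * z) - cosh (2 * z) * sinh (e * z)"
    by (simp_all add: distrib_right left_diff_distrib sinh_add sinh_diff)
  have 3: "e * cosh (e * z) * sinh (2 * z) - 2 * cosh (2 * z) * sinh (e * z) \<le> 0"
    using 1 unfolding 2 by (simp add: algebra_simps)
  have ne: "sinh (2 * z) \<noteq> 0" using z by simp
  have D: "((\<lambda>y. sinh (e * y) / sinh (2 * y)) has_real_derivative
     (e * cosh (e * z) * sinh (2 * z) - 2 * cosh (2 * z) * sinh (e * z)) / (sinh (2 * z))\<^sup>2) (at z)"
    using ne by (auto intro!: derivative_eq_intros simp: power2_eq_square algebra_simps)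
  show "\<exists>D. ((\<lambda>y. sinh (e * y) / sinh (2 * y)) has_real_derivative D) (at z) \<and> D \<le> 0"
    using D 3 by (meson divide_nonpos_nonneg zero_le_power2)
qed

text \<open>The product-to-sum formula turns both sides into sums of two cosh terms that compare one
  by one. The use is that a bound on \<open>cosh (al * x) / cosh x\<close> at one point passes to
  all smaller nonnegative points.\<close>

lemma cosh_ratio_mono:
  fixes al x y :: real
  assumes "1 \<le> al" "0 \<le> x" "x \<le> y"
  shows "cosh (al * x) * cosh y \<le> cosh (al * y) * cosh x"
proof -
  have 1: "(al - 1) * (y - x) \<ge> 0" "(al - 1) * x \<ge> 0" "(al - 1) * y \<ge> 0" "(al+1) * (y-x) \<ge> 0"
    using assms by auto
  have "cosh (al * x + y) \<le> cosh (al * y + x)"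
    using 1 assms by (subst cosh_real_nonneg_le_iff) (auto simp: algebra_simps)
  moreover have "cosh (al * x - y) \<le> cosh (al * y - x)"
  proof -
    have "\<bar>al * x - y\<bar> \<le> al * y - x" using 1 assms by (auto simp: algebra_simps abs_le_iff)
    then have "cosh \<bar>al * x - y\<bar> \<le> cosh (al * y - x)"
      by (subst cosh_real_nonneg_le_iff) auto
    then show ?thesis by simp
  qed
  ultimately show ?thesis
    using two_cosh_cosh[of "al * x" y] two_cosh_cosh[of "al * y" x] by simp
qed

text \<open>In the coordinate \<open>s = tanh x\<close> this is the drift of a single urn without
  interaction, the reinforcement map minus the identity.\<close>

definition tanh_gap :: "real \<Rightarrow> real \<Rightarrow> real" where
  "tanh_gap al x = tanh (al * x) - tanh x"

lemma tanh_gap_eq: "tanh_gap al x = sinh ((al - 1) * x) / (cosh (al * x) * cosh x)"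
  by (simp add: tanh_gap_def tanh_diff_eq algebra_simps)

lemma tanh_gap_minus [simp]: "tanh_gap al (- x) = - tanh_gap al x"
  by (simp add: tanh_gap_def)

lemma tanh_gap_pos: "1 < al \<Longrightarrow> 0 < x \<Longrightarrow> 0 < tanh_gap al x"
  by (simp add: tanh_gap_eq)

text \<open>
  With \<open>w = x + b\<close> and \<open>d = x - b\<close> the claim reads \<open>cosh (al * w) < R * cosh w + r\<close> for
  \<open>R = sinh (al * d) / sinh d\<close> and \<open>r = sinh ((al - 1) * d) / sinh d\<close>. Since \<open>R \<ge> al\<close> and
  \<open>R + r \<ge> 2 * al - 1\<close>, it suffices that \<open>cosh (al * w) < al * cosh w + al - 1\<close>, and this inequality
  for all \<open>w \<le> 2 * a1\<close> is equivalent to the hypothesis on \<open>a1\<close>.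
\<close>

lemma tanh_gap_less:
  fixes al a1 b x :: real
  assumes al: "1 < al" and K: "(cosh (al * a1))\<^sup>2 < al * (cosh a1)\<^sup>2"
    and b: "0 \<le> b" and bx: "b < x" and sum: "x + b \<le> 2 * a1"
  shows "tanh_gap al b < tanh_gap al x"
proof -
  define w d where "w = x + b" and "d = x - b"
  have d: "0 < d" and w: "0 < w" "w / 2 \<le> a1" using b bx sum by (auto simp: w_def d_def)
  have "cosh (al * (w/2)) * cosh a1 \<le> cosh (al * a1) * cosh (w/2)"
    using w al by (intro cosh_ratio_mono) auto
  then have "(cosh (al * (w/2)) * cosh a1)\<^sup>2 \<le> (cosh (al * a1) * cosh (w/2))\<^sup>2"
    by (intro power_mono) auto
  also have "\<dots> < al * (cosh a1)\<^sup>2 * (cosh (w/2))\<^sup>2"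
    using K by (simp add: power_mult_distrib)
  finally have "(cosh (al * (w/2)))\<^sup>2 * (cosh a1)\<^sup>2 < (al * (cosh (w/2))\<^sup>2) * (cosh a1)\<^sup>2"
    by (simp add: power_mult_distrib mult_ac)
  then have "(cosh (al * (w/2)))\<^sup>2 < al * (cosh (w/2))\<^sup>2"
    by (simp add: mult_less_cancel_right)
  then have Kw: "cosh (al * w) < al * cosh w + al - 1"
  proof -
    have "cosh (al * w) = 2 * (cosh (al * (w/2)))\<^sup>2 - 1" "al * cosh w = 2 * (al * (cosh (w/2))\<^sup>2) - al"
      using cosh_double_cosh[of "al * (w/2)"] cosh_double_cosh[of "w/2"] by (simp_all add: right_diff_distrib)
    with \<open>(cosh (al * (w/2)))\<^sup>2 < al * (cosh (w/2))\<^sup>2\<close> show ?thesis by linarith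
  qed
  have s1: "al * sinh d \<le> sinh (al * d)" using al d by (intro sinh_mult_ge) auto
  \<comment> \<open>Source of the bound on \<open>R + r\<close>: multiplied by
    \<open>2 * cosh (d/2)\<close>, the left side becomes a multiple of \<open>sinh d\<close> and the
    right side the sum of the two numerators.\<close>
  have "(2 * al - 1) * sinh (d/2) \<le> sinh ((2 * al - 1) * (d/2))"
    using al d by (intro sinh_mult_ge) auto
  then have "(2 * al - 1) * (2 * (sinh (d/2) * cosh (d/2))) \<le> 2 * (sinh ((2 * al - 1) * (d/2)) * cosh (d/2))"
    by simp
  also have "2 * (sinh (d/2) * cosh (d/2)) = sinh d"
    using two_sinh_cosh[of "d/2" "d/2"] by simp
  also have "2 * (sinh ((2 * al - 1) * (d/2)) * cosh (d/2)) = sinh (al * d) + sinh ((al - 1) * d)"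
    unfolding two_sinh_cosh by (simp add: algebra_simps)
  finally have s2: "(2 * al - 1) * sinh d \<le> sinh (al * d) + sinh ((al - 1) * d)" .
  have s3: "sinh ((al - 1) * d) = sinh (al * d) * cosh d - cosh (al * d) * sinh d"
    using sinh_diff[of "al * d" d] by (simp add: left_diff_distrib)
  have "sinh d * cosh (al * w) < sinh d * (al * cosh w + al - 1)"
    using Kw d by simp
  also have "\<dots> = al * sinh d * (cosh w - 1) + (2 * al - 1) * sinh d"
    by (simp add: algebra_simps)
  also have "\<dots> \<le> sinh (al * d) * (cosh w - 1) + (sinh (al * d) + sinh ((al - 1) * d))"
    using s1 s2 cosh_real_ge_1[of w] by (intro add_mono mult_right_mono) auto
  also have "\<dots> = sinh (al * d) * (cosh w + cosh d) - cosh (al * d) * sinh d"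
    unfolding s3 by (simp add: distrib_left right_diff_distrib left_diff_distrib mult_ac)
  finally have "sinh d * (cosh (al * w) + cosh (al * d)) < sinh (al * d) * (cosh w + cosh d)"
    by (simp add: algebra_simps)
  moreover have "cosh w + cosh d = 2 * (cosh x * cosh b)"
    by (simp add: two_cosh_cosh w_def d_def)
  moreover have "cosh (al * w) + cosh (al * d) = 2 * (cosh (al * x) * cosh (al * b))"
    by (simp add: two_cosh_cosh w_def d_def algebra_simps)
  ultimately have "sinh d * (2 * (cosh (al * x) * cosh (al * b))) < sinh (al * d) * (2 * (cosh x * cosh b))"
    by (simp only:)
  then have "sinh d / (cosh x * cosh b) < sinh (al * d) / (cosh (al * x) * cosh (al * b))"
    by (simp add: divide_less_eq pos_less_divide_eq mult_ac)
  then have "tanh x - tanh b < tanh (al * x) - tanh (al * b)"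
    by (simp add: tanh_diff_eq d_def right_diff_distrib)
  then show ?thesis by (simp add: tanh_gap_def)
qed

text \<open>Replacing \<open>cosh (al * x)\<close> by \<open>cosh x\<close> leaves
  \<open>2 * sinh ((al - 1) * x) / sinh (2 * x) * tanh x\<close>, whose first factor decreases in
  \<open>x\<close>. The hypothesis \<open>al < 3\<close> is the condition \<open>e < 2\<close> of
  that monotonicity.\<close>

lemma tanh_gap_ratio_le:
  fixes al a1 x :: real
  assumes al: "1 < al" "al < 3" and a1: "0 < a1" and x: "a1 \<le> x"
  shows "tanh_gap al x \<le> 2 * sinh ((al - 1) * a1) / sinh (2 * a1) * tanh x"
proof -
  have "cosh x \<le> cosh (al * x)"
    using al a1 x by (subst cosh_real_nonneg_le_iff) (auto simp: mult_le_cancel_right1)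
  then have "tanh_gap al x \<le> sinh ((al - 1) * x) / (cosh x * cosh x)"
    unfolding tanh_gap_eq using al a1 x by (intro divide_left_mono mult_right_mono) auto
  also have "\<dots> = 2 * (sinh ((al - 1) * x) / sinh (2 * x)) * tanh x"
    using a1 x by (simp add: tanh_def sinh_double[of x])
  also have "\<dots> \<le> 2 * (sinh ((al - 1) * a1) / sinh (2 * a1)) * tanh x"
    using sinh_ratio_antimono[of "al - 1" a1 x] al a1 x by (intro mult_right_mono mult_left_mono) auto
  finally show ?thesis by simp
qed

text \<open>
  For a zero \<open>(tanh a, - tanh b)\<close> of the drift with \<open>a \<ge> b\<close>. If \<open>a > b\<close>, the intermediate value theorem
  gives \<open>a' \<le> a\<close> with \<open>tanh_gap al a' = tanh_gap al b\<close>; the geometric mean of these two equal values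
  then contradicts the lower bound on \<open>p\<close>.
\<close>

lemma antisymmetric_zero:
  fixes al a1 a b p :: real
  assumes al: "1 < al" "al < 3" and a1: "0 < a1" and K: "(cosh (al * a1))\<^sup>2 < al * (cosh a1)\<^sup>2"
    and p: "0 < p" "p \<le> 1" and pl: "(1 - p) * (2 * sinh ((al - 1) * a1)) < p * sinh (2 * a1)"
    and ab: "b \<le> a" "0 < a + b"
    and E1: "(1 - p) * (tanh (al * a) + tanh (al * b)) = tanh a + tanh b"
    and E2: "(1 - p) * (tanh (al * a) - tanh (al * b)) \<le> (1 - p) * (tanh a - tanh b)"
  shows "a = b \<and> a < a1"
proof -
  define C where "C = 2 * sinh ((al - 1) * a1) / sinh (2 * a1)"
  have pC: "(1 - p) * C < p" using pl a1 by (simp add: C_def field_simps)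
  have "tanh (- b) < tanh a" using ab by (subst tanh_real_less_iff) simp
  then have tp: "0 < tanh a + tanh b" by simp
  with E1 have p1: "p < 1" using p by (cases "p = 1") auto
  have E2': "tanh_gap al a \<le> tanh_gap al b"
    using E2 p1 by (simp add: mult_le_cancel_left tanh_gap_def)
  have a: "0 < a" using ab by simp
  have b: "0 < b"
  proof (rule ccontr)
    assume "\<not> 0 < b"
    then have "tanh_gap al b \<le> 0"
      using tanh_gap_pos[OF al(1), of "- b"] by (cases "b = 0") (auto simp: tanh_gap_def)
    with E2' tanh_gap_pos[OF al(1) a] show False by simp
  qed
  have E1': "(1 - p) * (tanh_gap al a + tanh_gap al b) = p * (tanh a + tanh b)"
  proof -
    have "(1 - p) * (tanh_gap al a + tanh_gap al b) =
        (1 - p) * (tanh (al * a) + tanh (al * b)) - (1 - p) * (tanh a + tanh b)"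
      by (simp add: tanh_gap_def right_diff_distrib distrib_left)
    also have "\<dots> = p * (tanh a + tanh b)"
      unfolding E1 by (simp add: left_diff_distrib)
    finally show ?thesis .
  qed
  \<comment> \<open>By \<open>E1'\<close> the ratio of the gap sum to \<open>tanh a + tanh b\<close>
    equals \<open>p / (1 - p)\<close>, and \<open>pl\<close> says that \<open>p / (1 - p)\<close>
    exceeds \<open>C\<close>. Every remaining case is excluded by bounding this ratio by
    \<open>C\<close>.\<close>
  have contra: False if "tanh_gap al a + tanh_gap al b \<le> C * (tanh a + tanh b)"
  proof -
    have "p * (tanh a + tanh b) \<le> (1 - p) * (C * (tanh a + tanh b))"
      unfolding E1'[symmetric] using p1 that by (intro mult_left_mono) auto
    then have "p * (tanh a + tanh b) \<le> ((1 - p) * C) * (tanh a + tanh b)" by (simp add: mult_ac)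
    with pC tp show False by (simp add: mult_le_cancel_right)
  qed
  have b1: "b < a1"
  proof (rule ccontr)
    assume "\<not> b < a1"
    then have "tanh_gap al a \<le> C * tanh a" "tanh_gap al b \<le> C * tanh b"
      using tanh_gap_ratio_le[OF al a1] ab unfolding C_def by auto
    with contra show False by (simp add: distrib_left)
  qed
  have "a = b"
  proof (rule ccontr)
    assume "a \<noteq> b"
    with ab have ba: "b < a" by simp
    \<comment> \<open>The gap at \<open>b\<close> is smaller than at every point between
      \<open>b\<close> and its reflection \<open>2 * a1 - b\<close>; since the gap at
      \<open>a\<close> is not larger than at \<open>b\<close>, \<open>a\<close> lies beyond the
      reflection.\<close>
    have far: "2 * a1 - b < a"
      using tanh_gap_less[OF al(1) K less_imp_le[OF b] ba] E2' by force
    have "tanh_gap al b < tanh_gap al (2 * a1 - b)"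
      using b b1 by (intro tanh_gap_less[OF al(1) K]) auto
    then have "\<exists>a'. 2 * a1 - b \<le> a' \<and> a' \<le> a \<and> tanh_gap al a' = tanh_gap al b"
      using far E2' by (intro IVT2') (auto intro!: continuous_intros simp: tanh_gap_def)
    then obtain a' where a': "2 * a1 - b \<le> a'" "a' \<le> a" "tanh_gap al a' = tanh_gap al b" by blast
    define w where "w = a' + b"
    have a'0: "0 < a'" and w: "a1 \<le> w / 2" "0 < w" using a' b b1 a1 by (auto simp: w_def)
    define k where "k = tanh_gap al b"
    have k: "0 < k" unfolding k_def by (rule tanh_gap_pos[OF al(1) b])
    have "k\<^sup>2 = tanh_gap al a' * tanh_gap al b" by (simp add: k_def a' power2_eq_square)
    also have "\<dots> = sinh ((al - 1) * a') * sinh ((al - 1) * b) /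
        ((cosh (al * a') * cosh (al * b)) * (cosh a' * cosh b))"
      by (simp add: tanh_gap_eq)
    also have "\<dots> \<le> (sinh ((al - 1) * (w/2)))\<^sup>2 / ((cosh a' * cosh b) * (cosh a' * cosh b))"
    proof (rule frac_le)
      \<comment> \<open>Log-concavity of sinh by the product-to-sum formula: the product of two
        values is at most the square of the value at the midpoint.\<close>
      have "1 \<le> cosh ((al - 1) * a' - (al - 1) * b)" by (rule cosh_real_ge_1)
      then have "2 * (sinh ((al - 1) * a') * sinh ((al - 1) * b)) \<le> cosh ((al - 1) * w) - 1"
        unfolding two_sinh_sinh by (simp add: w_def distrib_left)
      also have "\<dots> = 2 * (sinh ((al - 1) * (w/2)))\<^sup>2"
        using cosh_double_cosh[of "(al - 1) * (w/2)"] by (simp add: cosh_square_eq)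
      finally show "sinh ((al - 1) * a') * sinh ((al - 1) * b) \<le> (sinh ((al - 1) * (w/2)))\<^sup>2" by simp
      have "cosh x \<le> cosh (al * x)" if "0 < x" for x
        using al that by (subst cosh_real_nonneg_le_iff) (auto simp: mult_le_cancel_right1)
      then show "(cosh a' * cosh b) * (cosh a' * cosh b) \<le> (cosh (al * a') * cosh (al * b)) * (cosh a' * cosh b)"
        using a'0 b by (intro mult_right_mono mult_mono) auto
    qed (use a'0 b al in \<open>auto intro!: mult_pos_pos\<close>)
    also have "\<dots> = (sinh ((al - 1) * (w/2)) / (cosh a' * cosh b))\<^sup>2"
      by (simp add: power2_eq_square)
    finally have "k \<le> sinh ((al - 1) * (w/2)) / (cosh a' * cosh b)"
      by (rule power2_le_imp_le) (use w al in auto)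
    also have "\<dots> = sinh ((al - 1) * (w/2)) / sinh (2 * (w/2)) * (tanh a' + tanh b)"
      using w(2) tanh_plus_eq[of a' b] by (simp add: w_def[symmetric])
    also have "\<dots> \<le> sinh ((al - 1) * a1) / sinh (2 * a1) * (tanh a' + tanh b)"
      using sinh_ratio_antimono[of "al - 1" a1 "w/2"] al a1 w a'0 b
      by (intro mult_right_mono) (auto intro!: add_nonneg_nonneg)
    finally have "2 * k \<le> C * (tanh a' + tanh b)" by (simp add: C_def)
    also have "\<dots> \<le> C * (tanh a + tanh b)"
      using a'(2) al a1 by (intro mult_left_mono) (auto simp: C_def)
    finally show False using contra E2' by (simp add: k_def)
  qed
  with b1 show ?thesis by simp
qed

section \<open>The mean drift\<close>

text \<open>
  The urn function \<open>x powr al / (x powr al + (1 - x) powr al)\<close> in the coordinate \<open>s = 2 * x - 1\<close>.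
\<close>

definition reinf :: "real \<Rightarrow> real \<Rightarrow> real" where
  "reinf al s = ((1 + s) powr al - (1 - s) powr al) / ((1 + s) powr al + (1 - s) powr al)"

lemma reinf_minus [simp]: "reinf al (- s) = - reinf al s"
  by (simp add: reinf_def minus_divide_left add.commute)

lemma reinf_0 [simp]: "reinf al 0 = 0"
  by (simp add: reinf_def)

lemma reinf_1 [simp]: "reinf al 1 = 1"
  by (simp add: reinf_def)

lemma reinf_m1 [simp]: "reinf al (- 1) = - 1"
  by (simp add: reinf_def)

lemma obtain_tanh:
  fixes s :: real
  assumes "\<bar>s\<bar> < 1"
  obtains x where "s = tanh x"
proof -
  have "continuous_on UNIV (tanh :: real \<Rightarrow> real)" by (auto intro!: continuous_intros)
  have "eventually (\<lambda>x. tanh x < s) at_bot"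
    using order_tendstoD(2)[OF tanh_real_at_bot, of s] assms by auto
  then obtain l where l: "tanh l < s" by (metis eventually_at_bot_linorder order_refl)
  have "eventually (\<lambda>x. s < tanh x) at_top"
    using order_tendstoD(1)[OF tanh_real_at_top, of s] assms by auto
  then obtain u where u: "s < tanh u" by (metis eventually_at_top_linorder order_refl)
  have "l \<le> u" using l u by (smt (verit) tanh_real_le_iff)
  then have "\<exists>x. l \<le> x \<and> x \<le> u \<and> tanh x = s"
    using l u by (intro IVT') (auto intro!: continuous_intros)
  with that show ?thesis by blast
qed

text \<open>The weights \<open>1 + tanh x\<close> and \<open>1 - tanh x\<close> are
  \<open>exp x\<close> and \<open>exp (- x)\<close> over the common factor \<open>cosh x\<close>,
  which cancels after taking powers.\<close>

lemma reinf_tanh: "reinf al (tanh (x :: real)) = tanh (al * x)"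
proof -
  have "1 + tanh x = exp x / cosh x" "1 - tanh x = exp (- x) / cosh x"
    by (simp_all add: tanh_def field_simps cosh_plus_sinh cosh_minus_sinh)
  then have "(1 + tanh x) powr al = exp (al * x) / cosh x powr al"
    "(1 - tanh x) powr al = exp (- (al * x)) / cosh x powr al"
    by (simp_all add: powr_divide exp_powr_real mult.commute)
  then have "reinf al (tanh x) = ((exp (al * x) - exp (- (al * x))) / cosh x powr al) /
      ((exp (al * x) + exp (- (al * x))) / cosh x powr al)"
    by (simp add: reinf_def diff_divide_distrib add_divide_distrib)
  also have "\<dots> = tanh (al * x)"
    by (simp add: tanh_altdef)
  finally show ?thesis .
qed

lemma one_minus_tanh_square: "1 - (tanh x)\<^sup>2 = 1 / (cosh x)\<^sup>2" for x :: real
  by (simp add: tanh_def power_divide diff_divide_eq_iff hyperbolic_pythagoras)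

text \<open>Written so that the recurring hypothesis
  \<open>(cosh (al * a1))^2 < al * (cosh a1)^2\<close> says exactly that the slope at
  \<open>tanh a1\<close> exceeds \<open>1\<close>.\<close>

lemma reinf_has_derivative:
  fixes al x :: real
  shows "(reinf al has_real_derivative al * (cosh x)\<^sup>2 / (cosh (al * x))\<^sup>2) (at (tanh x))"
proof -
  have b: "tanh x \<in> {-1<..<1}" by (rule tanh_real_bounds)
  have "((\<lambda>s. tanh (al * artanh s)) has_real_derivative
      (1 - (tanh (al * artanh (tanh x)))\<^sup>2) * (al * (1 / (1 - (tanh x)\<^sup>2)))) (at (tanh x))"
    using b by (auto intro!: derivative_eq_intros simp: abs_less_iff)
  also have "(1 - (tanh (al * artanh (tanh x)))\<^sup>2) * (al * (1 / (1 - (tanh x)\<^sup>2))) =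
      al * (cosh x)\<^sup>2 / (cosh (al * x))\<^sup>2"
    by (simp add: artanh_tanh_real one_minus_tanh_square)
  finally show ?thesis
  proof (rule has_field_derivative_transform_within_open)
    fix s :: real assume "s \<in> {-1<..<1}"
    then obtain y where "s = tanh y" using obtain_tanh[of s] by (auto simp: abs_less_iff)
    then show "tanh (al * artanh s) = reinf al s" by (simp add: artanh_tanh_real reinf_tanh)
  qed (use b in auto)
qed

lemma continuous_on_reinf: "0 < al \<Longrightarrow> continuous_on {-1..1} (reinf al)"
  unfolding reinf_def
  by (intro continuous_intros continuous_on_powr') (auto simp: add_nonneg_eq_0_iff)

lemma reinf_deriv_bounds:
  fixes al x :: real
  assumes "1 \<le> al"
  shows "0 \<le> al * (cosh x)\<^sup>2 / (cosh (al * x))\<^sup>2" "al * (cosh x)\<^sup>2 / (cosh (al * x))\<^sup>2 \<le> al"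
proof -
  have "cosh \<bar>x\<bar> \<le> cosh \<bar>al * x\<bar>"
    using assms by (subst cosh_real_nonneg_le_iff) (auto simp: abs_mult mult_le_cancel_right1)
  then have "(cosh x)\<^sup>2 \<le> (cosh (al * x))\<^sup>2" by (intro power_mono) auto
  then show "al * (cosh x)\<^sup>2 / (cosh (al * x))\<^sup>2 \<le> al"
    using assms by (simp add: divide_le_eq)
  show "0 \<le> al * (cosh x)\<^sup>2 / (cosh (al * x))\<^sup>2" using assms by simp
qed

lemma reinf_diff_bounds:
  assumes al: "1 \<le> al" and st: "- 1 \<le> s" "s \<le> t" "t \<le> 1"
  shows "0 \<le> reinf al t - reinf al s" "reinf al t - reinf al s \<le> al * (t - s)"
proof -
  have "0 \<le> reinf al t - reinf al s \<and> reinf al t - reinf al s \<le> al * (t - s)"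
  proof (cases "s = t")
    case False
    with st have lt: "s < t" by simp
    have D: "\<exists>x. z = tanh x" if "s < z" "z < t" for z
      using that st obtain_tanh[of z] by (auto simp: abs_less_iff)
    have "\<exists>l z. s < z \<and> z < t \<and> (reinf al has_real_derivative l) (at z) \<and> reinf al t - reinf al s = (t - s) * l"
    proof (rule MVT[OF lt])
      show "continuous_on {s..t} (reinf al)"
        by (rule continuous_on_subset[OF continuous_on_reinf]) (use al st in auto)
      fix z assume "s < z" "z < t"
      with D reinf_has_derivative[of al] show "reinf al differentiable at z"
        by (metis real_differentiable_def)
    qed
    then obtain l z where z: "s < z" "z < t" and l: "(reinf al has_real_derivative l) (at z)"
      "reinf al t - reinf al s = (t - s) * l" by blast
    obtain x where "z = tanh x" using D z by blast
    with l(1) have "l = al * (cosh x)\<^sup>2 / (cosh (al * x))\<^sup>2"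
      using reinf_has_derivative DERIV_unique by blast
    with reinf_deriv_bounds[OF al, of x] have "0 \<le> l" "l \<le> al" by auto
    then show ?thesis unfolding l(2) using lt by (simp add: mult.commute)
  qed simp
  then show "0 \<le> reinf al t - reinf al s" "reinf al t - reinf al s \<le> al * (t - s)" by auto
qed

lemma reinf_mono: "1 \<le> al \<Longrightarrow> - 1 \<le> s \<Longrightarrow> s \<le> t \<Longrightarrow> t \<le> 1 \<Longrightarrow> reinf al s \<le> reinf al t"
  using reinf_diff_bounds(1)[of al s t] by simp

lemma reinf_lipschitz:
  assumes "1 \<le> al" "\<bar>s\<bar> \<le> 1" "\<bar>t\<bar> \<le> 1"
  shows "\<bar>reinf al s - reinf al t\<bar> \<le> al * \<bar>s - t\<bar>"
proof (cases "s \<le> t")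
  case True
  then show ?thesis using reinf_diff_bounds[of al s t] assms by (auto simp: abs_le_iff)
next
  case False
  then show ?thesis using reinf_diff_bounds[of al t s] assms by (auto simp: abs_le_iff)
qed

lemma abs_reinf_le: "1 \<le> al \<Longrightarrow> \<bar>s\<bar> \<le> 1 \<Longrightarrow> \<bar>reinf al s\<bar> \<le> 1"
  using reinf_mono[of al "-1" s] reinf_mono[of al s 1] by (auto simp: abs_le_iff)

lemma abs_reinf_less: "\<bar>s\<bar> < 1 \<Longrightarrow> \<bar>reinf al s\<bar> < 1"
  using tanh_real_bounds by (elim obtain_tanh) (auto simp: reinf_tanh abs_less_iff minus_less_iff)

lemma reinf_greater:
  assumes "1 < al" "0 < s" "s < 1"
  shows "s < reinf al s"
proof -
  obtain x where "s = tanh x" using obtain_tanh[of s] assms by auto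
  then show ?thesis using assms by (auto simp: reinf_tanh mult_less_cancel_right1)
qed

lemma reinf_ge:
  assumes "1 < al" "0 \<le> s" "s \<le> 1"
  shows "s \<le> reinf al s"
  using reinf_greater[of al s] assms by (cases "s = 0 \<or> s = 1") auto

text \<open>Points of equal sign are handled by \<open>tanh_gap_less\<close> and oddness, points of
  opposite sign by the sign of the gap. Applied to \<open>- t\<close> and \<open>s\<close>, this
  yields \<open>s + t <= reinf al s + reinf al t\<close> for \<open>s + t >= 0\<close>, the source
  of the repulsion from balance.\<close>

lemma reinf_gap_mono:
  assumes al: "1 < al" and K: "(cosh (al * a1))\<^sup>2 < al * (cosh a1)\<^sup>2"
    and st: "- tanh a1 \<le> s" "s \<le> t" "t \<le> tanh a1"
  shows "reinf al s - s \<le> reinf al t - t"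
proof -
  have "- tanh a1 \<ge> -1" "tanh a1 \<le> 1" using tanh_real_bounds[of a1] by auto
  moreover have "\<bar>tanh a1\<bar> < 1" using tanh_real_bounds[of a1] by auto
  ultimately have "\<bar>s\<bar> < 1" "\<bar>t\<bar> < 1" using st by auto
  then obtain x y where xy: "s = tanh x" "t = tanh y" using obtain_tanh by metis
  then have "tanh (- a1) \<le> tanh x" "tanh x \<le> tanh y" "tanh y \<le> tanh a1" using st by simp_all
  then have le: "- a1 \<le> x" "x \<le> y" "y \<le> a1" by (simp_all only: tanh_real_le_iff)
  have "tanh_gap al x \<le> tanh_gap al y"
  proof (cases "x = y")
    case False
    then have lt: "x < y" using le by simp
    consider "0 \<le> x" | "y \<le> 0" | "x < 0" "0 < y" by linarith
    then show ?thesis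
    proof cases
      case 1
      then show ?thesis using tanh_gap_less[OF al K 1 lt] le by simp
    next
      case 2
      then show ?thesis using tanh_gap_less[OF al K, of "- y" "- x"] le lt by simp
    next
      case 3
      then show ?thesis using tanh_gap_pos[OF al, of y] tanh_gap_pos[OF al, of "- x"] by simp
    qed
  qed simp
  then show ?thesis by (simp add: xy reinf_tanh tanh_gap_def)
qed

text \<open>The argument \<open>s\<close> belongs to the urn in question and \<open>t\<close> to the
  other one, so the second component of the field is obtained by swapping. The midpoint stands for
  the total proportion, which weighs the urns by their sizes; \<open>tprop_near\<close> controls the
  difference.\<close>

definition drift :: "real \<Rightarrow> real \<Rightarrow> real \<Rightarrow> real \<Rightarrow> real" where
  "drift al p s t = p * reinf al ((s + t) / 2) + (1 - p) * reinf al s - s"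

lemma drift_minus: "drift al p (- s) (- t) = - drift al p s t"
proof -
  have "(- s + - t) / 2 = - ((s + t) / 2)" by (simp only: minus_divide_left minus_add_distrib)
  then have "reinf al ((- s + - t) / 2) = - reinf al ((s + t) / 2)" by (simp only: reinf_minus)
  then show ?thesis by (simp add: drift_def algebra_simps)
qed

lemma drift_1_zero:
  assumes "0 < p" "t \<le> 1" "- 1 \<le> t" "drift al p 1 t = 0"
  shows "t = 1"
proof (rule ccontr)
  assume "t \<noteq> 1"
  then have "\<bar>(1 + t) / 2\<bar> < 1" using assms by auto
  then have "reinf al ((1 + t) / 2) < 1" using abs_reinf_less by (meson abs_less_iff)
  with assms show False by (simp add: drift_def)
qed

text \<open>Subtracting the two equations eliminates the interaction and gives the equality in
  \<open>antisymmetric_zero\<close>; adding them and using that reinforcement moves the nonnegative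
  midpoint outward gives the inequality there.\<close>

lemma drift_zero_interior:
  assumes al: "1 < al" "al < 3" and a1: "0 < a1" and K: "(cosh (al * a1))\<^sup>2 < al * (cosh a1)\<^sup>2"
    and p: "0 < p" "p \<le> 1" and pl: "(1 - p) * (2 * sinh ((al - 1) * a1)) < p * sinh (2 * a1)"
    and st: "\<bar>s\<bar> < 1" "\<bar>t\<bar> < 1" "t \<le> s" "0 \<le> s + t"
    and z: "drift al p s t = 0" "drift al p t s = 0"
  shows "t = - s \<and> \<bar>s\<bar> < tanh a1"
proof (cases "s = t")
  case True
  then have "reinf al s = s" using z by (simp add: drift_def algebra_simps)
  then have "s = 0" using reinf_greater[OF al(1), of s] st True by force
  then show ?thesis using True a1 by simp
next
  case False
  obtain a where a: "s = tanh a" using obtain_tanh st by metis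
  obtain b' where "t = tanh b'" using obtain_tanh st by metis
  then obtain b where b: "t = - tanh b" by (metis minus_minus tanh_minus)
  have "tanh (- b) < tanh a" "tanh b \<le> tanh a" using False st a b by auto
  then have ab: "b \<le> a" "0 < a + b" by (simp_all only: tanh_real_le_iff tanh_real_less_iff)
  have E: "(1 - p) * reinf al s = s - p * reinf al ((s + t) / 2)"
    "(1 - p) * reinf al t = t - p * reinf al ((s + t) / 2)"
    using z by (simp_all add: drift_def add.commute)
  have "(1 - p) * (reinf al s - reinf al t) = s - t" unfolding right_diff_distrib E by simp
  then have E1: "(1 - p) * (tanh (al * a) + tanh (al * b)) = tanh a + tanh b"
    by (simp add: a b reinf_tanh)
  have "(1 - p) * (reinf al s + reinf al t) = s + t - 2 * (p * reinf al ((s + t) / 2))"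
    unfolding distrib_left E by simp
  also have "\<dots> \<le> s + t - 2 * (p * ((s + t) / 2))"
    using reinf_ge[OF al(1), of "(s + t) / 2"] st p
    by (intro diff_left_mono mult_left_mono) auto
  also have "\<dots> = (1 - p) * (s + t)" by (simp add: algebra_simps)
  finally have "(1 - p) * (tanh (al * a) - tanh (al * b)) \<le> (1 - p) * (tanh a - tanh b)"
    by (simp add: a b reinf_tanh)
  from antisymmetric_zero[OF al a1 K p pl ab E1 this] have "a = b" "a < a1" by auto
  then show ?thesis using ab by (simp add: a b)
qed

text \<open>Swapping urns and swapping colours reduce the interior to the case already treated. On
  the boundary, one urn of a single colour can rest only if the midpoint is extreme too, because
  \<open>p > 0\<close>.\<close>

lemma drift_zeros:
  assumes al: "1 < al" "al < 3" and a1: "0 < a1" and K: "(cosh (al * a1))\<^sup>2 < al * (cosh a1)\<^sup>2"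
    and p: "0 < p" "p \<le> 1" and pl: "(1 - p) * (2 * sinh ((al - 1) * a1)) < p * sinh (2 * a1)"
    and st: "\<bar>s\<bar> \<le> 1" "\<bar>t\<bar> \<le> 1"
    and z: "drift al p s t = 0" "drift al p t s = 0"
  shows "\<bar>s + t\<bar> = 2 \<or> (t = - s \<and> \<bar>s\<bar> < tanh a1)"
proof (cases "\<bar>s\<bar> < 1 \<and> \<bar>t\<bar> < 1")
  case True
  note I = drift_zero_interior[OF al a1 K p pl]
  have zm: "drift al p (- s) (- t) = 0" "drift al p (- t) (- s) = 0" using z by (simp_all add: drift_minus)
  consider "t \<le> s" "0 \<le> s + t" | "s \<le> t" "0 \<le> s + t" | "t \<le> s" "s + t \<le> 0" | "s \<le> t" "s + t \<le> 0"
    by linarith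
  then show ?thesis
  proof cases
    case 1
    then show ?thesis using I[of s t] True z by simp
  next
    case 2
    then show ?thesis using I[of t s] True z by auto
  next
    case 3
    then show ?thesis using I[of "- t" "- s"] True zm by auto
  next
    case 4
    then show ?thesis using I[of "- s" "- t"] True zm by auto
  qed
next
  case False
  then consider "s = 1" | "s = -1" | "t = 1" | "t = - 1" using st by (auto simp: abs_if split: if_splits)
  then show ?thesis
  proof cases
    case 1
    then show ?thesis using drift_1_zero[of p t al] p st z by auto
  next
    case 2
    then show ?thesis using drift_1_zero[of p "-t" al] drift_minus[of al p s t] p st z by auto
  next
    case 3
    then show ?thesis using drift_1_zero[of p s al] p st z by auto
  next
    case 4
    then show ?thesis using drift_1_zero[of p "-s" al] drift_minus[of al p t s] p st z by auto
  qed
qed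

text \<open>Compactness: the part of the square away from the admissible zeros is closed and carries
  no zero, so the larger of the two drift components is bounded below on it.\<close>

lemma drift_small:
  assumes al: "1 < al" "al < 3" and a1: "0 < a1" and K: "(cosh (al * a1))\<^sup>2 < al * (cosh a1)\<^sup>2"
    and p: "0 < p" "p \<le> 1" and pl: "(1 - p) * (2 * sinh ((al - 1) * a1)) < p * sinh (2 * a1)"
    and e: "0 < e"
  obtains d where "0 < d"
    "\<And>s t. \<bar>s\<bar> \<le> 1 \<Longrightarrow> \<bar>t\<bar> \<le> 1 \<Longrightarrow> \<bar>drift al p s t\<bar> < d \<Longrightarrow> \<bar>drift al p t s\<bar> < d \<Longrightarrow>
      (\<bar>s + t\<bar> < e \<and> \<bar>s\<bar> < tanh a1 \<and> \<bar>t\<bar> < tanh a1) \<or> 2 - e < \<bar>s + t\<bar>"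
proof -
  define S where "S = ({-1..1} \<times> {-1..1}) \<inter>
     (({z. e \<le> \<bar>fst z + snd z\<bar>} \<union> {z. tanh a1 \<le> \<bar>fst z\<bar>} \<union> {z. tanh a1 \<le> \<bar>snd z\<bar>}) \<inter>
      {z :: real \<times> real. \<bar>fst z + snd z\<bar> \<le> 2 - e})"
  define g where "g z = max \<bar>drift al p (fst z) (snd z)\<bar> \<bar>drift al p (snd z) (fst z)\<bar>" for z
  have "compact S" unfolding S_def
    by (intro compact_Int_closed compact_Times compact_Icc closed_Int closed_Un closed_Collect_le)
      (auto intro!: continuous_intros)
  moreover have "continuous_on S g"
  proof -
    have c: "continuous_on S (\<lambda>z. reinf al (h z))" if "continuous_on S h" "h ` S \<subseteq> {-1..1}" for h
      using continuous_on_compose[OF that(1) continuous_on_subset[OF continuous_on_reinf that(2)]] al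
      by (simp add: o_def)
    have "(\<lambda>z. (fst z + snd z) / 2) ` S \<subseteq> {-1..1}" "(\<lambda>z. (snd z + fst z) / 2) ` S \<subseteq> {-1..1}"
      "fst ` S \<subseteq> {-1..1}" "snd ` S \<subseteq> {-1..1}"
      by (auto simp: S_def)
    then show ?thesis unfolding g_def drift_def
      by (intro continuous_intros c) auto
  qed
  moreover have pos: "0 < g z" if "z \<in> S" for z
  proof (rule ccontr)
    assume "\<not> 0 < g z"
    then have "drift al p (fst z) (snd z) = 0" "drift al p (snd z) (fst z) = 0"
      by (auto simp: g_def)
    moreover have "\<bar>fst z\<bar> \<le> 1" "\<bar>snd z\<bar> \<le> 1" using that by (auto simp: S_def)
    ultimately have "\<bar>fst z + snd z\<bar> = 2 \<or> (snd z = - fst z \<and> \<bar>fst z\<bar> < tanh a1)"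
      using drift_zeros[OF al a1 K p pl] by blast
    with that e show False by (auto simp: S_def)
  qed
  ultimately obtain d where d: "0 < d" "\<And>z. z \<in> S \<Longrightarrow> d \<le> g z"
  proof (cases "S = {}")
    case False
    with \<open>compact S\<close> \<open>continuous_on S g\<close> obtain z where "z \<in> S" "\<And>y. y \<in> S \<Longrightarrow> g z \<le> g y"
      using continuous_attains_inf by metis
    with pos that show ?thesis by blast
  qed (use zero_less_one in blast)
  show ?thesis
  proof (rule that[OF d(1)])
    fix s t assume "\<bar>s\<bar> \<le> 1" "\<bar>t\<bar> \<le> 1" "\<bar>drift al p s t\<bar> < d" "\<bar>drift al p t s\<bar> < d"
    then show "(\<bar>s + t\<bar> < e \<and> \<bar>s\<bar> < tanh a1 \<and> \<bar>t\<bar> < tanh a1) \<or> 2 - e < \<bar>s + t\<bar>"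
      using d(2)[of "(s, t)"] by (force simp: S_def g_def abs_le_iff)
  qed
qed

section \<open>The law of the chain\<close>

lemma measurable_coordinate [measurable]:
  "(\<lambda>\<omega>. \<omega> n) \<in> measurable (urn_law al p c0) (count_space UNIV)"
  unfolding measurable_cong_sets[OF sets_urn_law refl]
  by (rule measurable_component_singleton) simp

lemma measurable_prefix [measurable]:
  "(\<lambda>\<omega>. map \<omega> [0..<n]) \<in> measurable (urn_law al p c0) (count_space UNIV)"
proof (induction n)
  case (Suc n)
  have "(\<lambda>\<omega>. (\<lambda>l \<omega>. l @ [\<omega> n]) (map \<omega> [0..<n]) \<omega>) \<in> measurable (urn_law al p c0) (count_space UNIV)"
  proof (rule measurable_compose_countable[OF _ Suc])
    fix l :: "config list"
    show "(\<lambda>\<omega>. l @ [\<omega> n]) \<in> measurable (urn_law al p c0) (count_space UNIV)"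
      by (rule measurable_compose[OF measurable_coordinate]) simp
  qed
  then show ?case by simp
qed simp

text \<open>\<open>h\<close> depends only on the coordinates up to time \<open>n\<close>; this replaces adaptedness to a filtration.\<close>

definition past_dep :: "nat \<Rightarrow> ((nat \<Rightarrow> config) \<Rightarrow> 'a) \<Rightarrow> bool" where
  "past_dep n h \<longleftrightarrow> (\<forall>\<omega> \<omega>'. (\<forall>k\<le>n. \<omega> k = \<omega>' k) \<longrightarrow> h \<omega> = h \<omega>')"

lemma past_depI:
  assumes "\<And>\<omega> \<omega>'. (\<And>k. k \<le> n \<Longrightarrow> \<omega> k = \<omega>' k) \<Longrightarrow> h \<omega> = h \<omega>'"
  shows "past_dep n h"
proof (unfold past_dep_def, intro allI impI)
  fix \<omega> \<omega>' :: "nat \<Rightarrow> config" assume "\<forall>k\<le>n. \<omega> k = \<omega>' k"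
  then show "h \<omega> = h \<omega>'" by (intro assms) blast
qed

lemma past_dep_Collect:
  assumes "past_dep n (\<lambda>\<omega>. \<omega> \<in> S)"
  shows "past_dep n (\<lambda>\<omega>. \<omega> \<in> {\<omega> \<in> S. Q (\<omega> n)})"
proof (rule past_depI)
  fix \<omega> \<omega>' :: "nat \<Rightarrow> config" assume w: "\<And>i. i \<le> n \<Longrightarrow> \<omega> i = \<omega>' i"
  then have "\<omega> \<in> S \<longleftrightarrow> \<omega>' \<in> S" using assms by (simp add: past_dep_def)
  then show "\<omega> \<in> {\<omega> \<in> S. Q (\<omega> n)} \<longleftrightarrow> \<omega>' \<in> {\<omega> \<in> S. Q (\<omega> n)}" using w[of n] by simp
qed

lemma past_dep_prefix:
  assumes "past_dep n h"
  shows "h \<omega> = h (\<lambda>k. map \<omega> [0..<Suc n] ! k)"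
  by (rule assms[unfolded past_dep_def, rule_format]) (simp del: upt_Suc)

text \<open>Such a function factors through the list of the first \<open>Suc n\<close>
  configurations, an element of a countable type on which every function is measurable.\<close>

lemma measurable_past_dep:
  assumes "past_dep n h"
  shows "h \<in> measurable (urn_law al p c0) (count_space UNIV)"
proof -
  have "(\<lambda>\<omega>. (\<lambda>l. h (\<lambda>k. l ! k)) (map \<omega> [0..<Suc n])) \<in> measurable (urn_law al p c0) (count_space UNIV)"
    by (rule measurable_compose[OF measurable_prefix]) simp
  also have "(\<lambda>\<omega>. (\<lambda>l. h (\<lambda>k. l ! k)) (map \<omega> [0..<Suc n])) = h"
    by (intro ext past_dep_prefix[OF assms, symmetric])
  finally show ?thesis .
qed

lemma sets_past_dep:
  assumes "past_dep n (\<lambda>\<omega>. \<omega> \<in> A)"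
  shows "A \<in> sets (urn_law al p c0)"
proof -
  have "(\<lambda>\<omega>. \<omega> \<in> A) -` {True} \<inter> space (urn_law al p c0) \<in> sets (urn_law al p c0)"
    by (rule measurable_sets[OF measurable_past_dep[OF assms]]) simp
  also have "(\<lambda>\<omega>. \<omega> \<in> A) -` {True} \<inter> space (urn_law al p c0) = A"
    by (auto simp: space_PiM)
  finally show ?thesis .
qed

lemma sets_tendsto:
  fixes f :: "nat \<Rightarrow> (nat \<Rightarrow> config) \<Rightarrow> real"
  assumes f: "\<And>n. past_dep n (f n)"
  shows "{\<omega>. (\<lambda>n. f n \<omega>) \<longlonglongrightarrow> x} \<in> sets (urn_law al p c0)"
proof -
  have S: "{\<omega>. \<bar>f n \<omega> - x\<bar> < inverse (real (Suc m))} \<in> sets (urn_law al p c0)" for n m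
  proof (rule sets_past_dep[of n], rule past_depI)
    fix \<omega> \<omega>' :: "nat \<Rightarrow> config" assume "\<And>k. k \<le> n \<Longrightarrow> \<omega> k = \<omega>' k"
    then have "f n \<omega> = f n \<omega>'" using f[of n] by (simp add: past_dep_def)
    then show "(\<omega> \<in> {\<omega>. \<bar>f n \<omega> - x\<bar> < inverse (real (Suc m))}) = (\<omega>' \<in> {\<omega>. \<bar>f n \<omega> - x\<bar> < inverse (real (Suc m))})"
      by simp
  qed
  have "(\<lambda>n. f n \<omega>) \<longlonglongrightarrow> x \<longleftrightarrow> (\<forall>m. \<exists>N. \<forall>n\<in>{N..}. \<bar>f n \<omega> - x\<bar> < inverse (real (Suc m)))" for \<omega>
  proof
    assume "(\<lambda>n. f n \<omega>) \<longlonglongrightarrow> x"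
    then show "\<forall>m. \<exists>N. \<forall>n\<in>{N..}. \<bar>f n \<omega> - x\<bar> < inverse (real (Suc m))"
      unfolding lim_sequentially dist_real_def by (metis atLeast_iff inverse_positive_iff_positive of_nat_0_less_iff zero_less_Suc)
  next
    assume R: "\<forall>m. \<exists>N. \<forall>n\<in>{N..}. \<bar>f n \<omega> - x\<bar> < inverse (real (Suc m))"
    show "(\<lambda>n. f n \<omega>) \<longlonglongrightarrow> x"
    proof (rule LIMSEQ_I)
      fix r :: real assume "0 < r"
      then obtain m where "inverse (real (Suc m)) < r" using reals_Archimedean by blast
      with R show "\<exists>N. \<forall>n\<ge>N. norm (f n \<omega> - x) < r" by (metis atLeast_iff order_less_trans real_norm_def)
    qed
  qed
  then have "{\<omega>. (\<lambda>n. f n \<omega>) \<longlonglongrightarrow> x} = (\<Inter>m. \<Union>N. \<Inter>n\<in>{N..}. {\<omega>. \<bar>f n \<omega> - x\<bar> < inverse (real (Suc m))})"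
    by auto
  also have "\<dots> \<in> sets (urn_law al p c0)"
    by (intro sets.countable_INT' sets.countable_UN sets.countable_INT'' image_subsetI S) (use S in auto)
  finally show ?thesis .
qed

lemma AE_urn_start: "AE \<omega> in urn_law al p c0. \<omega> 0 = c0"
proof -
  have "AE \<omega> in urn_law al p c0. \<omega> 0 \<noteq> c" if "c \<noteq> c0" for c
  proof (rule AE_I')
    have "{\<omega>. \<omega> 0 = c} \<in> sets (urn_law al p c0)"
      by (rule sets_past_dep[of 0]) (auto simp: past_dep_def)
    then show "{\<omega>. \<omega> 0 = c} \<in> null_sets (urn_law al p c0)"
      using emeasure_urn_law_path[where \<alpha>=al and p=p and ?c0.0=c0 and n=0 and a="\<lambda>_. c"] that by (simp add: null_sets_def)
  qed auto
  then have "AE \<omega> in urn_law al p c0. \<forall>c. c \<noteq> c0 \<longrightarrow> \<omega> 0 \<noteq> c"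
    by (simp add: AE_all_countable)
  then show ?thesis by eventually_elim blast
qed

lemma prob_space_urn_law: "prob_space (urn_law al p c0)"
proof
  have S: "{\<omega>. \<omega> 0 = c0} \<in> sets (urn_law al p c0)"
    by (rule sets_past_dep[of 0]) (auto simp: past_dep_def)
  have "emeasure (urn_law al p c0) (space (urn_law al p c0)) = emeasure (urn_law al p c0) {\<omega>. \<omega> 0 = c0}"
  proof (rule emeasure_eq_AE)
    show "AE \<omega> in urn_law al p c0. \<omega> \<in> space (urn_law al p c0) \<longleftrightarrow> \<omega> \<in> {\<omega>. \<omega> 0 = c0}"
      using AE_urn_start[of c0 al p] by eventually_elim (simp add: space_PiM)
  qed (use S in auto)
  also have "\<dots> = 1"
    using emeasure_urn_law_path[where \<alpha>=al and p=p and ?c0.0=c0 and n=0 and a="\<lambda>_. c0"] by simp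
  finally show "emeasure (urn_law al p c0) (space (urn_law al p c0)) = 1" .
qed

section \<open>Markov property, path properties and a maximal inequality\<close>

lemma nn_integral_countable_rv:
  fixes X :: "'a \<Rightarrow> 'b :: countable"
  assumes X: "X \<in> measurable M (count_space UNIV)"
  shows "(\<integral>\<^sup>+\<omega>. f (X \<omega>) \<partial>M) = (\<integral>\<^sup>+x. emeasure M (X -` {x} \<inter> space M) * f x \<partial>count_space UNIV)"
proof -
  have "distr M (count_space UNIV) X = density (count_space UNIV) (\<lambda>x. emeasure M (X -` {x} \<inter> space M))"
    by (rule measure_eqI_countable[where A=UNIV]) (use X in \<open>auto simp: emeasure_distr emeasure_density\<close>)
  then show ?thesis
    using nn_integral_distr[OF X, of f] by (simp add: nn_integral_density)
qed

text \<open>The probability of a path prefix followed by one more state is that of the prefix times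
  the transition weight; summing over the countably many prefixes gives the identity. It plays the
  role of conditioning on the past.\<close>

lemma nn_integral_markov:
  assumes h: "past_dep n h"
  shows "(\<integral>\<^sup>+\<omega>. h \<omega> (\<omega> (Suc n)) \<partial>urn_law al p c0) =
    (\<integral>\<^sup>+\<omega>. (\<integral>\<^sup>+c. h \<omega> c \<partial>measure_pmf (urn_step al p (\<omega> n))) \<partial>urn_law al p c0)"
proof -
  let ?M = "urn_law al p c0"
  define P where "P \<omega> = map \<omega> [0..<Suc n]" for \<omega> :: "nat \<Rightarrow> config"
  define X where "X \<omega> = (P \<omega>, \<omega> (Suc n))" for \<omega> :: "nat \<Rightarrow> config"
  define H where "H l = h (\<lambda>k. l ! k)" for l :: "config list"
  have hH: "h \<omega> = H (P \<omega>)" for \<omega>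
    unfolding H_def P_def by (rule past_dep_prefix[OF h])
  have P: "P \<in> measurable ?M (count_space UNIV)"
    using measurable_prefix[of "Suc n" al p c0] by (simp add: P_def[abs_def] del: upt_Suc)
  have X: "X \<in> measurable ?M (count_space UNIV)"
  proof -
    have "(\<lambda>\<omega>. (\<lambda>l \<omega>. (l, \<omega> (Suc n))) (P \<omega>) \<omega>) \<in> measurable ?M (count_space UNIV)"
    proof (rule measurable_compose_countable[OF _ P])
      fix l :: "config list"
      show "(\<lambda>\<omega>. (l, \<omega> (Suc n))) \<in> measurable ?M (count_space UNIV)"
        by (rule measurable_compose[OF measurable_coordinate]) simp
    qed
    then show ?thesis by (simp add: X_def[abs_def])
  qed
  have len: "P \<omega> = l \<longleftrightarrow> length l = Suc n \<and> (\<forall>k\<le>n. \<omega> k = l ! k)" for \<omega> l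
    unfolding P_def by (auto simp: list_eq_iff_nth_eq less_Suc_eq_le simp del: upt_Suc)
  have eX: "emeasure ?M (X -` {(l, c)} \<inter> space ?M) =
      emeasure ?M (P -` {l} \<inter> space ?M) * ennreal (pmf (urn_step al p (l ! n)) c)" for l c
  proof (cases "length l = Suc n")
    case True
    \<comment> \<open>The path formula needs a function on all times; the prefix extended by
      \<open>c\<close> supplies it on \<open>0..Suc n\<close>, and its values beyond are irrelevant.
      Lists of any other length have probability \<open>0\<close> on both sides.\<close>
    define a where "a = (\<lambda>k. (l @ [c]) ! k)"
    have a: "a k = l ! k" if "k \<le> n" for k using that True by (simp add: a_def nth_append)
    have "a (Suc n) = c" using True by (simp add: a_def nth_append)
    then have "X -` {(l, c)} \<inter> space ?M = {\<omega>. \<forall>k\<le>Suc n. \<omega> k = a k}"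
      using True a by (auto simp: X_def len space_PiM le_Suc_eq)
    moreover have "P -` {l} \<inter> space ?M = {\<omega>. \<forall>k\<le>n. \<omega> k = a k}"
      using True a by (simp add: vimage_def len space_PiM)
    ultimately show ?thesis
      using a[of n] \<open>a (Suc n) = c\<close>
      by (simp add: emeasure_urn_law_path ennreal_mult'' prod_nonneg)
  next
    case False
    then have "X -` {(l, c)} \<inter> space ?M = {}" "P -` {l} \<inter> space ?M = {}"
      using len by (auto simp: X_def)
    then show ?thesis by simp
  qed
  have "(\<integral>\<^sup>+\<omega>. h \<omega> (\<omega> (Suc n)) \<partial>?M) = (\<integral>\<^sup>+\<omega>. case_prod H (X \<omega>) \<partial>?M)"
    by (simp add: hH X_def)
  also have "\<dots> = (\<integral>\<^sup>+x. emeasure ?M (X -` {x} \<inter> space ?M) * case_prod H x \<partial>count_space UNIV)"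
    by (rule nn_integral_countable_rv[OF X])
  also have "\<dots> = (\<integral>\<^sup>+l. \<integral>\<^sup>+c. emeasure ?M (P -` {l} \<inter> space ?M) *
      (ennreal (pmf (urn_step al p (l ! n)) c) * H l c) \<partial>count_space UNIV \<partial>count_space UNIV)"
    unfolding nn_integral_fst_count_space[symmetric] eX by (simp add: mult.assoc)
  also have "\<dots> = (\<integral>\<^sup>+l. emeasure ?M (P -` {l} \<inter> space ?M) *
      (\<integral>\<^sup>+c. H l c \<partial>measure_pmf (urn_step al p (l ! n))) \<partial>count_space UNIV)"
    by (simp add: nn_integral_cmult nn_integral_measure_pmf)
  also have "\<dots> = (\<integral>\<^sup>+\<omega>. (\<integral>\<^sup>+c. H (P \<omega>) c \<partial>measure_pmf (urn_step al p (P \<omega> ! n))) \<partial>?M)"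
    by (rule nn_integral_countable_rv[OF P, symmetric])
  also have "\<dots> = (\<integral>\<^sup>+\<omega>. (\<integral>\<^sup>+c. h \<omega> c \<partial>measure_pmf (urn_step al p (\<omega> n))) \<partial>?M)"
  proof -
    have "P \<omega> ! n = \<omega> n" for \<omega> by (simp add: P_def del: upt_Suc)
    then show ?thesis by (simp add: hH)
  qed
  finally show ?thesis .
qed

lemma AE_urn_path:
  "AE \<omega> in urn_law al p c0. \<omega> 0 = c0 \<and> (\<forall>n. \<omega> (Suc n) \<in> set_pmf (urn_step al p (\<omega> n)))"
proof -
  let ?M = "urn_law al p c0"
  have "AE \<omega> in ?M. \<omega> (Suc n) \<in> set_pmf (urn_step al p (\<omega> n))" for n
  proof -
    let ?h = "\<lambda>\<omega> c. indicator (- set_pmf (urn_step al p (\<omega> n))) c :: ennreal"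
    have "(\<integral>\<^sup>+\<omega>. ?h \<omega> (\<omega> (Suc n)) \<partial>?M) =
      (\<integral>\<^sup>+\<omega>. (\<integral>\<^sup>+c. ?h \<omega> c \<partial>measure_pmf (urn_step al p (\<omega> n))) \<partial>?M)"
      by (rule nn_integral_markov) (auto intro!: past_depI)
    also have "\<dots> = 0"
    proof -
      have "(\<integral>\<^sup>+c. ?h \<omega> c \<partial>measure_pmf (urn_step al p (\<omega> n))) = 0" for \<omega>
        by (subst nn_integral_0_iff_AE) (auto simp: AE_measure_pmf_iff)
      then show ?thesis by simp
    qed
    finally have z: "(\<integral>\<^sup>+\<omega>. ?h \<omega> (\<omega> (Suc n)) \<partial>?M) = 0" .
    have "past_dep (Suc n) (\<lambda>\<omega>. ?h \<omega> (\<omega> (Suc n)))" by (auto intro!: past_depI)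
    then have "(\<lambda>\<omega>. ?h \<omega> (\<omega> (Suc n))) \<in> measurable ?M (count_space UNIV)"
      by (rule measurable_past_dep)
    then have "(\<lambda>\<omega>. ?h \<omega> (\<omega> (Suc n))) \<in> borel_measurable ?M"
      by (rule measurable_compose) simp
    from nn_integral_0_iff_AE[OF this] z show ?thesis
      by (auto elim!: eventually_mono split: split_indicator_asm)
  qed
  then have "AE \<omega> in ?M. \<forall>n. \<omega> (Suc n) \<in> set_pmf (urn_step al p (\<omega> n))"
    by (simp add: AE_all_countable)
  moreover note AE_urn_start[where al=al and p=p and ?c0.0=c0]
  ultimately show ?thesis by eventually_elim simp
qed

text \<open>Doob's inequality for a nonnegative supermartingale, started on an event of the past at
  time \<open>k\<close>. The supermartingale property is demanded only inside \<open>G\<close> and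
  below the level \<open>l\<close>, since the process is stopped at the level and killed on leaving
  \<open>G\<close>.\<close>

lemma maximal_inequality:
  fixes V :: "nat \<Rightarrow> config \<Rightarrow> ennreal" and l :: ennreal
  assumes A: "past_dep k (\<lambda>\<omega>. \<omega> \<in> A)"
    and V: "\<And>n c. k \<le> n \<Longrightarrow> c \<in> G n \<Longrightarrow> V n c < l \<Longrightarrow>
      (\<integral>\<^sup>+c'. V (Suc n) c' \<partial>measure_pmf (urn_step al p c)) \<le> V n c"
  shows "l * emeasure (urn_law al p c0) {\<omega> \<in> A. \<exists>j\<ge>k. l \<le> V j (\<omega> j) \<and> (\<forall>i\<in>{k..<j}. \<omega> i \<in> G i)}
    \<le> (\<integral>\<^sup>+\<omega>. indicator A \<omega> * V k (\<omega> k) \<partial>urn_law al p c0)"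
proof -
  let ?M = "urn_law al p c0"
  define B where "B m = {\<omega> \<in> A. \<exists>j\<in>{k..m}. l \<le> V j (\<omega> j) \<and> (\<forall>i\<in>{k..<j}. \<omega> i \<in> G i)}" for m
  define C where "C m = {\<omega> \<in> A. \<forall>i\<in>{k..m}. V i (\<omega> i) < l \<and> (i < m \<longrightarrow> \<omega> i \<in> G i)}" for m
  have Am: "past_dep m (\<lambda>\<omega>. \<omega> \<in> A)" if "k \<le> m" for m
    using A that by (auto simp: past_dep_def)
  have depB: "past_dep m (\<lambda>\<omega>. \<omega> \<in> B m)" and depC: "past_dep m (\<lambda>\<omega>. \<omega> \<in> C m)" if "k \<le> m" for m
  proof -
    have Q: "(\<omega> \<in> B m \<longleftrightarrow> \<omega>' \<in> B m) \<and> (\<omega> \<in> C m \<longleftrightarrow> \<omega>' \<in> C m)" if w: "\<And>i. i \<le> m \<Longrightarrow> \<omega> i = \<omega>' i" for \<omega> \<omega>'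
    proof -
      have "\<omega> \<in> A \<longleftrightarrow> \<omega>' \<in> A" using Am[OF \<open>k \<le> m\<close>] w by (simp add: past_dep_def)
      moreover have "(l \<le> V j (\<omega> j) \<and> (\<forall>i\<in>{k..<j}. \<omega> i \<in> G i)) \<longleftrightarrow> (l \<le> V j (\<omega>' j) \<and> (\<forall>i\<in>{k..<j}. \<omega>' i \<in> G i))"
        if "j \<in> {k..m}" for j using that w by auto
      moreover have "(V i (\<omega> i) < l \<and> (i < m \<longrightarrow> \<omega> i \<in> G i)) \<longleftrightarrow> (V i (\<omega>' i) < l \<and> (i < m \<longrightarrow> \<omega>' i \<in> G i))"
        if "i \<in> {k..m}" for i using that w by auto
      ultimately show ?thesis unfolding B_def C_def by simp
    qed
    show "past_dep m (\<lambda>\<omega>. \<omega> \<in> B m)" "past_dep m (\<lambda>\<omega>. \<omega> \<in> C m)"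
      by (rule past_depI, use Q in blast)+
  qed
  have B [measurable]: "B m \<in> sets ?M" and C [measurable]: "C m \<in> sets ?M" if "k \<le> m" for m
    using sets_past_dep[OF depB[OF that]] sets_past_dep[OF depC[OF that]] by auto
  have Vm [measurable]: "(\<lambda>\<omega>. V j (\<omega> j)) \<in> borel_measurable ?M" for j
    by (rule measurable_compose[OF measurable_coordinate]) simp
  have split: "(\<integral>\<^sup>+\<omega>. l * indicator S \<omega> + indicator S' \<omega> * V j (\<omega> j) \<partial>?M) =
      l * emeasure ?M S + (\<integral>\<^sup>+\<omega>. indicator S' \<omega> * V j (\<omega> j) \<partial>?M)"
    if [measurable]: "S \<in> sets ?M" "S' \<in> sets ?M" for S S' j
    by (subst nn_integral_add) (auto simp: nn_integral_cmult_indicator that simp del: urn.PF.sets_lim)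
  \<comment> \<open>The left side is a lower bound for the mean of the stopped and killed process at
    time \<open>m\<close>: \<open>l\<close> on \<open>B m\<close>, where the level has been reached,
    and the current value on \<open>C m\<close>, where the path is still running.\<close>
  have main: "l * emeasure ?M (B m) + (\<integral>\<^sup>+\<omega>. indicator (C m) \<omega> * V m (\<omega> m) \<partial>?M)
      \<le> (\<integral>\<^sup>+\<omega>. indicator A \<omega> * V k (\<omega> k) \<partial>?M)" if "k \<le> m" for m
    using that
  proof (induction m rule: dec_induct)
    case base
    have "l * emeasure ?M (B k) + (\<integral>\<^sup>+\<omega>. indicator (C k) \<omega> * V k (\<omega> k) \<partial>?M) =
      (\<integral>\<^sup>+\<omega>. l * indicator (B k) \<omega> + indicator (C k) \<omega> * V k (\<omega> k) \<partial>?M)"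
      by (rule split[symmetric]) (use B[of k] C[of k] in blast)+
    also have "\<dots> \<le> (\<integral>\<^sup>+\<omega>. indicator A \<omega> * V k (\<omega> k) \<partial>?M)"
      by (rule nn_integral_mono) (auto simp: B_def C_def split: split_indicator)
    finally show ?case .
  next
    case (step m)
    have km: "k \<le> m" "k \<le> Suc m" using step by auto
    define D where "D = {\<omega> \<in> C m. \<omega> m \<in> G m}"
    have depD: "past_dep m (\<lambda>\<omega>. \<omega> \<in> D)"
      unfolding D_def by (rule past_dep_Collect[OF depC[OF km(1)]])
    have D [measurable]: "D \<in> sets ?M" by (rule sets_past_dep[OF depD])
    have "l * emeasure ?M (B (Suc m)) + (\<integral>\<^sup>+\<omega>. indicator (C (Suc m)) \<omega> * V (Suc m) (\<omega> (Suc m)) \<partial>?M) =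
      (\<integral>\<^sup>+\<omega>. l * indicator (B (Suc m)) \<omega> + indicator (C (Suc m)) \<omega> * V (Suc m) (\<omega> (Suc m)) \<partial>?M)"
      by (rule split[OF B[OF km(2)] C[OF km(2)], symmetric])
    also have "\<dots> \<le> (\<integral>\<^sup>+\<omega>. l * indicator (B m) \<omega> + indicator D \<omega> * V (Suc m) (\<omega> (Suc m)) \<partial>?M)"
    proof (rule nn_integral_mono)
      fix \<omega>
      consider (1) "\<omega> \<in> B m" | (2) "\<omega> \<notin> B m" "\<omega> \<in> B (Suc m)" | (3) "\<omega> \<notin> B (Suc m)" "\<omega> \<notin> B m"
        by blast
      then show "l * indicator (B (Suc m)) \<omega> + indicator (C (Suc m)) \<omega> * V (Suc m) (\<omega> (Suc m))
         \<le> l * indicator (B m) \<omega> + indicator D \<omega> * V (Suc m) (\<omega> (Suc m))"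
      proof cases
        case 1
        then obtain j where j: "\<omega> \<in> A" "j \<in> {k..m}" "l \<le> V j (\<omega> j)" "\<forall>i\<in>{k..<j}. \<omega> i \<in> G i"
          by (auto simp: B_def)
        then have "j \<in> {k..Suc m}" by simp
        with j have "\<omega> \<in> B (Suc m)" "\<omega> \<notin> C (Suc m)"
          unfolding B_def C_def by (blast, auto simp: not_less)
        with 1 show ?thesis by simp
      next
        case 2
        then obtain j where j: "\<omega> \<in> A" "j \<in> {k..Suc m}" "l \<le> V j (\<omega> j)" "\<forall>i\<in>{k..<j}. \<omega> i \<in> G i"
          by (auto simp: B_def)
        with 2 have jm: "j = Suc m" by (auto simp: B_def le_Suc_eq)
        have "V i (\<omega> i) < l" if "i \<in> {k..m}" for i
          using 2(1) j(1,4) that jm by (auto simp: B_def not_le[symmetric])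
        then have "\<omega> \<in> D" using j jm km by (auto simp: D_def C_def)
        moreover have "\<omega> \<notin> C (Suc m)" using j jm km by (auto simp: C_def not_less)
        ultimately show ?thesis using 2 j jm by simp
      next
        case 3
        have "\<omega> \<in> D" if "\<omega> \<in> C (Suc m)" using that km by (auto simp: C_def D_def)
        then show ?thesis using 3 by (auto split: split_indicator)
      qed
    qed
    also have "\<dots> = l * emeasure ?M (B m) + (\<integral>\<^sup>+\<omega>. indicator D \<omega> * V (Suc m) (\<omega> (Suc m)) \<partial>?M)"
      by (rule split[OF B[OF km(1)] D])
    also have "(\<integral>\<^sup>+\<omega>. indicator D \<omega> * V (Suc m) (\<omega> (Suc m)) \<partial>?M) =
      (\<integral>\<^sup>+\<omega>. (\<integral>\<^sup>+c. indicator D \<omega> * V (Suc m) c \<partial>measure_pmf (urn_step al p (\<omega> m))) \<partial>?M)"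
      by (rule nn_integral_markov) (use depD in \<open>auto intro!: past_depI simp: past_dep_def indicator_def fun_eq_iff\<close>)
    also have "\<dots> \<le> (\<integral>\<^sup>+\<omega>. indicator (C m) \<omega> * V m (\<omega> m) \<partial>?M)"
    proof (rule nn_integral_mono)
      fix \<omega>
      show "(\<integral>\<^sup>+c. indicator D \<omega> * V (Suc m) c \<partial>measure_pmf (urn_step al p (\<omega> m))) \<le> indicator (C m) \<omega> * V m (\<omega> m)"
      proof (cases "\<omega> \<in> D")
        case True
        then show ?thesis using V[of m "\<omega> m"] km by (auto simp: D_def C_def)
      qed simp
    qed
    finally show ?case using step.IH by (meson add_left_mono order_trans)
  qed
  have inc: "incseq (\<lambda>m. B (k + m))" by (force simp: incseq_def B_def)
  have "{\<omega> \<in> A. \<exists>j\<ge>k. l \<le> V j (\<omega> j) \<and> (\<forall>i\<in>{k..<j}. \<omega> i \<in> G i)} = (\<Union>m. B (k + m))"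
    by (fastforce simp: B_def nat_le_iff_add)
  then have "emeasure ?M {\<omega> \<in> A. \<exists>j\<ge>k. l \<le> V j (\<omega> j) \<and> (\<forall>i\<in>{k..<j}. \<omega> i \<in> G i)} = (SUP m. emeasure ?M (B (k + m)))"
    using SUP_emeasure_incseq[OF _ inc, of ?M] B by (simp add: image_subset_iff)
  moreover have "l * (SUP m. emeasure ?M (B (k + m))) \<le> (\<integral>\<^sup>+\<omega>. indicator A \<omega> * V k (\<omega> k) \<partial>?M)"
    unfolding SUP_mult_left_ennreal
  proof (rule SUP_least)
    fix m
    have "l * emeasure ?M (B (k + m)) \<le> l * emeasure ?M (B (k + m)) + (\<integral>\<^sup>+\<omega>. indicator (C (k + m)) \<omega> * V (k + m) (\<omega> (k + m)) \<partial>?M)"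
      by simp
    also have "\<dots> \<le> (\<integral>\<^sup>+\<omega>. indicator A \<omega> * V k (\<omega> k) \<partial>?M)" by (rule main) simp
    finally show "l * emeasure ?M (B (k + m)) \<le> (\<integral>\<^sup>+\<omega>. indicator A \<omega> * V k (\<omega> k) \<partial>?M)" .
  qed
  ultimately show ?thesis by simp
qed

section \<open>One step of the urns\<close>

definition sprop :: "urn \<Rightarrow> real" where
  "sprop u = (real (black u) - real (red u)) / (real (black u) + real (red u))"

definition tprop :: "config \<Rightarrow> real" where
  "tprop c = (real (black_total c) - real (red_total c)) / (real (black_total c) + real (red_total c))"

definition sg :: "bool \<Rightarrow> real" where
  "sg i = (if i then 1 else - 1)"

lemma sg_mult_self [simp]: "sg i * sg i = 1" "(sg i)\<^sup>2 = 1"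
  by (simp_all add: sg_def)

lemma abs_balance_le_1:
  fixes b r :: nat
  shows "\<bar>(real b - real r) / (real b + real r)\<bar> \<le> 1"
  by (cases "b + r = 0") (auto simp: abs_le_iff divide_le_eq le_divide_eq)

lemma abs_sprop_le_1: "\<bar>sprop u\<bar> \<le> 1"
  unfolding sprop_def by (rule abs_balance_le_1)

lemma abs_tprop_le_1: "\<bar>tprop c\<bar> \<le> 1"
  unfolding tprop_def by (rule abs_balance_le_1)

text \<open>Powers are homogeneous: rescaling both counts by \<open>2 / (b + r)\<close> turns them
  into \<open>1 + s\<close> and \<open>1 - s\<close>, and the common factor cancels.\<close>

lemma weight_ratio:
  fixes b r :: nat
  assumes "0 < b + r"
  shows "2 * (weight al b / (weight al b + weight al r)) - 1 = reinf al ((real b - real r) / (real b + real r))"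
proof -
  let ?N = "real b + real r"
  let ?k = "(2 / ?N) powr al"
  have N: "0 < ?N" using assms by linarith
  have "1 + (real b - real r) / ?N = (2 / ?N) * real b" "1 - (real b - real r) / ?N = (2 / ?N) * real r"
    using N by (simp_all add: field_simps)
  then have "(1 + (real b - real r) / ?N) powr al = ?k * weight al b"
    "(1 - (real b - real r) / ?N) powr al = ?k * weight al r"
    unfolding weight_def using N by (simp_all only: powr_mult)
  then have "reinf al ((real b - real r) / ?N) = (?k * (weight al b - weight al r)) / (?k * (weight al b + weight al r))"
    by (simp add: reinf_def right_diff_distrib distrib_left)
  also have "\<dots> = (weight al b - weight al r) / (weight al b + weight al r)"
    using N by simp
  also have "\<dots> = 2 * (weight al b / (weight al b + weight al r)) - 1"
  proof -
    have "0 < weight al b \<or> 0 < weight al r" "0 \<le> weight al b" "0 \<le> weight al r"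
      using assms by (auto simp: weight_def)
    then have "weight al b + weight al r \<noteq> 0" by linarith
    then show ?thesis by (simp add: field_simps)
  qed
  finally show ?thesis by simp
qed

lemma draw_prob_bounds:
  assumes "0 \<le> p" "p \<le> 1"
  shows "0 \<le> draw_prob al p c u" "draw_prob al p c u \<le> 1"
proof -
  define w where "w b r = weight al b / (weight al b + weight al r)" for b r
  have w: "0 \<le> w b r" "w b r \<le> 1" for b r
  proof -
    have "0 \<le> weight al b" "0 \<le> weight al r" by (simp_all add: weight_def)
    then show "0 \<le> w b r" "w b r \<le> 1" unfolding w_def by (auto simp: divide_le_eq_1)
  qed
  have eq: "draw_prob al p c u = p * w (black_total c) (red_total c) + (1 - p) * w (black u) (red u)"
    by (simp add: draw_prob_def w_def)
  show "0 \<le> draw_prob al p c u" unfolding eq using w assms by simp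
  have "draw_prob al p c u \<le> p * 1 + (1 - p) * 1"
    unfolding eq using w assms by (intro add_mono mult_left_mono) auto
  then show "draw_prob al p c u \<le> 1" by simp
qed

text \<open>The conditional mean of the signed colour \<open>sg\<close> of the next ball, as
  \<open>draw_prob_eq\<close> shows; unlike \<open>drift\<close>, it uses the exact total
  proportion.\<close>

definition draw_mean :: "real \<Rightarrow> real \<Rightarrow> config \<Rightarrow> urn \<Rightarrow> real" where
  "draw_mean al p c u = p * reinf al (tprop c) + (1 - p) * reinf al (sprop u)"

lemma draw_prob_eq:
  assumes "0 < black u + red u" "0 < black_total c + red_total c"
  shows "draw_prob al p c u = (1 + draw_mean al p c u) / 2"
proof -
  have "2 * draw_prob al p c u - 1 =
      p * (2 * (weight al (black_total c) / (weight al (black_total c) + weight al (red_total c))) - 1)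
     + (1 - p) * (2 * (weight al (black u) / (weight al (black u) + weight al (red u))) - 1)"
    by (simp add: draw_prob_def algebra_simps)
  also have "\<dots> = draw_mean al p c u"
    unfolding draw_mean_def tprop_def sprop_def
    by (simp only: weight_ratio[OF assms(1)] weight_ratio[OF assms(2)])
  finally show ?thesis by simp
qed

definition bump :: "config \<Rightarrow> bool \<Rightarrow> bool \<Rightarrow> config" where
  "bump c i j = (add_ball i (fst c), add_ball j (snd c))"

lemma set_pmf_urn_step: "set_pmf (urn_step al p c) \<subseteq> {bump c i j |i j. True}"
  by (auto simp: urn_step_def bump_def)

lemma nn_integral_urn_step:
  fixes al p :: real and g :: "config \<Rightarrow> real"
  assumes p: "0 \<le> p" "p \<le> 1" and g: "\<And>i j. 0 \<le> g (bump c i j)"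
  defines "q1 \<equiv> draw_prob al p c (fst c)" and "q2 \<equiv> draw_prob al p c (snd c)"
  shows "(\<integral>\<^sup>+c'. ennreal (g c') \<partial>measure_pmf (urn_step al p c)) =
    ennreal (q1 * (q2 * g (bump c True True) + (1 - q2) * g (bump c True False)) +
      (1 - q1) * (q2 * g (bump c False True) + (1 - q2) * g (bump c False False)))"
proof -
  have q: "0 \<le> q1" "q1 \<le> 1" "0 \<le> q2" "q2 \<le> 1"
    unfolding q1_def q2_def using draw_prob_bounds[OF p] by auto
  have r: "ennreal (g (bump c i True)) * ennreal q2 + ennreal (g (bump c i False)) * ennreal (1 - q2) =
      ennreal (q2 * g (bump c i True) + (1 - q2) * g (bump c i False))" for i
    using q g by (simp add: ennreal_mult'[symmetric] ennreal_plus[symmetric] mult.commute del: ennreal_plus)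
  have nn: "0 \<le> q2 * g (bump c i True) + (1 - q2) * g (bump c i False)" for i
    using q g by simp
  have "(\<integral>\<^sup>+c'. ennreal (g c') \<partial>measure_pmf (urn_step al p c)) =
    ennreal (q2 * g (bump c True True) + (1 - q2) * g (bump c True False)) * ennreal q1 +
    ennreal (q2 * g (bump c False True) + (1 - q2) * g (bump c False False)) * ennreal (1 - q1)"
    unfolding urn_step_def q1_def[symmetric] q2_def[symmetric]
    using q by (simp add: nn_integral_pair_pmf' bump_def[symmetric] r)
  also have "\<dots> = ennreal (q1 * (q2 * g (bump c True True) + (1 - q2) * g (bump c True False)) +
      (1 - q1) * (q2 * g (bump c False True) + (1 - q2) * g (bump c False False)))"
    using q nn by (simp add: ennreal_mult'[symmetric] ennreal_plus[symmetric] mult.commute del: ennreal_plus)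
  finally show ?thesis .
qed

text \<open>The draws are independent signs, so a majorant bilinear in \<open>sg i\<close> and
  \<open>sg j\<close> integrates to the same expression in the means. The second conclusion is
  recorded because \<open>ennreal\<close> would cut off a negative bound and spoil
  additivity.\<close>

lemma nn_integral_urn_step_le:
  fixes al p :: real and g :: "config \<Rightarrow> real"
  assumes p: "0 \<le> p" "p \<le> 1" and g: "\<And>i j. 0 \<le> g (bump c i j)"
    and le: "\<And>i j. g (bump c i j) \<le> a0 + a1 * sg i + a2 * sg j + a3 * (sg i * sg j)"
    and pos: "0 < black (fst c) + red (fst c)" "0 < black (snd c) + red (snd c)"
  defines "m1 \<equiv> draw_mean al p c (fst c)" and "m2 \<equiv> draw_mean al p c (snd c)"
  shows "(\<integral>\<^sup>+c'. ennreal (g c') \<partial>measure_pmf (urn_step al p c)) \<le> ennreal (a0 + a1 * m1 + a2 * m2 + a3 * (m1 * m2))"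
    and "0 \<le> a0 + a1 * m1 + a2 * m2 + a3 * (m1 * m2)"
proof -
  have t: "0 < black_total c + red_total c" using pos unfolding black_total_def red_total_def by linarith
  have q: "0 \<le> (1 + m1) / 2" "(1 + m1) / 2 \<le> 1" "0 \<le> (1 + m2) / 2" "(1 + m2) / 2 \<le> 1"
    unfolding m1_def m2_def using draw_prob_bounds[OF p] draw_prob_eq[OF _ t] pos by metis+
  let ?G = "\<lambda>i j. a0 + a1 * sg i + a2 * sg j + a3 * (sg i * sg j)"
  have "(\<integral>\<^sup>+c'. ennreal (g c') \<partial>measure_pmf (urn_step al p c)) =
    ennreal ((1 + m1) / 2 * ((1 + m2) / 2 * g (bump c True True) + (1 - (1 + m2) / 2) * g (bump c True False)) +
      (1 - (1 + m1) / 2) * ((1 + m2) / 2 * g (bump c False True) + (1 - (1 + m2) / 2) * g (bump c False False)))"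
    using nn_integral_urn_step[OF p, where g=g and c=c and al=al, OF g] draw_prob_eq[OF pos(1) t] draw_prob_eq[OF pos(2) t]
    by (simp add: m1_def m2_def)
  also have "\<dots> \<le> ennreal ((1 + m1) / 2 * ((1 + m2) / 2 * ?G True True + (1 - (1 + m2) / 2) * ?G True False) +
      (1 - (1 + m1) / 2) * ((1 + m2) / 2 * ?G False True + (1 - (1 + m2) / 2) * ?G False False))"
    using q by (intro ennreal_leI add_mono mult_left_mono le) (auto intro!: le)
  also have eq: "(1 + m1) / 2 * ((1 + m2) / 2 * ?G True True + (1 - (1 + m2) / 2) * ?G True False) +
      (1 - (1 + m1) / 2) * ((1 + m2) / 2 * ?G False True + (1 - (1 + m2) / 2) * ?G False False) =
      a0 + a1 * m1 + a2 * m2 + a3 * (m1 * m2)"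
    by (simp add: sg_def field_simps)
  finally show "(\<integral>\<^sup>+c'. ennreal (g c') \<partial>measure_pmf (urn_step al p c)) \<le> ennreal (a0 + a1 * m1 + a2 * m2 + a3 * (m1 * m2))" .
  define G where "G i j = ?G i j" for i j
  have "0 \<le> G i j" for i j using g[of i j] le[of i j] by (simp add: G_def)
  then have "0 \<le> (1 + m1) / 2 * ((1 + m2) / 2 * G True True + (1 - (1 + m2) / 2) * G True False) +
      (1 - (1 + m1) / 2) * ((1 + m2) / 2 * G False True + (1 - (1 + m2) / 2) * G False False)"
    using q by (intro add_nonneg_nonneg mult_nonneg_nonneg) auto
  then show "0 \<le> a0 + a1 * m1 + a2 * m2 + a3 * (m1 * m2)"
    unfolding G_def eq .
qed

lemma sprop_add_ball:
  assumes "0 < black u + red u"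
  shows "sprop (add_ball i u) = sprop u + (sg i - sprop u) / (real (black u) + real (red u) + 1)"
proof -
  let ?N = "real (black u) + real (red u)"
  have N: "0 < ?N" using assms by linarith
  have "sprop (add_ball i u) = (real (black u) - real (red u) + sg i) / (?N + 1)"
    by (auto simp: sprop_def add_ball_def sg_def algebra_simps)
  also have "real (black u) - real (red u) = sprop u * ?N" using N by (simp add: sprop_def)
  finally show ?thesis using N by (simp add: field_simps)
qed

text \<open>The reinforcement map is increasing, so its antiderivative is convex and lies above its
  tangents. This supplies the potential with a one-sided expansion that has no second order
  term.\<close>

lemma antiderivative_convex:
  assumes al: "1 \<le> al"
  obtains Ph where "Ph 0 = 0"
    "\<And>x y. \<bar>x\<bar> \<le> 1 \<Longrightarrow> \<bar>y\<bar> \<le> 1 \<Longrightarrow> Ph x + reinf al x * (y - x) \<le> Ph y"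
proof -
  have "continuous_on {-1..1} (reinf al)" using al by (intro continuous_on_reinf) simp
  then obtain G where G: "\<And>x. x \<in> {-1..1} \<Longrightarrow> (G has_real_derivative reinf al x) (at x within {-1..1})"
    using antiderivative_continuous[of "-1" 1 "reinf al"]
    by (auto simp: has_real_derivative_iff_has_vector_derivative)
  have mv: "\<exists>z. x < z \<and> z < y \<and> G y - G x = reinf al z * (y - x)" if "-1 \<le> x" "x < y" "y \<le> 1" for x y
  proof -
    have "\<exists>z\<in>{x<..<y}. G y - G x = (*) (reinf al z) (y - x)"
    proof (rule mvt_simple[OF that(2)])
      fix z assume z: "x \<le> z" "z \<le> y"
      have "(G has_real_derivative reinf al z) (at z within {x..y})"
        by (rule DERIV_subset[OF G]) (use z that in auto)
      then show "(G has_derivative (*) (reinf al z)) (at z within {x..y})"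
        by (simp add: has_field_derivative_def)
    qed
    then show ?thesis by auto
  qed
  have "G x + reinf al x * (y - x) \<le> G y" if xy: "\<bar>x\<bar> \<le> 1" "\<bar>y\<bar> \<le> 1" for x y
  proof -
    consider "x < y" | "y < x" | "x = y" by linarith
    then show ?thesis
    proof cases
      case 1
      then obtain z where z: "x < z" "z < y" "G y - G x = reinf al z * (y - x)"
        using mv[of x y] xy abs_le_iff by (metis minus_le_iff)
      have "reinf al x * (y - x) \<le> reinf al z * (y - x)"
        using reinf_mono[OF al, of x z] z xy by (intro mult_right_mono) auto
      with z(3) show ?thesis by linarith
    next
      case 2
      then obtain z where z: "y < z" "z < x" "G x - G y = reinf al z * (x - y)"
        using mv[of y x] xy abs_le_iff by (metis minus_le_iff)
      have "reinf al z * (x - y) \<le> reinf al x * (x - y)"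
        using reinf_mono[OF al, of z x] z xy by (intro mult_right_mono) auto
      with z show ?thesis by (simp add: algebra_simps)
    qed simp
  qed
  then show ?thesis by (intro that[of "\<lambda>x. G x - G 0"]) (auto simp: algebra_simps)
qed

text \<open>Taking expectations and telescoping bounds the expected total of the gains
  \<open>g\<close> by the initial mean of \<open>V\<close> plus the total error; a nonnegative
  variable with finite mean is almost surely finite.\<close>

lemma supermartingale_sum_finite:
  fixes V g :: "nat \<Rightarrow> config \<Rightarrow> ennreal" and e :: "nat \<Rightarrow> real"
  assumes Q: "AE \<omega> in urn_law al p c0. \<forall>n. Q n (\<omega> n)"
    and step: "\<And>n c. Q n c \<Longrightarrow>
      (\<integral>\<^sup>+c'. V (Suc n) c' \<partial>measure_pmf (urn_step al p c)) + g n c \<le> V n c + ennreal (e n)"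
    and e: "\<And>n. 0 \<le> e n" "summable e" and fin: "(\<integral>\<^sup>+\<omega>. V 0 (\<omega> 0) \<partial>urn_law al p c0) < \<infinity>"
  shows "AE \<omega> in urn_law al p c0. (\<Sum>n. g n (\<omega> n)) < \<infinity>"
proof -
  let ?M = "urn_law al p c0"
  interpret prob_space ?M by (rule prob_space_urn_law)
  have m [measurable]: "(\<lambda>\<omega>. f (\<omega> n)) \<in> borel_measurable ?M" for f :: "config \<Rightarrow> ennreal" and n
    by (rule measurable_compose[OF measurable_coordinate]) simp
  define a where "a n = (\<integral>\<^sup>+\<omega>. V n (\<omega> n) \<partial>?M)" for n
  define G where "G n = (\<integral>\<^sup>+\<omega>. g n (\<omega> n) \<partial>?M)" for n
  have rec: "a (Suc n) + G n \<le> a n + ennreal (e n)" for n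
  proof -
    have "a (Suc n) = (\<integral>\<^sup>+\<omega>. (\<integral>\<^sup>+c. V (Suc n) c \<partial>measure_pmf (urn_step al p (\<omega> n))) \<partial>?M)"
      unfolding a_def by (rule nn_integral_markov) (rule past_depI, simp)
    then have "a (Suc n) + G n = (\<integral>\<^sup>+\<omega>. (\<integral>\<^sup>+c. V (Suc n) c \<partial>measure_pmf (urn_step al p (\<omega> n))) + g n (\<omega> n) \<partial>?M)"
      unfolding G_def by (simp add: nn_integral_add m)
    also have "\<dots> \<le> (\<integral>\<^sup>+\<omega>. V n (\<omega> n) + ennreal (e n) \<partial>?M)"
      by (rule nn_integral_mono_AE) (use Q in \<open>eventually_elim, use step in blast\<close>)
    also have "\<dots> = a n + ennreal (e n)"
      by (simp add: nn_integral_add m a_def emeasure_space_1 del: urn.PF.space_lim)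
    finally show ?thesis .
  qed
  have tel: "(\<Sum>k<n. G k) + a n \<le> a 0 + (\<Sum>k<n. ennreal (e k))" for n
  proof (induction n)
    case (Suc n)
    have "(\<Sum>k<Suc n. G k) + a (Suc n) = (\<Sum>k<n. G k) + (a (Suc n) + G n)" by (simp add: ac_simps)
    also have "\<dots> \<le> (\<Sum>k<n. G k) + (a n + ennreal (e n))" by (intro add_left_mono rec)
    also have "\<dots> = ((\<Sum>k<n. G k) + a n) + ennreal (e n)" by (simp add: ac_simps)
    also have "\<dots> \<le> (a 0 + (\<Sum>k<n. ennreal (e k))) + ennreal (e n)" by (intro add_right_mono Suc)
    finally show ?case by (simp add: ac_simps)
  qed simp
  have "(\<Sum>n. G n) \<le> a 0 + (\<Sum>n. ennreal (e n))"
  proof (rule suminf_le_const)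
    fix n
    have "(\<Sum>k<n. G k) \<le> (\<Sum>k<n. G k) + a n" by simp
    also note tel
    also have "a 0 + (\<Sum>k<n. ennreal (e k)) \<le> a 0 + (\<Sum>n. ennreal (e n))"
      by (intro add_left_mono sum_le_suminf) auto
    finally show "(\<Sum>k<n. G k) \<le> a 0 + (\<Sum>n. ennreal (e n))" .
  qed auto
  also have "\<dots> < \<infinity>"
    using fin e by (simp add: a_def suminf_ennreal2 less_top)
  finally have "(\<integral>\<^sup>+\<omega>. (\<Sum>n. g n (\<omega> n)) \<partial>?M) < \<infinity>"
    by (simp add: nn_integral_suminf m G_def)
  then have "AE \<omega> in ?M. (\<Sum>n. g n (\<omega> n)) \<noteq> \<infinity>"
    by (intro nn_integral_PInf_AE) (auto intro!: borel_measurable_suminf_order m)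
  then show ?thesis by eventually_elim (simp add: less_top)
qed

text \<open>The increments of \<open>a\<^sup>3\<close> are dominated by \<open>a\<^sup>2 / (n + 1)\<close>, so \<open>a\<^sup>3\<close> converges.\<close>

lemma tendsto_0_if_weighted_square_summable:
  fixes a :: "nat \<Rightarrow> real"
  assumes C: "0 \<le> C" and d: "\<And>n. \<bar>a (Suc n) - a n\<bar> \<le> C / real (Suc n)"
    and s: "summable (\<lambda>n. (a n)\<^sup>2 / real (Suc n))"
  shows "a \<longlonglongrightarrow> 0"
proof -
  have bnd: "norm (a (Suc n) ^ 3 - a n ^ 3) \<le> 5 * C * ((a n)\<^sup>2 / real (Suc n)) + 3 * C ^ 3 * (1 / real (Suc n) ^ 2)" for n
  proof -
    let ?d = "a (Suc n) - a n" and ?r = "C / real (Suc n)"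
    have r: "0 \<le> ?r" using C by simp
    have "a (Suc n) ^ 3 - a n ^ 3 = ?d * (3 * (a n)\<^sup>2 + 3 * a n * ?d + ?d\<^sup>2)"
      by (simp add: power2_eq_square power3_eq_cube algebra_simps)
    moreover have "\<bar>3 * (a n)\<^sup>2 + 3 * a n * ?d + ?d\<^sup>2\<bar> \<le> 5 * (a n)\<^sup>2 + 3 * ?d\<^sup>2"
    proof -
      \<comment> \<open>The weights are chosen to give
        \<open>3 * |a * d| <= 2 * a^2 + 9/8 * d^2\<close>, which fits below the constants
        \<open>5\<close> and \<open>3\<close>.\<close>
      have "0 \<le> (4 * a n + 3 * ?d)\<^sup>2" "0 \<le> (4 * a n - 3 * ?d)\<^sup>2" by simp_all
      then have "3 * a n * ?d \<le> 2 * (a n)\<^sup>2 + 9/8 * ?d\<^sup>2" "- (3 * a n * ?d) \<le> 2 * (a n)\<^sup>2 + 9/8 * ?d\<^sup>2"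
        by (simp_all add: power2_eq_square algebra_simps)
      moreover have "0 \<le> (a n)\<^sup>2" "0 \<le> ?d\<^sup>2" by simp_all
      ultimately show ?thesis by linarith
    qed
    moreover have "?d\<^sup>2 \<le> ?r\<^sup>2" using d[of n] r by (metis abs_le_square_iff abs_of_nonneg)
    ultimately have q: "\<bar>3 * (a n)\<^sup>2 + 3 * a n * ?d + ?d\<^sup>2\<bar> \<le> 5 * (a n)\<^sup>2 + 3 * ?r\<^sup>2"
      and eq: "a (Suc n) ^ 3 - a n ^ 3 = ?d * (3 * (a n)\<^sup>2 + 3 * a n * ?d + ?d\<^sup>2)"
      by linarith+
    have "norm (a (Suc n) ^ 3 - a n ^ 3) \<le> ?r * (5 * (a n)\<^sup>2 + 3 * ?r\<^sup>2)"
      unfolding eq real_norm_def abs_mult by (rule mult_mono[OF d q r abs_ge_zero])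
    also have "\<dots> = 5 * C * ((a n)\<^sup>2 / real (Suc n)) + 3 * C ^ 3 * (1 / real (Suc n) ^ 3)"
      by (simp add: power_divide power2_eq_square power3_eq_cube algebra_simps add_divide_distrib)
    also have "\<dots> \<le> 5 * C * ((a n)\<^sup>2 / real (Suc n)) + 3 * C ^ 3 * (1 / real (Suc n) ^ 2)"
      using C by (intro add_left_mono mult_left_mono divide_left_mono power_increasing) auto
    finally show ?thesis .
  qed
  have "summable (\<lambda>n. 5 * C * ((a n)\<^sup>2 / real (Suc n)) + 3 * C ^ 3 * (1 / real (Suc n) ^ 2))"
    by (intro summable_add summable_mult s) (use inverse_squares_sums in \<open>auto simp: sums_iff add.commute\<close>)
  then have "summable (\<lambda>n. a (Suc n) ^ 3 - a n ^ 3)"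
    by (rule summable_comparison_test'[where N=0]) (rule bnd)
  then obtain L0 where "(\<lambda>n. \<Sum>k<n. a (Suc k) ^ 3 - a k ^ 3) \<longlonglongrightarrow> L0"
    by (auto simp: summable_def sums_def)
  then have "(\<lambda>n. (a n ^ 3 - a 0 ^ 3) + a 0 ^ 3) \<longlonglongrightarrow> L0 + a 0 ^ 3"
    unfolding sum_lessThan_telescope[of "\<lambda>k. a k ^ 3"] by (intro tendsto_intros)
  then obtain L where L: "(\<lambda>n. a n ^ 3) \<longlonglongrightarrow> L" by simp
  have "L = 0"
  proof (rule ccontr)
    assume "L \<noteq> 0"
    \<comment> \<open>The cap at \<open>1\<close> makes \<open>|x|^3 <= |x|\<close> for
      \<open>|x| < r\<close>, so a cube above \<open>|L| / 2\<close> forces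
      \<open>|a n| >= r\<close>.\<close>
    define r where "r = min 1 (\<bar>L\<bar> / 2)"
    have r: "0 < r" "r \<le> 1" using \<open>L \<noteq> 0\<close> by (auto simp: r_def)
    have "(\<lambda>n. \<bar>a n ^ 3\<bar>) \<longlonglongrightarrow> \<bar>L\<bar>" using L by (intro tendsto_intros)
    then have "eventually (\<lambda>n. \<bar>L\<bar> / 2 < \<bar>a n ^ 3\<bar>) sequentially"
      using \<open>L \<noteq> 0\<close> by (intro order_tendstoD(1)) auto
    then have "eventually (\<lambda>n. norm (r\<^sup>2 * (1 / real (Suc n))) \<le> (a n)\<^sup>2 / real (Suc n)) sequentially"
    proof eventually_elim
      case (elim n)
      have "r \<le> \<bar>a n\<bar>"
      proof (rule ccontr)
        assume "\<not> r \<le> \<bar>a n\<bar>"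
        then have l: "\<bar>a n\<bar> < r" by simp
        have "\<bar>a n ^ 3\<bar> \<le> \<bar>a n\<bar>"
          using power_decreasing[of 1 3 "\<bar>a n\<bar>"] l r by (simp add: power_abs)
        with elim l show False by (simp add: r_def)
      qed
      then have "r\<^sup>2 \<le> (a n)\<^sup>2" using r by (metis abs_le_square_iff abs_of_pos)
      then show ?case by (simp add: divide_right_mono)
    qed
    then have "summable (\<lambda>n. r\<^sup>2 * (1 / real (Suc n)))"
      by (rule summable_comparison_test_ev[OF _ s])
    then have "summable (\<lambda>n. 1 / real (Suc n))"
      by (rule summable_mult_D) (use r in simp)
    then have "summable (\<lambda>n. 1 / real n)" using summable_Suc_iff[of "\<lambda>n. 1 / real n"] by simp
    then show False using not_summable_harmonic[where 'a=real] by (simp add: inverse_eq_divide)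
  qed
  with L have 0: "(\<lambda>n. a n ^ 3) \<longlonglongrightarrow> 0" by simp
  show ?thesis
  proof (rule tendstoI)
    fix e :: real assume e: "0 < e"
    have "eventually (\<lambda>n. dist (a n ^ 3) 0 < e ^ 3) sequentially"
      using e by (intro tendstoD[OF 0]) simp
    then show "eventually (\<lambda>n. dist (a n) 0 < e) sequentially"
    proof eventually_elim
      case (elim n)
      then have "\<bar>a n\<bar> ^ 3 < e ^ 3" by (simp add: power_abs)
      then show ?case using e power_less_imp_less_base[of "\<bar>a n\<bar>" 3 e] by simp
    qed
  qed
qed

section \<open>The two-urn process and its mean increments\<close>

lemma abs_mult_unit_le:
  fixes x y c :: real
  assumes "0 \<le> c" "c \<le> 1" "\<bar>x\<bar> \<le> y"
  shows "\<bar>c * x\<bar> \<le> y"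
  using mult_right_mono[of c 1 "\<bar>x\<bar>"] assms by (simp add: abs_mult)

lemma weighted_mean_diff:
  fixes N a b x y :: real
  assumes "0 \<le> N" "1 \<le> a" "1 \<le> b"
  shows "(x * (N + a) + y * (N + b)) / (2 * N + a + b) - (x + y) / 2 = ((a - b) * ((x - y) / 2)) / (2 * N + a + b)"
proof -
  have "2 * N + a + b \<noteq> 0" using assms by linarith
  then show ?thesis by (simp add: divide_simps) (simp add: algebra_simps)
qed

text \<open>A red ball in urn 1 and a black ball in urn 2 make both urns nonempty and keep both
  colours present in total at all times; with \<open>p > 0\<close> neither colour is ever excluded
  from a draw.\<close>

locale two_urns =
  fixes al p :: real and b1 r1 b2 r2 :: nat
  assumes al: "1 < al" and p: "0 < p" "p \<le> 1" and r1: "1 \<le> r1" and b2: "1 \<le> b2"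
begin

abbreviation law :: "(nat \<Rightarrow> config) measure" where
  "law \<equiv> urn_law al p ((b1, r1), (b2, r2))"

abbreviation prop1 :: "config \<Rightarrow> real" where "prop1 c \<equiv> sprop (fst c)"
abbreviation prop2 :: "config \<Rightarrow> real" where "prop2 c \<equiv> sprop (snd c)"
abbreviation drift1 :: "config \<Rightarrow> real" where "drift1 c \<equiv> drift al p (prop1 c) (prop2 c)"
abbreviation drift2 :: "config \<Rightarrow> real" where "drift2 c \<equiv> drift al p (prop2 c) (prop1 c)"

definition at_time :: "nat \<Rightarrow> config \<Rightarrow> bool" where
  "at_time n c \<longleftrightarrow> black (fst c) + red (fst c) = n + (b1 + r1) \<and> black (snd c) + red (snd c) = n + (b2 + r2)"

text \<open>One constant for all effects of the initial sizes: both urn sizes after the next draw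
  lie between \<open>n + 1\<close> and \<open>K * (n + 1)\<close>.\<close>

definition K :: real where "K = real (b1 + r1) + real (b2 + r2) + 1"

lemma K_pos: "1 \<le> K" by (simp add: K_def)

lemma at_timeD:
  assumes "at_time n c"
  shows "0 < black (fst c) + red (fst c)" "0 < black (snd c) + red (snd c)"
    "real (black (fst c)) + real (red (fst c)) = real n + real (b1 + r1)"
    "real (black (snd c)) + real (red (snd c)) = real n + real (b2 + r2)"
    "real (black_total c) + real (red_total c) = 2 * real n + real (b1 + r1) + real (b2 + r2)"
proof -
  have "black (fst c) + red (fst c) = n + (b1 + r1)" "black (snd c) + red (snd c) = n + (b2 + r2)"
    using assms by (simp_all add: at_time_def)
  then have e: "real (black (fst c) + red (fst c)) = real (n + (b1 + r1))"
    "real (black (snd c) + red (snd c)) = real (n + (b2 + r2))" by presburger+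
  show "0 < black (fst c) + red (fst c)" "0 < black (snd c) + red (snd c)"
    using assms r1 b2 unfolding at_time_def by linarith+
  show "real (black (fst c)) + real (red (fst c)) = real n + real (b1 + r1)"
    "real (black (snd c)) + real (red (snd c)) = real n + real (b2 + r2)"
    "real (black_total c) + real (red_total c) = 2 * real n + real (b1 + r1) + real (b2 + r2)"
    using e by (simp_all add: black_total_def red_total_def)
qed

lemma at_time_bump: "at_time n c \<Longrightarrow> at_time (Suc n) (bump c i j)"
  by (auto simp: at_time_def bump_def add_ball_def)

lemma AE_path: "AE \<omega> in law. \<forall>n. at_time n (\<omega> n) \<and> (\<exists>i j. \<omega> (Suc n) = bump (\<omega> n) i j)"
  using AE_urn_path[of "((b1, r1), (b2, r2))" al p]
proof eventually_elim
  case (elim \<omega>)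
  have st: "\<exists>i j. \<omega> (Suc n) = bump (\<omega> n) i j" for n
    using elim set_pmf_urn_step[of al p "\<omega> n"] by blast
  have "at_time n (\<omega> n)" for n
  proof (induction n)
    case 0
    then show ?case using elim by (simp add: at_time_def)
  next
    case (Suc n)
    then show ?case using st[of n] at_time_bump by metis
  qed
  with st show ?case by blast
qed

lemma prop_bump:
  assumes "at_time n c"
  shows "prop1 (bump c i j) = prop1 c + (sg i - prop1 c) / (real n + real (b1 + r1) + 1)"
    "prop2 (bump c i j) = prop2 c + (sg j - prop2 c) / (real n + real (b2 + r2) + 1)"
  using sprop_add_ball at_timeD[OF assms] by (simp_all add: bump_def)

lemma prop_bump_diff:
  assumes "at_time n c"
  shows "\<bar>prop1 (bump c i j) - prop1 c\<bar> \<le> 2 / real (Suc n)" "\<bar>prop2 (bump c i j) - prop2 c\<bar> \<le> 2 / real (Suc n)"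
proof -
  have *: "\<bar>(sg i - s) / (real n + real m + 1)\<bar> \<le> 2 / real (Suc n)" if "\<bar>s\<bar> \<le> 1" for i m s
  proof -
    have "\<bar>sg i - s\<bar> \<le> 2" using that by (auto simp: sg_def)
    then show ?thesis by (simp add: abs_divide frac_le)
  qed
  then show "\<bar>prop1 (bump c i j) - prop1 c\<bar> \<le> 2 / real (Suc n)" "\<bar>prop2 (bump c i j) - prop2 c\<bar> \<le> 2 / real (Suc n)"
    unfolding prop_bump[OF assms] add_diff_cancel_left' by - (rule *[OF abs_sprop_le_1])+
qed

text \<open>The urn sizes differ by a constant, so the size-weighted mean of the two proportions
  differs from the plain mean by that constant over the number of balls.\<close>

lemma tprop_near:
  assumes "at_time n c"
  shows "\<bar>tprop c - (prop1 c + prop2 c) / 2\<bar> \<le> K / real (Suc n)"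
proof -
  note T = at_timeD[OF assms]
  let ?n1 = "real (b1 + r1)" and ?n2 = "real (b2 + r2)"
  have n1: "1 \<le> ?n1" "1 \<le> ?n2" using r1 b2 by simp_all
  have "real (black (fst c)) - real (red (fst c)) = prop1 c * (real n + ?n1)"
    "real (black (snd c)) - real (red (snd c)) = prop2 c * (real n + ?n2)"
    unfolding sprop_def T(3,4) using n1 by simp_all
  then have "real (black_total c) - real (red_total c) = prop1 c * (real n + ?n1) + prop2 c * (real n + ?n2)"
    by (simp add: black_total_def red_total_def)
  then have "tprop c = (prop1 c * (real n + ?n1) + prop2 c * (real n + ?n2)) / (2 * real n + ?n1 + ?n2)"
    unfolding tprop_def T(5) by simp
  then have "tprop c - (prop1 c + prop2 c) / 2 = ((?n1 - ?n2) * ((prop1 c - prop2 c) / 2)) / (2 * real n + ?n1 + ?n2)"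
    using weighted_mean_diff[OF of_nat_0_le_iff n1] by simp
  also have "\<bar>\<dots>\<bar> \<le> K / real (Suc n)"
    unfolding abs_divide abs_mult
  proof (rule frac_le)
    have "\<bar>?n1 - ?n2\<bar> \<le> K" "\<bar>prop1 c - prop2 c\<bar> / \<bar>2\<bar> \<le> 1"
      using abs_sprop_le_1[of "fst c"] abs_sprop_le_1[of "snd c"] n1 by (auto simp: K_def)
    then show "\<bar>?n1 - ?n2\<bar> * (\<bar>prop1 c - prop2 c\<bar> / \<bar>2\<bar>) \<le> K"
      using mult_mono[of "\<bar>?n1 - ?n2\<bar>" K "\<bar>prop1 c - prop2 c\<bar> / \<bar>2\<bar>" 1] K_pos by simp
  qed (use n1 K_pos in auto)
  finally show ?thesis .
qed

lemma draw_mean_near: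
  assumes "at_time n c"
  shows "\<bar>draw_mean al p c (fst c) - prop1 c - drift1 c\<bar> \<le> al * K / real (Suc n)"
    "\<bar>draw_mean al p c (snd c) - prop2 c - drift2 c\<bar> \<le> al * K / real (Suc n)"
proof -
  let ?m = "(prop1 c + prop2 c) / 2"
  have "\<bar>prop1 c + prop2 c\<bar> \<le> 2"
    using abs_sprop_le_1[of "fst c"] abs_sprop_le_1[of "snd c"] by linarith
  then have "\<bar>?m\<bar> \<le> 1" by simp
  then have "\<bar>reinf al (tprop c) - reinf al ?m\<bar> \<le> al * \<bar>tprop c - ?m\<bar>"
    using al abs_tprop_le_1 by (intro reinf_lipschitz) auto
  also have "\<dots> \<le> al * (K / real (Suc n))"
    using al tprop_near[OF assms] by (intro mult_left_mono) auto
  finally have "\<bar>p * (reinf al (tprop c) - reinf al ?m)\<bar> \<le> al * (K / real (Suc n))"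
    by (rule abs_mult_unit_le[rotated 2]) (use p in auto)
  then show "\<bar>draw_mean al p c (fst c) - prop1 c - drift1 c\<bar> \<le> al * K / real (Suc n)"
    "\<bar>draw_mean al p c (snd c) - prop2 c - drift2 c\<bar> \<le> al * K / real (Suc n)"
    by (simp_all add: draw_mean_def drift_def right_diff_distrib add.commute)
qed

lemma drift_lipschitz:
  assumes "\<bar>s\<bar> \<le> 1" "\<bar>t\<bar> \<le> 1" "\<bar>s'\<bar> \<le> 1" "\<bar>t'\<bar> \<le> 1"
  shows "\<bar>drift al p s t - drift al p s' t'\<bar> \<le> (2 * al + 1) * (\<bar>s - s'\<bar> + \<bar>t - t'\<bar>)"
proof -
  have "\<bar>reinf al ((s + t) / 2) - reinf al ((s' + t') / 2)\<bar> \<le> al * \<bar>(s + t) / 2 - (s' + t') / 2\<bar>"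
    using al assms by (intro reinf_lipschitz) auto
  also have "\<dots> \<le> al * (\<bar>s - s'\<bar> + \<bar>t - t'\<bar>)"
    using al by (intro mult_left_mono) (auto simp: abs_if add_divide_distrib)
  finally have 1: "\<bar>p * (reinf al ((s + t) / 2) - reinf al ((s' + t') / 2))\<bar> \<le> al * (\<bar>s - s'\<bar> + \<bar>t - t'\<bar>)"
    by (rule abs_mult_unit_le[rotated 2]) (use p in auto)
  have "\<bar>reinf al s - reinf al s'\<bar> \<le> al * \<bar>s - s'\<bar>"
    using al assms by (intro reinf_lipschitz) auto
  then have "\<bar>(1 - p) * (reinf al s - reinf al s')\<bar> \<le> al * \<bar>s - s'\<bar>"
    by (rule abs_mult_unit_le[rotated 2]) (use p in auto)
  also have "\<dots> \<le> al * (\<bar>s - s'\<bar> + \<bar>t - t'\<bar>)" using al by simp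
  finally have 2: "\<bar>(1 - p) * (reinf al s - reinf al s')\<bar> \<le> al * (\<bar>s - s'\<bar> + \<bar>t - t'\<bar>)" .
  have "drift al p s t - drift al p s' t' = p * (reinf al ((s + t) / 2) - reinf al ((s' + t') / 2))
     + (1 - p) * (reinf al s - reinf al s') - (s - s')"
    by (simp add: drift_def algebra_simps)
  moreover have "(2 * al + 1) * (\<bar>s - s'\<bar> + \<bar>t - t'\<bar>) =
      al * (\<bar>s - s'\<bar> + \<bar>t - t'\<bar>) + al * (\<bar>s - s'\<bar> + \<bar>t - t'\<bar>) + (\<bar>s - s'\<bar> + \<bar>t - t'\<bar>)"
    by (simp add: algebra_simps)
  ultimately show ?thesis using 1 2 by linarith
qed

lemma abs_drift_le:
  assumes "\<bar>s\<bar> \<le> 1" "\<bar>t\<bar> \<le> 1"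
  shows "\<bar>drift al p s t\<bar> \<le> 2"
proof -
  have "\<bar>reinf al ((s + t) / 2)\<bar> \<le> 1" "\<bar>reinf al s\<bar> \<le> 1"
    using al assms by (auto intro!: abs_reinf_le)
  then have "\<bar>p * reinf al ((s + t) / 2)\<bar> \<le> p" "\<bar>(1 - p) * reinf al s\<bar> \<le> 1 - p"
    unfolding abs_mult using p by (simp_all add: mult_left_le)
  then have "\<bar>p * reinf al ((s + t) / 2) + (1 - p) * reinf al s\<bar> \<le> 1"
    using abs_triangle_ineq[of "p * reinf al ((s + t) / 2)" "(1 - p) * reinf al s"] by linarith
  then show ?thesis
    using abs_triangle_ineq4[of "p * reinf al ((s + t) / 2) + (1 - p) * reinf al s" s] assms(1)
    unfolding drift_def by linarith
qed

end

section \<open>Convergence to the zeros of the drift\<close>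

text \<open>Eventually \<open>|s + t|\<close> is below \<open>1/2\<close> or above
  \<open>3/2\<close>, while one step changes \<open>s + t\<close> by less than \<open>1/2\<close>.
  Hence the path cannot change between the three regions, and \<open>drift_small\<close> with
  smaller tolerances identifies the limit in each of them.\<close>

lemma drift_to_zero_cases:
  fixes s t :: "nat \<Rightarrow> real"
  assumes al: "1 < al" "al < 3" and a1: "0 < a1" and K: "(cosh (al * a1))\<^sup>2 < al * (cosh a1)\<^sup>2"
    and p: "0 < p" "p \<le> 1" and pl: "(1 - p) * (2 * sinh ((al - 1) * a1)) < p * sinh (2 * a1)"
    and st: "\<And>n. \<bar>s n\<bar> \<le> 1" "\<And>n. \<bar>t n\<bar> \<le> 1"
    and step: "\<And>n. \<bar>(s (Suc n) + t (Suc n)) - (s n + t n)\<bar> \<le> 4 / real (Suc n)"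
    and d: "(\<lambda>n. drift al p (s n) (t n)) \<longlonglongrightarrow> 0" "(\<lambda>n. drift al p (t n) (s n)) \<longlonglongrightarrow> 0"
  shows "(s \<longlonglongrightarrow> 1 \<and> t \<longlonglongrightarrow> 1) \<or> (s \<longlonglongrightarrow> -1 \<and> t \<longlonglongrightarrow> -1) \<or>
    ((\<lambda>n. s n + t n) \<longlonglongrightarrow> 0 \<and> eventually (\<lambda>n. \<bar>s n\<bar> < tanh a1 \<and> \<bar>t n\<bar> < tanh a1) sequentially)"
proof -
  have ev: "eventually (\<lambda>n. (\<bar>s n + t n\<bar> < e \<and> \<bar>s n\<bar> < tanh a1 \<and> \<bar>t n\<bar> < tanh a1) \<or> 2 - e < \<bar>s n + t n\<bar>) sequentially"
    if e: "0 < e" for e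
  proof -
    obtain r where r: "0 < r"
      "\<And>s t. \<bar>s\<bar> \<le> 1 \<Longrightarrow> \<bar>t\<bar> \<le> 1 \<Longrightarrow> \<bar>drift al p s t\<bar> < r \<Longrightarrow> \<bar>drift al p t s\<bar> < r \<Longrightarrow>
        (\<bar>s + t\<bar> < e \<and> \<bar>s\<bar> < tanh a1 \<and> \<bar>t\<bar> < tanh a1) \<or> 2 - e < \<bar>s + t\<bar>"
      using drift_small[OF al a1 K p pl e] by blast
    show ?thesis
      using tendstoD[OF d(1) r(1)] tendstoD[OF d(2) r(1)]
      by eventually_elim (use r(2) st in auto)
  qed
  have "(\<lambda>n. 4 / real (Suc n)) \<longlonglongrightarrow> 0"
    using tendsto_mult_right_zero[OF LIMSEQ_inverse_real_of_nat, of 4] by (simp add: divide_inverse)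
  then have "eventually (\<lambda>n. 4 / real (Suc n) < 1/2) sequentially"
    by (rule order_tendstoD) simp
  with ev[of "1/2"] have "eventually (\<lambda>n. (\<bar>s n + t n\<bar> < 1/2 \<or> 3/2 < \<bar>s n + t n\<bar>) \<and> 4 / real (Suc n) < 1/2) sequentially"
    by (auto elim!: eventually_elim2)
  then obtain N where N: "\<And>n. N \<le> n \<Longrightarrow> (\<bar>s n + t n\<bar> < 1/2 \<or> 3/2 < \<bar>s n + t n\<bar>) \<and> 4 / real (Suc n) < 1/2"
    by (auto simp: eventually_sequentially)
  have near: "\<bar>(s (Suc n) + t (Suc n)) - (s n + t n)\<bar> < 1/2" if "N \<le> n" for n
    using N[OF that] step[of n] by linarith
  have up: "(\<lambda>n. \<sigma> * s n) \<longlonglongrightarrow> 1 \<and> (\<lambda>n. \<sigma> * t n) \<longlonglongrightarrow> 1"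
    if \<sigma>: "\<sigma> = 1 \<or> \<sigma> = - 1" and start: "3/2 < \<sigma> * (s N + t N)" for \<sigma>
  proof -
    have large: "3/2 < \<sigma> * (s n + t n)" if "N \<le> n" for n
      using that
    proof (induction n rule: dec_induct)
      case (step n)
      have "3/2 < s (Suc n) + t (Suc n)" if "3/2 < s n + t n"
        using that step.hyps N[of "Suc n"] near[of n] by linarith
      moreover have "3/2 < - (s (Suc n) + t (Suc n))" if "3/2 < - (s n + t n)"
        using that step.hyps N[of "Suc n"] near[of n] by linarith
      ultimately show ?case using \<sigma> step.IH by auto
    qed (use start in simp)
    have E: "eventually (\<lambda>n. dist (\<sigma> * s n) 1 < e \<and> dist (\<sigma> * t n) 1 < e) sequentially" if "0 < e" for e
    proof -
      have "0 < min e (1/2)" using that by simp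
      from ev[OF this] eventually_ge_at_top[of N] show ?thesis
      proof eventually_elim
        case (elim n)
        define x y where "x = \<sigma> * s n" and "y = \<sigma> * t n"
        have xy: "x \<le> 1" "y \<le> 1" using \<sigma> st[of n] by (auto simp: x_def y_def abs_le_iff)
        have sum: "3/2 < x + y" using large[OF elim(2)] by (simp add: x_def y_def distrib_left)
        have "\<bar>s n + t n\<bar> = \<bar>x + y\<bar>" using \<sigma> by (auto simp: x_def y_def)
        also have "\<bar>x + y\<bar> = x + y" using sum by simp
        finally have "2 - min e (1/2) < x + y" using elim(1) sum by auto
        then have "2 - e < x + y" by linarith
        then have "\<bar>x - 1\<bar> < e" "\<bar>y - 1\<bar> < e" using xy by (simp_all add: abs_less_iff)
        then show ?case by (simp add: dist_real_def x_def y_def)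
      qed
    qed
    show ?thesis
      by (intro conjI; rule tendstoI; drule E; erule eventually_mono; blast)
  qed
  consider "\<bar>s N + t N\<bar> < 1/2" | "3/2 < s N + t N" | "s N + t N < - (3/2)"
    using N[of N] by linarith
  then show ?thesis
  proof cases
    case 1
    have small: "\<bar>s n + t n\<bar> < 1/2" if "N \<le> n" for n
      using that
    proof (induction n rule: dec_induct)
      case (step n)
      then show ?case using N[of "Suc n"] near[of n] by linarith
    qed (use 1 in simp)
    have E: "eventually (\<lambda>n. \<bar>s n + t n\<bar> < e \<and> \<bar>s n\<bar> < tanh a1 \<and> \<bar>t n\<bar> < tanh a1) sequentially"
      if "0 < e" "e \<le> 1/2" for e
      using ev[OF that(1)] eventually_ge_at_top[of N]
      by eventually_elim (use small that in fastforce)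
    have "(\<lambda>n. s n + t n) \<longlonglongrightarrow> 0"
    proof (rule tendstoI)
      fix e :: real assume "0 < e"
      then have "eventually (\<lambda>n. \<bar>s n + t n\<bar> < min e (1/2) \<and> \<bar>s n\<bar> < tanh a1 \<and> \<bar>t n\<bar> < tanh a1) sequentially"
        by (intro E) auto
      then show "eventually (\<lambda>n. dist (s n + t n) 0 < e) sequentially" by eventually_elim simp
    qed
    moreover have "eventually (\<lambda>n. \<bar>s n\<bar> < tanh a1 \<and> \<bar>t n\<bar> < tanh a1) sequentially"
      using E[of "1/2"] by (auto elim: eventually_mono)
    ultimately show ?thesis by blast
  next
    case 2
    then show ?thesis using up[of 1] by simp
  next
    case 3
    then have "(\<lambda>n. - s n) \<longlonglongrightarrow> 1" "(\<lambda>n. - t n) \<longlonglongrightarrow> 1" using up[of "- 1"] by simp_all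
    from tendsto_minus[OF this(1)] tendsto_minus[OF this(2)] show ?thesis by simp
  qed
qed

text \<open>Here \<open>H\<close> is a drift component, \<open>e\<close> its error of order
  \<open>1 / n\<close>, \<open>T\<close> the true urn size and \<open>N = n + 1\<close>. Since
  \<open>H^2\<close> has a sign, replacing \<open>T\<close> by \<open>k * N\<close> only weakens the
  gain.\<close>

lemma drift_gain:
  fixes H e E T N k :: real
  assumes "\<bar>H\<bar> \<le> 2" "\<bar>e\<bar> \<le> E / N" "0 < N" "N \<le> T" "T \<le> k * N"
  shows "- (H * (H + e)) / T \<le> - (H\<^sup>2 / (k * N)) + 2 * E / N\<^sup>2"
proof -
  have T: "0 < T" using assms by linarith
  have "0 \<le> E / N" using assms(2) by linarith
  have "\<bar>H * e\<bar> \<le> 2 * (E / N)" unfolding abs_mult using assms by (intro mult_mono) auto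
  then have "- (H * e) / T \<le> 2 * (E / N) / T" using T by (intro divide_right_mono) auto
  also have "\<dots> \<le> 2 * (E / N) / N" using assms \<open>0 \<le> E / N\<close> T by (intro divide_left_mono) auto
  also have "\<dots> = 2 * E / N\<^sup>2" by (simp add: power2_eq_square)
  finally have 1: "- (H * e) / T \<le> 2 * E / N\<^sup>2" .
  have 2: "H\<^sup>2 / (k * N) \<le> H\<^sup>2 / T" using assms T by (intro divide_left_mono) auto
  have "- (H * (H + e)) / T = - (H\<^sup>2 / T) + - (H * e) / T"
    using T by (simp add: field_simps power2_eq_square)
  with 1 2 show ?thesis by linarith
qed

context two_urns
begin

text \<open>With \<open>Ph\<close> the convex antiderivative of the reinforcement map, the function
  \<open>L\<close> has gradient \<open>(drift al p s t, drift al p t s)\<close>. Convexity bounds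
  its nonquadratic part from below by tangents, so only the explicit squares remain as second order
  terms.\<close>

lemma lyapunov_function:
  obtains L :: "real \<Rightarrow> real \<Rightarrow> real" where
    "\<And>s t. \<bar>s\<bar> \<le> 1 \<Longrightarrow> \<bar>t\<bar> \<le> 1 \<Longrightarrow> L s t \<le> 2"
    "\<And>s t s' t'. \<bar>s\<bar> \<le> 1 \<Longrightarrow> \<bar>t\<bar> \<le> 1 \<Longrightarrow> \<bar>s'\<bar> \<le> 1 \<Longrightarrow> \<bar>t'\<bar> \<le> 1 \<Longrightarrow>
      L s t + drift al p s t * (s' - s) + drift al p t s * (t' - t) - (s' - s)\<^sup>2 / 2 - (t' - t)\<^sup>2 / 2 \<le> L s' t'"
proof -
  obtain Ph where Ph: "Ph 0 = 0"
    "\<And>x y. \<bar>x\<bar> \<le> 1 \<Longrightarrow> \<bar>y\<bar> \<le> 1 \<Longrightarrow> Ph x + reinf al x * (y - x) \<le> Ph y"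
    using antiderivative_convex al by (metis less_imp_le)
  have Ph1: "Ph x \<le> 1" if "\<bar>x\<bar> \<le> 1" for x
  proof -
    have "\<bar>reinf al x * x\<bar> \<le> 1 * 1"
      unfolding abs_mult using al that by (intro mult_mono abs_reinf_le) auto
    then show ?thesis using Ph(2)[of x 0] that Ph(1) by simp
  qed
  define L where "L s t = 2 * p * Ph ((s + t) / 2) + (1 - p) * (Ph s + Ph t) - s\<^sup>2 / 2 - t\<^sup>2 / 2" for s t
  have mid: "\<bar>(s + t) / 2\<bar> \<le> 1" if "\<bar>s\<bar> \<le> 1" "\<bar>t\<bar> \<le> 1" for s t :: real
    using that by (auto simp: abs_le_iff)
  show ?thesis
  proof (rule that[of L])
    fix s t :: real assume st: "\<bar>s\<bar> \<le> 1" "\<bar>t\<bar> \<le> 1"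
    have "2 * p * Ph ((s + t) / 2) \<le> 2 * p * 1"
      using Ph1[OF mid[OF st]] p by (intro mult_left_mono) auto
    moreover have "(1 - p) * (Ph s + Ph t) \<le> (1 - p) * (1 + 1)"
      using Ph1[OF st(1)] Ph1[OF st(2)] p by (intro mult_left_mono add_mono) auto
    moreover have "0 \<le> s\<^sup>2" "0 \<le> t\<^sup>2" by simp_all
    moreover have "2 * p * 1 + (1 - p) * (1 + 1) = 2" by simp
    ultimately show "L s t \<le> 2" unfolding L_def by linarith
  next
    fix s t s' t' :: real
    assume st: "\<bar>s\<bar> \<le> 1" "\<bar>t\<bar> \<le> 1" "\<bar>s'\<bar> \<le> 1" "\<bar>t'\<bar> \<le> 1"
    have "2 * p * (Ph ((s + t) / 2) + reinf al ((s + t) / 2) * ((s' + t') / 2 - (s + t) / 2)) \<le> 2 * p * Ph ((s' + t') / 2)"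
      using p st by (intro mult_left_mono Ph(2) mid) auto
    moreover have "(1 - p) * ((Ph s + reinf al s * (s' - s)) + (Ph t + reinf al t * (t' - t))) \<le> (1 - p) * (Ph s' + Ph t')"
      using p st by (intro mult_left_mono add_mono Ph(2)) auto
    moreover have "L s t + drift al p s t * (s' - s) + drift al p t s * (t' - t) - (s' - s)\<^sup>2 / 2 - (t' - t)\<^sup>2 / 2 =
       2 * p * (Ph ((s + t) / 2) + reinf al ((s + t) / 2) * ((s' + t') / 2 - (s + t) / 2)) +
       (1 - p) * ((Ph s + reinf al s * (s' - s)) + (Ph t + reinf al t * (t' - t))) - s'\<^sup>2 / 2 - t'\<^sup>2 / 2"
      unfolding L_def drift_def add.commute[of t s]
      by (simp add: field_simps power2_eq_square)
    ultimately show "L s t + drift al p s t * (s' - s) + drift al p t s * (t' - t) - (s' - s)\<^sup>2 / 2 - (t' - t)\<^sup>2 / 2 \<le> L s' t'"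
      unfolding L_def by linarith
  qed
qed

lemma time_scale:
  "real (Suc n) \<le> real n + real (b1 + r1) + 1" "real n + real (b1 + r1) + 1 \<le> K * real (Suc n)"
  "real (Suc n) \<le> real n + real (b2 + r2) + 1" "real n + real (b2 + r2) + 1 \<le> K * real (Suc n)"
proof -
  have "K + real n \<le> K * real (Suc n)"
    using mult_right_mono[OF K_pos, of "real n"] by (simp add: distrib_left)
  then show "real (Suc n) \<le> real n + real (b1 + r1) + 1" "real n + real (b1 + r1) + 1 \<le> K * real (Suc n)"
    "real (Suc n) \<le> real n + real (b2 + r2) + 1" "real n + real (b2 + r2) + 1 \<le> K * real (Suc n)"
    unfolding K_def by simp_all
qed

text \<open>The function is \<open>2 - L\<close>, which decreases along the drift by its squared
  length. In the error, \<open>4\<close> comes from two increments of size at most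
  \<open>2 / (n + 1)\<close>, and \<open>4 * (al * K)\<close> from the error of the conditional mean
  in each urn.\<close>

lemma lyapunov_step:
  obtains Psi :: "config \<Rightarrow> real" where "\<And>c. 0 \<le> Psi c"
    "\<And>n c. at_time n c \<Longrightarrow> (\<integral>\<^sup>+c'. ennreal (Psi c') \<partial>measure_pmf (urn_step al p c))
       + ennreal ((drift1 c)\<^sup>2 / (K * real (Suc n)) + (drift2 c)\<^sup>2 / (K * real (Suc n)))
       \<le> ennreal (Psi c) + ennreal ((4 + 4 * (al * K)) * (1 / real (Suc n) ^ 2))"
proof -
  obtain L where L: "\<And>s t. \<bar>s\<bar> \<le> 1 \<Longrightarrow> \<bar>t\<bar> \<le> 1 \<Longrightarrow> L s t \<le> 2"
    "\<And>s t s' t'. \<bar>s\<bar> \<le> 1 \<Longrightarrow> \<bar>t\<bar> \<le> 1 \<Longrightarrow> \<bar>s'\<bar> \<le> 1 \<Longrightarrow> \<bar>t'\<bar> \<le> 1 \<Longrightarrow>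
      L s t + drift al p s t * (s' - s) + drift al p t s * (t' - t) - (s' - s)\<^sup>2 / 2 - (t' - t)\<^sup>2 / 2 \<le> L s' t'"
    using lyapunov_function by metis
  define Psi where "Psi c = 2 - L (prop1 c) (prop2 c)" for c
  have Psi0: "0 \<le> Psi c" for c
    using L(1)[OF abs_sprop_le_1 abs_sprop_le_1] by (simp add: Psi_def)
  show ?thesis
  proof (rule that[OF Psi0])
    fix n c assume c: "at_time n c"
    let ?s = "prop1 c" and ?t = "prop2 c" and ?H = "drift1 c" and ?G = "drift2 c" and ?N = "real (Suc n)"
    let ?T1 = "real n + real (b1 + r1) + 1" and ?T2 = "real n + real (b2 + r2) + 1"
    let ?m1 = "draw_mean al p c (fst c)" and ?m2 = "draw_mean al p c (snd c)"
    define g where "g = ?H\<^sup>2 / (K * ?N) + ?G\<^sup>2 / (K * ?N)"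
    have g0: "0 \<le> g" using K_pos by (simp add: g_def)
    have le: "Psi (bump c i j) \<le> (Psi c + ?H * ?s / ?T1 + ?G * ?t / ?T2 + 4 / ?N\<^sup>2)
        + (- ?H / ?T1) * sg i + (- ?G / ?T2) * sg j + 0 * (sg i * sg j)" for i j
    proof -
      let ?d = "prop1 (bump c i j) - ?s" and ?e = "prop2 (bump c i j) - ?t"
      have "?d\<^sup>2 \<le> (2 / ?N)\<^sup>2" "?e\<^sup>2 \<le> (2 / ?N)\<^sup>2"
        using prop_bump_diff[OF c, of i j] by (metis abs_le_square_iff abs_of_nonneg divide_nonneg_nonneg of_nat_0_le_iff zero_le_numeral)+
      moreover have "(2 / ?N)\<^sup>2 = 4 / ?N\<^sup>2" by (simp add: power_divide)
      ultimately have "?d\<^sup>2 / 2 + ?e\<^sup>2 / 2 \<le> 4 / ?N\<^sup>2" by linarith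
      then have "Psi (bump c i j) \<le> Psi c - ?H * ?d - ?G * ?e + 4 / ?N\<^sup>2"
        using L(2)[of ?s ?t "prop1 (bump c i j)" "prop2 (bump c i j)"] abs_sprop_le_1
        unfolding Psi_def by simp
      moreover have "?H * ?d = ?H * sg i / ?T1 - ?H * ?s / ?T1" "?G * ?e = ?G * sg j / ?T2 - ?G * ?t / ?T2"
        unfolding prop_bump[OF c] by (simp_all add: diff_divide_distrib right_diff_distrib del: of_nat_add)
      ultimately show ?thesis by simp
    qed
    have Psib: "0 \<le> Psi (bump c i j)" for i j by (rule Psi0)
    have p0: "0 \<le> p" "p \<le> 1" using p by simp_all
    define x where "x = (Psi c + ?H * ?s / ?T1 + ?G * ?t / ?T2 + 4 / ?N\<^sup>2)
        + (- ?H / ?T1) * ?m1 + (- ?G / ?T2) * ?m2 + 0 * (?m1 * ?m2)"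
    have I: "(\<integral>\<^sup>+c'. ennreal (Psi c') \<partial>measure_pmf (urn_step al p c)) \<le> ennreal x" and x0: "0 \<le> x"
      unfolding x_def using nn_integral_urn_step_le[OF p0 Psib le at_timeD(1,2)[OF c]] by simp_all
    have "- (?H * (?H + (?m1 - ?s - ?H))) / ?T1 \<le> - (?H\<^sup>2 / (K * ?N)) + 2 * (al * K) / ?N\<^sup>2"
      using draw_mean_near(1)[OF c] abs_drift_le abs_sprop_le_1 time_scale(1,2)[of n]
      by (intro drift_gain) auto
    moreover have "- (?G * (?G + (?m2 - ?t - ?G))) / ?T2 \<le> - (?G\<^sup>2 / (K * ?N)) + 2 * (al * K) / ?N\<^sup>2"
      using draw_mean_near(2)[OF c] abs_drift_le abs_sprop_le_1 time_scale(3,4)[of n]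
      by (intro drift_gain) auto
    moreover have "x = Psi c + - (?H * (?H + (?m1 - ?s - ?H))) / ?T1 + - (?G * (?G + (?m2 - ?t - ?G))) / ?T2 + 4 / ?N\<^sup>2"
      unfolding x_def by (simp add: right_diff_distrib diff_divide_distrib del: of_nat_add)
    moreover have "(4 + 4 * (al * K)) * (1 / ?N ^ 2) = 4 / ?N\<^sup>2 + 2 * (al * K) / ?N\<^sup>2 + 2 * (al * K) / ?N\<^sup>2"
      by (simp add: add_divide_distrib)
    ultimately have xg: "x + g \<le> Psi c + (4 + 4 * (al * K)) * (1 / ?N ^ 2)"
      unfolding g_def by linarith
    have "(\<integral>\<^sup>+c'. ennreal (Psi c') \<partial>measure_pmf (urn_step al p c)) + ennreal g \<le> ennreal x + ennreal g"
      using I by (rule add_right_mono)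
    also have "\<dots> = ennreal (x + g)" using x0 g0 by (simp add: ennreal_plus)
    also have "\<dots> \<le> ennreal (Psi c + (4 + 4 * (al * K)) * (1 / ?N ^ 2))" using xg by (rule ennreal_leI)
    also have "\<dots> = ennreal (Psi c) + ennreal ((4 + 4 * (al * K)) * (1 / ?N ^ 2))"
      using Psi0 al K_pos by (intro ennreal_plus) auto
    finally show "(\<integral>\<^sup>+c'. ennreal (Psi c') \<partial>measure_pmf (urn_step al p c))
       + ennreal (?H\<^sup>2 / (K * ?N) + ?G\<^sup>2 / (K * ?N)) \<le> ennreal (Psi c) + ennreal ((4 + 4 * (al * K)) * (1 / ?N ^ 2))"
      unfolding g_def .
  qed
qed

text \<open>The total gain in the potential is almost surely finite, which makes the squared drifts
  summable against \<open>1 / (n + 1)\<close>. The drift is Lipschitz and the proportions move by at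
  most \<open>2 / (n + 1)\<close>, so summability already forces convergence to
  \<open>0\<close>.\<close>

lemma AE_drift_tendsto_0:
  "AE \<omega> in law. (\<lambda>n. drift1 (\<omega> n)) \<longlonglongrightarrow> 0 \<and> (\<lambda>n. drift2 (\<omega> n)) \<longlonglongrightarrow> 0"
proof -
  obtain Psi :: "config \<Rightarrow> real" where Psi: "\<And>c. 0 \<le> Psi c"
    "\<And>n c. at_time n c \<Longrightarrow> (\<integral>\<^sup>+c'. ennreal (Psi c') \<partial>measure_pmf (urn_step al p c))
       + ennreal ((drift1 c)\<^sup>2 / (K * real (Suc n)) + (drift2 c)\<^sup>2 / (K * real (Suc n)))
       \<le> ennreal (Psi c) + ennreal ((4 + 4 * (al * K)) * (1 / real (Suc n) ^ 2))"
    using lyapunov_step by metis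
  interpret prob_space law by (rule prob_space_urn_law)
  have "AE \<omega> in law. (\<Sum>n. ennreal ((drift1 (\<omega> n))\<^sup>2 / (K * real (Suc n)) + (drift2 (\<omega> n))\<^sup>2 / (K * real (Suc n)))) < \<infinity>"
  proof (rule supermartingale_sum_finite[where V="\<lambda>n c. ennreal (Psi c)" and Q=at_time])
    show "AE \<omega> in law. \<forall>n. at_time n (\<omega> n)" using AE_path by eventually_elim blast
    show "0 \<le> (4 + 4 * (al * K)) * (1 / real (Suc n) ^ 2)" for n using al K_pos by simp
    show "summable (\<lambda>n. (4 + 4 * (al * K)) * (1 / real (Suc n) ^ 2))"
      by (intro summable_mult) (use inverse_squares_sums in \<open>auto simp: sums_iff add.commute\<close>)
    have "(\<integral>\<^sup>+\<omega>. ennreal (Psi (\<omega> 0)) \<partial>law) = (\<integral>\<^sup>+\<omega>. ennreal (Psi ((b1, r1), (b2, r2))) \<partial>law)"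
      by (rule nn_integral_cong_AE) (use AE_urn_path in \<open>eventually_elim, simp\<close>)
    then show "(\<integral>\<^sup>+\<omega>. ennreal (Psi (\<omega> 0)) \<partial>law) < \<infinity>"
      by (simp add: emeasure_space_1 del: urn.PF.space_lim)
  qed (rule Psi(2))
  then show ?thesis
    using AE_path
  proof eventually_elim
    case (elim \<omega>)
    have step: "\<bar>prop1 (\<omega> (Suc n)) - prop1 (\<omega> n)\<bar> \<le> 2 / real (Suc n)" "\<bar>prop2 (\<omega> (Suc n)) - prop2 (\<omega> n)\<bar> \<le> 2 / real (Suc n)" for n
      using elim prop_bump_diff by metis+
    have lip: "\<bar>drift al p (s (Suc n)) (t (Suc n)) - drift al p (s n) (t n)\<bar> \<le> ((2 * al + 1) * 4) / real (Suc n)"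
      if "\<And>n. \<bar>s n\<bar> \<le> 1" "\<And>n. \<bar>t n\<bar> \<le> 1" "\<And>n. \<bar>s (Suc n) - s n\<bar> \<le> 2 / real (Suc n)" "\<And>n. \<bar>t (Suc n) - t n\<bar> \<le> 2 / real (Suc n)" for s t n
    proof -
      have "\<bar>drift al p (s (Suc n)) (t (Suc n)) - drift al p (s n) (t n)\<bar> \<le> (2 * al + 1) * (\<bar>s (Suc n) - s n\<bar> + \<bar>t (Suc n) - t n\<bar>)"
        by (rule drift_lipschitz) (rule that)+
      also have "\<dots> \<le> (2 * al + 1) * (2 / real (Suc n) + 2 / real (Suc n))"
        using al that(3)[of n] that(4)[of n] by (intro mult_left_mono add_mono) auto
      also have "\<dots> = ((2 * al + 1) * 4) / real (Suc n)" by simp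
      finally show ?thesis .
    qed
    have sum: "summable (\<lambda>n. (drift1 (\<omega> n))\<^sup>2 / (K * real (Suc n)) + (drift2 (\<omega> n))\<^sup>2 / (K * real (Suc n)))"
      using elim K_pos by (intro summable_suminf_not_top) (auto simp: less_top)
    have sm: "summable (\<lambda>n. (f n)\<^sup>2 / real (Suc n))"
      if f: "\<And>n. (f n)\<^sup>2 / (K * real (Suc n)) \<le> (drift1 (\<omega> n))\<^sup>2 / (K * real (Suc n)) + (drift2 (\<omega> n))\<^sup>2 / (K * real (Suc n))" for f :: "nat \<Rightarrow> real"
    proof -
      have "summable (\<lambda>n. K * ((f n)\<^sup>2 / (K * real (Suc n))))"
        by (intro summable_mult summable_comparison_test'[OF sum, of 0]) (use f K_pos in simp)
      then show ?thesis using K_pos by simp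
    qed
    have C: "0 \<le> (2 * al + 1) * 4" using al by simp
    have "(\<lambda>n. drift1 (\<omega> n)) \<longlonglongrightarrow> 0"
      by (rule tendsto_0_if_weighted_square_summable[OF C lip[OF abs_sprop_le_1 abs_sprop_le_1 step] sm])
        (use K_pos in simp)
    moreover have "(\<lambda>n. drift2 (\<omega> n)) \<longlonglongrightarrow> 0"
      by (rule tendsto_0_if_weighted_square_summable[OF C lip[OF abs_sprop_le_1 abs_sprop_le_1 step(2) step(1)] sm])
        (use K_pos in simp)
    ultimately show ?case by blast
  qed
qed

end

section \<open>Escape from balanced configurations\<close>

text \<open>The second order remainder is exactly \<open>d^2 / (X^2 * (X + d))\<close>; the
  hypothesis \<open>X / 2 <= X + d\<close> bounds its last factor.\<close>

lemma reciprocal_expansion: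
  fixes X d :: real
  assumes "0 < X" "X / 2 \<le> X + d"
  shows "1 / (X + d) \<le> 1 / X - d / X\<^sup>2 + 2 * d\<^sup>2 / X ^ 3"
proof -
  have pos: "0 < X + d" using assms by linarith
  have "1 / (X + d) = 1 / X - d / X\<^sup>2 + d\<^sup>2 / X\<^sup>2 * (1 / (X + d))"
    using assms(1) pos by (simp add: divide_simps power2_eq_square) (simp add: algebra_simps)
  also have "d\<^sup>2 / X\<^sup>2 * (1 / (X + d)) \<le> d\<^sup>2 / X\<^sup>2 * (1 / (X / 2))"
    using assms pos by (intro mult_left_mono divide_left_mono) auto
  also have "d\<^sup>2 / X\<^sup>2 * (1 / (X / 2)) = 2 * d\<^sup>2 / X ^ 3"
    using assms(1) by (simp add: power2_eq_square power3_eq_cube)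
  finally show ?thesis by simp
qed

text \<open>
  The constants stem from the increment \<open>d\<close> of \<open>Y\<^sup>2 + 64 * t\<close> in one step, for which
  \<open>\<bar>d\<bar> \<le> 4 * \<bar>Y\<bar> + 132\<close> and hence \<open>d\<^sup>2 \<le> 32 * Y\<^sup>2 + 34848\<close>; the factor 64 makes the second order term
  negligible against the gain \<open>4 * Y\<^sup>2 / t\<close>.
\<close>

lemma escape_contraction:
  fixes t Y E D v l :: real
  defines "X \<equiv> Y\<^sup>2 + 64 * t"
  assumes t: "0 < t" "2 * (1089 + 2 * D\<^sup>2) \<le> v * t" and l: "0 \<le> l" "l \<le> 1/4" "l \<le> v / 256"
    and E: "4 * Y\<^sup>2 / t - 2 * D * \<bar>Y\<bar> / t + 128 + v \<le> E"
  shows "(t + 2) * (1 / X - E / X\<^sup>2 + 2 * (32 * Y\<^sup>2 + 34848) / X ^ 3) \<le> (1 - l / t) * (t / X)"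
proof -
  have X: "0 < X" "64 * t \<le> X" unfolding X_def using t by (simp_all add: add_nonneg_pos)
  have "2 * (32 * Y\<^sup>2 + 34848) / X \<le> 2 * (32 * Y\<^sup>2 + 34848) / (64 * t)"
    using X t by (intro divide_left_mono) auto
  also have "\<dots> = Y\<^sup>2 / t + 1089 / t" using t by (simp add: field_simps)
  finally have 1: "2 * (32 * Y\<^sup>2 + 34848) / X \<le> Y\<^sup>2 / t + 1089 / t" .
  have "2 * D * \<bar>Y\<bar> \<le> Y\<^sup>2 / 2 + 2 * D\<^sup>2"
    using zero_le_power2[of "\<bar>Y\<bar> - 2 * D"] by (simp add: power2_eq_square algebra_simps)
  then have 2: "2 * D * \<bar>Y\<bar> / t \<le> Y\<^sup>2 / t / 2 + 2 * D\<^sup>2 / t"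
    using t divide_right_mono[of "2 * D * \<bar>Y\<bar>" "Y\<^sup>2 / 2 + 2 * D\<^sup>2" t] by (simp add: add_divide_distrib)
  have 3: "1089 / t + 2 * D\<^sup>2 / t \<le> v / 2" using t by (simp add: field_simps)
  define y W Z q r where "y = Y\<^sup>2 / t" and "W = 2 * D * \<bar>Y\<bar> / t" and "Z = 2 * (32 * Y\<^sup>2 + 34848) / X"
    and "q = 1089 / t" and "r = 2 * D\<^sup>2 / t"
  have "Z \<le> y + q" "W \<le> y / 2 + r" "q + r \<le> v / 2"
    using 1 2 3 by (simp_all only: y_def W_def Z_def q_def r_def)
  moreover have "4 * y - W + 128 + v \<le> E" using E by (simp add: y_def W_def)
  moreover have "y * l \<le> y * (1/4)" using t l by (intro mult_left_mono) (auto simp: y_def)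
  moreover have "(2 + 2 * l) * X / t = 2 * y + 2 * (y * l) + 128 + 128 * l"
    unfolding X_def y_def using t by (simp add: field_simps)
  \<comment> \<open>The budget behind the bounds on \<open>l\<close>: of \<open>4 * y\<close>, the
    term \<open>W\<close> uses \<open>y / 2\<close> and \<open>Z\<close> uses \<open>y\<close>,
    which leaves \<open>2 * y + y / 2\<close> and room for \<open>2 * y * l\<close> with
    \<open>l <= 1/4\<close>. Of \<open>v\<close>, half pays for \<open>q + r\<close> and the other
    half for \<open>128 * l\<close>.\<close>
  ultimately have "(2 + 2 * l) * X / t \<le> E - Z" using l by linarith
  then have gain: "(2 + 2 * l) * X / t \<le> E - 2 * (32 * Y\<^sup>2 + 34848) / X" by (simp only: Z_def)
  have "1 / X - E / X\<^sup>2 + 2 * (32 * Y\<^sup>2 + 34848) / X ^ 3 = (1 - (E - 2 * (32 * Y\<^sup>2 + 34848) / X) / X) / X"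
    using X by (simp add: field_simps power2_eq_square power3_eq_cube)
  also have "\<dots> \<le> (1 - ((2 + 2 * l) * X / t) / X) / X"
    using X gain by (intro divide_right_mono diff_left_mono) auto
  also have "\<dots> = (1 - (2 + 2 * l) / t) / X" using X by simp
  finally have "(t + 2) * (1 / X - E / X\<^sup>2 + 2 * (32 * Y\<^sup>2 + 34848) / X ^ 3) \<le> (t + 2) * ((1 - (2 + 2 * l) / t) / X)"
    using t by (intro mult_left_mono) auto
  also have "\<dots> = ((t + 2) * (1 - (2 + 2 * l) / t)) / X" by simp
  also have "\<dots> \<le> (t - l) / X"
  proof (rule divide_right_mono)
    have "(t + 2) * (1 - (2 + 2 * l) / t) = t - 2 * l - 2 * (2 + 2 * l) / t"
      using t by (simp add: field_simps)
    also have "\<dots> \<le> t - l" using t l by (smt (verit) divide_nonneg_pos)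
    finally show "(t + 2) * (1 - (2 + 2 * l) / t) \<le> t - l" .
  qed (use X in simp)
  also have "\<dots> = (1 - l / t) * (t / X)" using t by (simp add: left_diff_distrib diff_divide_distrib)
  finally show ?thesis .
qed

text \<open>Lets the square of a positive part be expanded like an ordinary square: where the
  truncation is active before the step, the new value is at most \<open>- d\<close>.\<close>

lemma truncated_square_step:
  fixes a u d :: real
  shows "(max 0 (a - (u + d)))\<^sup>2 \<le> (max 0 (a - u) - d)\<^sup>2"
proof (cases "0 \<le> a - (u + d)")
  case True
  show ?thesis
  proof (cases "0 \<le> a - u")
    case False
    have "(a - (u + d))\<^sup>2 \<le> (- d)\<^sup>2" using True False by (intro power_mono) auto
    then show ?thesis using True False by (simp add: max_def)
  qed (use True in \<open>simp add: max_def algebra_simps\<close>)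
qed (simp add: max_def)

section \<open>Colour excess, repulsion from balance and noise\<close>

context two_urns
begin

text \<open>The number of balls in both urns, hence the exact denominator of \<open>tprop\<close>;
  it grows by \<open>2\<close> per step.\<close>

definition clock :: "nat \<Rightarrow> real" where
  "clock n = 2 * real n + real (b1 + r1) + real (b2 + r2)"

definition excess :: "config \<Rightarrow> real" where
  "excess c = real (black_total c) - real (red_total c)"

lemma clock_Suc: "clock (Suc n) = clock n + 2"
  by (simp add: clock_def)

lemma clock_ge_2: "2 \<le> clock n"
  using r1 b2 by (simp add: clock_def)

lemma clock_le: "clock n \<le> 2 * K * real (Suc n)"
  using time_scale[of n] by (simp add: clock_def)

lemma inverse_Suc_le: "1 / real (Suc n) \<le> 2 * K / clock n"
  using clock_le[of n] clock_ge_2[of n] by (simp add: field_simps)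

lemma filterlim_clock: "filterlim clock at_top sequentially"
proof (rule filterlim_at_top_mono[OF filterlim_real_sequentially])
  show "eventually (\<lambda>n. real n \<le> clock n) sequentially" by (simp add: clock_def)
qed

lemma tprop_eq: "at_time n c \<Longrightarrow> tprop c = excess c / clock n"
  unfolding tprop_def excess_def clock_def by (simp only: at_timeD(5))

lemma excess_bump: "excess (bump c i j) = excess c + sg i + sg j"
  by (auto simp: excess_def bump_def black_total_def red_total_def add_ball_def sg_def)

lemma abs_tprop_le_max:
  assumes "at_time n c" "\<bar>prop1 c\<bar> \<le> s" "\<bar>prop2 c\<bar> \<le> s"
  shows "\<bar>tprop c\<bar> \<le> s"
proof -
  note T = at_timeD[OF assms(1)]
  let ?n1 = "real n + real (b1 + r1)" and ?n2 = "real n + real (b2 + r2)"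
  have n1: "0 < ?n1" "0 < ?n2" using r1 b2 by simp_all
  have "real (black (fst c)) - real (red (fst c)) = prop1 c * ?n1"
    "real (black (snd c)) - real (red (snd c)) = prop2 c * ?n2"
    unfolding sprop_def T(3,4) using n1 by simp_all
  then have e: "excess c = prop1 c * ?n1 + prop2 c * ?n2"
    by (simp add: excess_def black_total_def red_total_def)
  have "\<bar>excess c\<bar> \<le> \<bar>prop1 c\<bar> * ?n1 + \<bar>prop2 c\<bar> * ?n2"
    unfolding e using abs_triangle_ineq[of "prop1 c * ?n1" "prop2 c * ?n2"] by (simp add: abs_mult)
  also have "\<dots> \<le> s * ?n1 + s * ?n2"
    using assms n1 by (intro add_mono mult_right_mono) auto
  also have "\<dots> = s * clock n" by (simp add: clock_def algebra_simps)
  finally show ?thesis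
    using clock_ge_2[of n] by (simp add: tprop_eq[OF assms(1)] abs_divide divide_le_eq)
qed

text \<open>The box in which \<open>reinf_gap_mono\<close> applies to both urns. Including
  \<open>at_time\<close> lets membership alone fix the urn sizes.\<close>

definition core :: "real \<Rightarrow> nat \<Rightarrow> config set" where
  "core a1 n = {c. at_time n c \<and> \<bar>prop1 c\<bar> < tanh a1 \<and> \<bar>prop2 c\<bar> < tanh a1}"

text \<open>Away from monochromatic urns the draws stay uniformly random: the means are bounded by a
  constant below \<open>1\<close>, which makes \<open>noise\<close> positive.\<close>

lemma draw_mean_small:
  assumes "c \<in> core a1 n"
  shows "\<bar>draw_mean al p c (fst c)\<bar> \<le> reinf al (tanh a1)" "\<bar>draw_mean al p c (snd c)\<bar> \<le> reinf al (tanh a1)"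
proof -
  have c: "at_time n c" "\<bar>prop1 c\<bar> < tanh a1" "\<bar>prop2 c\<bar> < tanh a1" using assms by (auto simp: core_def)
  have t1: "tanh a1 < 1" by (rule tanh_real_lt_1)
  have b: "\<bar>reinf al x\<bar> \<le> reinf al (tanh a1)" if "\<bar>x\<bar> \<le> tanh a1" for x
    using reinf_mono[of al x "tanh a1"] reinf_mono[of al "- x" "tanh a1"] that t1 al by (auto simp: abs_le_iff)
  have "\<bar>p * x + (1 - p) * y\<bar> \<le> r" if xy: "\<bar>x\<bar> \<le> r" "\<bar>y\<bar> \<le> r" for x y r
  proof -
    have "\<bar>p * x\<bar> \<le> p * r" "\<bar>(1 - p) * y\<bar> \<le> (1 - p) * r"
      unfolding abs_mult using xy p by (auto intro!: mult_mono)
    then have "\<bar>p * x + (1 - p) * y\<bar> \<le> p * r + (1 - p) * r"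
      using abs_triangle_ineq[of "p * x" "(1 - p) * y"] by linarith
    then show ?thesis by (simp add: algebra_simps)
  qed
  then show "\<bar>draw_mean al p c (fst c)\<bar> \<le> reinf al (tanh a1)" "\<bar>draw_mean al p c (snd c)\<bar> \<le> reinf al (tanh a1)"
    unfolding draw_mean_def using c b[OF abs_tprop_le_max[OF c(1)]] b by simp_all
qed

text \<open>Since \<open>clock\<close> grows by \<open>2\<close>, a mean increment of the excess of
  at least \<open>2 * tprop\<close> means that \<open>tprop\<close> does not shrink in mean. The
  interaction contributes by \<open>reinf_ge\<close>, the separate urns by monotonicity of the
  gap.\<close>

lemma draw_mean_outward:
  assumes Kc: "(cosh (al * a1))\<^sup>2 < al * (cosh a1)\<^sup>2" and c: "c \<in> core a1 n"
    and \<sigma>: "\<sigma> = 1 \<or> \<sigma> = - 1" and pos: "0 < \<sigma> * tprop c"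
  shows "2 * (\<sigma> * tprop c) - 2 * al * K / real (Suc n)
    \<le> \<sigma> * (draw_mean al p c (fst c) + draw_mean al p c (snd c))"
proof -
  have c': "at_time n c" "\<bar>prop1 c\<bar> < tanh a1" "\<bar>prop2 c\<bar> < tanh a1" using c by (auto simp: core_def)
  have odd: "\<sigma> * reinf al x = reinf al (\<sigma> * x)" for x using \<sigma> by auto
  define s t u where "s = \<sigma> * prop1 c" and "t = \<sigma> * prop2 c" and "u = \<sigma> * tprop c"
  have st: "\<bar>s\<bar> < tanh a1" "\<bar>t\<bar> < tanh a1" using \<sigma> c' by (auto simp: s_def t_def)
  have t1: "tanh a1 < 1" by (rule tanh_real_lt_1)
  have "\<bar>u\<bar> \<le> 1" using \<sigma> abs_tprop_le_1[of c] by (auto simp: u_def)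
  then have u: "0 < u" "u \<le> 1" using pos by (auto simp: u_def)
  have "\<bar>tprop c - (prop1 c + prop2 c) / 2\<bar> \<le> K / real (Suc n)" by (rule tprop_near[OF c'(1)])
  moreover define k where "k = K / real (Suc n)"
  ultimately have near: "2 * u - 2 * k \<le> s + t"
    using \<sigma> by (auto simp: u_def s_def t_def add_divide_distrib k_def)
  have K0: "0 \<le> k" using K_pos by (simp add: k_def)
  have sum: "2 * u - 2 * (al * k) \<le> reinf al s + reinf al t"
  proof (cases "0 \<le> s + t")
    case True
    have "reinf al (- t) - (- t) \<le> reinf al s - s"
      using st True by (intro reinf_gap_mono[OF al Kc]) auto
    then have "s + t \<le> reinf al s + reinf al t" by simp
    moreover have "k \<le> al * k" using mult_right_mono[of 1 al k] al K0 by simp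
    ultimately show ?thesis using near by linarith
  next
    \<comment> \<open>The midpoint may be negative although \<open>u\<close> is positive, because
      the urns differ in size. Then both are of order \<open>1 / n\<close>, and the Lipschitz bound
      of \<open>reinf\<close> costs only the factor \<open>al\<close> in the error.\<close>
    case False
    have "reinf al (- t) - reinf al s \<le> al * (- t - s)"
      using al st t1 False by (intro reinf_diff_bounds) auto
    then have "al * (s + t) \<le> reinf al s + reinf al t" by (simp add: algebra_simps)
    moreover have "al * (2 * u - 2 * k) \<le> al * (s + t)"
      using near al by (intro mult_left_mono) auto
    moreover have "u \<le> al * u" using al u by (simp add: mult_le_cancel_right1)
    moreover have "al * (2 * u - 2 * k) = 2 * (al * u) - 2 * (al * k)"
      by (simp add: right_diff_distrib)
    ultimately show ?thesis by linarith
  qed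
  have "2 * u - 2 * (al * k) \<le> 2 * u - (1 - p) * (2 * (al * k))"
    using p al K0 by (simp add: mult_left_le_one_le)
  also have "\<dots> = p * (2 * u) + (1 - p) * (2 * u - 2 * (al * k))"
    by (simp add: algebra_simps)
  also have "\<dots> \<le> p * (2 * reinf al u) + (1 - p) * (reinf al s + reinf al t)"
    using p sum reinf_ge[OF al, of u] u by (intro add_mono mult_left_mono) auto
  also have "\<dots> = \<sigma> * (draw_mean al p c (fst c) + draw_mean al p c (snd c))"
    unfolding draw_mean_def s_def t_def u_def odd[symmetric] by (simp add: algebra_simps)
  finally show ?thesis by (simp add: u_def k_def)
qed


text \<open>
  In logarithmic time \<open>excess / sqrt clock\<close> behaves like an unstable Ornstein-Uhlenbeck process, so while
  the process stays in the core this function decreases in mean and \<open>\<bar>excess\<bar>\<close> outgrows \<open>sqrt clock\<close>.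
\<close>

definition localization :: "nat \<Rightarrow> config \<Rightarrow> real" where
  "localization n c = clock n / ((excess c)\<^sup>2 + 64 * clock n)"

lemma localization_nonneg: "0 \<le> localization n c"
  using clock_ge_2[of n] by (simp add: localization_def)

lemma localization_le: "localization n c \<le> 1 / 64"
proof -
  have "clock n / ((excess c)\<^sup>2 + 64 * clock n) \<le> clock n / (64 * clock n)"
    using clock_ge_2[of n] by (intro divide_left_mono) (auto intro!: mult_pos_pos add_nonneg_pos)
  then show ?thesis using clock_ge_2[of n] by (simp add: localization_def)
qed

lemma localization_bump:
  fixes n c i j
  defines "t \<equiv> clock n" and "Y \<equiv> excess c"
  defines "X \<equiv> Y\<^sup>2 + 64 * t"
  shows "localization (Suc n) (bump c i j) \<le>
    (t + 2) * (1 / X - (2 * Y * (sg i + sg j) + 130 + 2 * (sg i * sg j)) / X\<^sup>2 + 2 * (32 * Y\<^sup>2 + 34848) / X ^ 3)"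
proof -
  have t: "2 \<le> t" by (simp add: t_def clock_ge_2)
  have X: "0 < X" "Y\<^sup>2 + 128 \<le> X" unfolding X_def using t by (simp_all add: add_nonneg_pos)
  define D where "D = sg i + sg j"
  have D: "\<bar>D\<bar> \<le> 2" by (simp add: D_def sg_def)
  \<comment> \<open>The increment of \<open>X\<close>: the clock contributes
    \<open>64 * 2 = 128\<close>, and \<open>D^2 = 2 + 2 * sg i * sg j\<close> contributes the other
    \<open>2\<close> of the constant \<open>130\<close>.\<close>
  define d where "d = 2 * Y * D + D\<^sup>2 + 128"
  have D2: "D\<^sup>2 = 2 + 2 * (sg i * sg j)" by (simp add: D_def power2_sum)
  have X': "(Y + D)\<^sup>2 + 64 * (t + 2) = X + d"
    by (simp add: X_def d_def power2_sum algebra_simps)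
  have Dle: "D\<^sup>2 \<le> 4" using D abs_le_square_iff[of D 2] by simp
  \<comment> \<open>Young's inequality with a small weight on \<open>Y^2\<close>, so that a decrease
    of \<open>X\<close> never exceeds half of it, as the reciprocal expansion requires.\<close>
  have "0 \<le> (Y / 2 + 2 * D)\<^sup>2" by simp
  then have "- (2 * Y * D) \<le> Y\<^sup>2 / 4 + 4 * D\<^sup>2" by (simp add: power2_sum power2_eq_square algebra_simps)
  then have half: "X / 2 \<le> X + d" using X Dle zero_le_power2[of Y] zero_le_power2[of D] unfolding d_def by linarith
  have "\<bar>2 * Y * D\<bar> \<le> 4 * \<bar>Y\<bar>"
    using mult_left_mono[OF D, of "2 * \<bar>Y\<bar>"] by (simp add: abs_mult)
  then have "\<bar>d\<bar> \<le> 4 * \<bar>Y\<bar> + 132" using Dle zero_le_power2[of D] unfolding d_def by linarith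
  then have "\<bar>d\<bar>\<^sup>2 \<le> (4 * \<bar>Y\<bar> + 132)\<^sup>2" by (intro power_mono) auto
  also have "(4 * \<bar>Y\<bar> + 132)\<^sup>2 \<le> 32 * Y\<^sup>2 + 34848"
    using zero_le_power2[of "4 * \<bar>Y\<bar> - 132"] by (simp add: power2_sum power2_diff)
  finally have d2: "d\<^sup>2 \<le> 32 * Y\<^sup>2 + 34848" by simp
  have "localization (Suc n) (bump c i j) = (t + 2) * (1 / (X + d))"
    unfolding localization_def clock_Suc excess_bump t_def[symmetric] Y_def[symmetric] X'[symmetric]
    by (simp add: D_def add.assoc)
  also have "\<dots> \<le> (t + 2) * (1 / X - d / X\<^sup>2 + 2 * d\<^sup>2 / X ^ 3)"
    using reciprocal_expansion[OF X(1) half] t by (intro mult_left_mono) auto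
  also have "\<dots> \<le> (t + 2) * (1 / X - d / X\<^sup>2 + 2 * (32 * Y\<^sup>2 + 34848) / X ^ 3)"
    using X(1) d2 t by (intro mult_left_mono add_left_mono divide_right_mono) auto
  also have "d = 2 * Y * (sg i + sg j) + 130 + 2 * (sg i * sg j)"
    unfolding d_def D2 by (simp add: D_def)
  finally show ?thesis .
qed

text \<open>A lower bound in the core for \<open>2 + 2 * m1 * m2\<close>, the conditional second
  moment of the increment \<open>sg i + sg j\<close> of the excess.\<close>

definition noise :: "real \<Rightarrow> real" where
  "noise a1 = 2 - 2 * (reinf al (tanh a1))\<^sup>2"

lemma noise_pos: "0 < noise a1"
proof -
  have "\<bar>reinf al (tanh a1)\<bar> < 1" using tanh_real_bounds[of a1] by (intro abs_reinf_less) auto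
  then have "(reinf al (tanh a1))\<^sup>2 < 1" by (simp add: abs_square_less_1)
  then show ?thesis by (simp add: noise_def)
qed

text \<open>The largest \<open>l\<close> that \<open>escape_contraction\<close> admits for
  \<open>v = noise a1\<close>.\<close>

definition escape_rate :: "real \<Rightarrow> real" where
  "escape_rate a1 = min (1/4) (noise a1 / 256)"

lemma escape_rate: "0 < escape_rate a1" "escape_rate a1 \<le> 1/4" "escape_rate a1 \<le> noise a1 / 256"
  using noise_pos[of a1] by (simp_all add: escape_rate_def)

text \<open>The drift term pushes the excess outward up to its error, and the noise supplies a
  strict surplus even where the excess vanishes. The lower bound on \<open>clock n\<close> makes all
  error terms use at most half of this surplus.\<close>

lemma localization_step:
  assumes Kc: "(cosh (al * a1))\<^sup>2 < al * (cosh a1)\<^sup>2" and c: "c \<in> core a1 n"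
    and n: "2 * (1089 + 2 * (4 * al * K\<^sup>2)\<^sup>2) \<le> noise a1 * clock n"
  shows "(\<integral>\<^sup>+c'. ennreal (localization (Suc n) c') \<partial>measure_pmf (urn_step al p c))
     \<le> ennreal ((1 - escape_rate a1 / clock n) * localization n c)"
proof -
  define t Y X where "t = clock n" and "Y = excess c" and "X = Y\<^sup>2 + 64 * t"
  define R where "R = 2 * (32 * Y\<^sup>2 + 34848) / X ^ 3"
  let ?m1 = "draw_mean al p c (fst c)" and ?m2 = "draw_mean al p c (snd c)"
  have c': "at_time n c" using c by (simp add: core_def)
  have t: "2 \<le> t" by (simp add: t_def clock_ge_2)
  have le: "localization (Suc n) (bump c i j) \<le> (t + 2) * (1 / X - 130 / X\<^sup>2 + R)
      + (- ((t + 2) * (2 * Y) / X\<^sup>2)) * sg i + (- ((t + 2) * (2 * Y) / X\<^sup>2)) * sg j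
      + (- ((t + 2) * 2 / X\<^sup>2)) * (sg i * sg j)" for i j
  proof -
    have "localization (Suc n) (bump c i j) \<le>
        (t + 2) * (1 / X - (2 * Y * (sg i + sg j) + 130 + 2 * (sg i * sg j)) / X\<^sup>2 + R)"
      unfolding R_def X_def t_def Y_def by (rule localization_bump)
    also have "\<dots> = (t + 2) * (1 / X - 130 / X\<^sup>2 + R)
      + (- ((t + 2) * (2 * Y) / X\<^sup>2)) * sg i + (- ((t + 2) * (2 * Y) / X\<^sup>2)) * sg j
      + (- ((t + 2) * 2 / X\<^sup>2)) * (sg i * sg j)"
      by (simp add: add_divide_distrib algebra_simps)
    finally show ?thesis .
  qed
  have p0: "0 \<le> p" "p \<le> 1" using p by simp_all
  define E where "E = 2 * Y * (?m1 + ?m2) + 130 + 2 * (?m1 * ?m2)"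
  have "(\<integral>\<^sup>+c'. ennreal (localization (Suc n) c') \<partial>measure_pmf (urn_step al p c)) \<le>
     ennreal ((t + 2) * (1 / X - 130 / X\<^sup>2 + R)
      + (- ((t + 2) * (2 * Y) / X\<^sup>2)) * ?m1 + (- ((t + 2) * (2 * Y) / X\<^sup>2)) * ?m2
      + (- ((t + 2) * 2 / X\<^sup>2)) * (?m1 * ?m2))"
    by (rule nn_integral_urn_step_le(1)[OF p0 localization_nonneg le at_timeD(1,2)[OF c']])
  also have "(t + 2) * (1 / X - 130 / X\<^sup>2 + R)
      + (- ((t + 2) * (2 * Y) / X\<^sup>2)) * ?m1 + (- ((t + 2) * (2 * Y) / X\<^sup>2)) * ?m2
      + (- ((t + 2) * 2 / X\<^sup>2)) * (?m1 * ?m2) = (t + 2) * (1 / X - E / X\<^sup>2 + R)"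
    unfolding E_def by (simp add: add_divide_distrib algebra_simps)
  also have "\<dots> \<le> (1 - escape_rate a1 / t) * (t / X)"
    unfolding R_def X_def
  \<comment> \<open>The value of \<open>D\<close> is the drift error
    \<open>2 * al * K / (n + 1)\<close> rewritten with
    \<open>1 / (n + 1) <= 2 * K / clock n\<close>.\<close>
  proof (rule escape_contraction[where D="4 * al * K\<^sup>2" and v="noise a1"])
    have "\<bar>?m1 * ?m2\<bar> \<le> reinf al (tanh a1) * reinf al (tanh a1)"
      unfolding abs_mult using draw_mean_small[OF c] by (intro mult_mono) auto
    then have mm: "noise a1 \<le> 2 + 2 * (?m1 * ?m2)"
      by (simp add: noise_def power2_eq_square abs_le_iff)
    have Ym: "2 * Y\<^sup>2 / t - 4 * al * K\<^sup>2 * \<bar>Y\<bar> / t \<le> Y * (?m1 + ?m2)"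
    proof (cases "Y = 0")
      case False
      define \<sigma> where "\<sigma> = sgn Y"
      have s: "\<sigma> = 1 \<or> \<sigma> = - 1" "\<sigma> * Y = \<bar>Y\<bar>" "\<bar>Y\<bar> * \<sigma> = Y"
        using False by (auto simp: \<sigma>_def sgn_if)
      have u: "\<sigma> * tprop c = \<bar>Y\<bar> / t"
        using s(2) by (simp add: tprop_eq[OF c'] Y_def t_def)
      have "0 < \<bar>Y\<bar> / t" using False t by simp
      then have o: "2 * (\<bar>Y\<bar> / t) - 2 * al * K / real (Suc n) \<le> \<sigma> * (?m1 + ?m2)"
        using draw_mean_outward[OF Kc c s(1)] unfolding u by simp
      have "2 * al * K * (1 / real (Suc n)) \<le> 2 * al * K * (2 * K / t)"
        unfolding t_def using al K_pos inverse_Suc_le by (intro mult_left_mono) auto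
      then have "2 * (\<bar>Y\<bar> / t) - 4 * al * K\<^sup>2 / t \<le> \<sigma> * (?m1 + ?m2)"
        using o by (simp add: power2_eq_square)
      then have "\<bar>Y\<bar> * (2 * (\<bar>Y\<bar> / t) - 4 * al * K\<^sup>2 / t) \<le> \<bar>Y\<bar> * (\<sigma> * (?m1 + ?m2))"
        by (rule mult_left_mono) simp
      also have "\<dots> = Y * (?m1 + ?m2)" by (simp only: mult.assoc[symmetric] s(3))
      also have "\<bar>Y\<bar> * (2 * (\<bar>Y\<bar> / t) - 4 * al * K\<^sup>2 / t) = 2 * Y\<^sup>2 / t - 4 * al * K\<^sup>2 * \<bar>Y\<bar> / t"
      proof -
        have "\<bar>Y\<bar> * (2 * (\<bar>Y\<bar> / t) - 4 * al * K\<^sup>2 / t) = 2 * (\<bar>Y\<bar> * \<bar>Y\<bar>) / t - 4 * al * K\<^sup>2 * \<bar>Y\<bar> / t"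
          by (simp only: right_diff_distrib) (simp only: times_divide_eq_right mult.assoc mult.left_commute mult.commute)
        also have "\<bar>Y\<bar> * \<bar>Y\<bar> = Y\<^sup>2" by (simp add: power2_eq_square)
        finally show ?thesis .
      qed
      finally show ?thesis .
    qed simp
    define A B where "A = Y\<^sup>2 / t" and "B = 4 * al * K\<^sup>2 * \<bar>Y\<bar> / t"
    have "2 * A - B \<le> Y * (?m1 + ?m2)" using Ym by (simp add: A_def B_def)
    moreover have "E = 2 * (Y * (?m1 + ?m2)) + 130 + 2 * (?m1 * ?m2)" by (simp add: E_def)
    ultimately have "4 * A - 2 * B + 128 + noise a1 \<le> E" using mm by linarith
    then show "4 * Y\<^sup>2 / t - 2 * (4 * al * K\<^sup>2) * \<bar>Y\<bar> / t + 128 + noise a1 \<le> E"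
      by (simp add: A_def B_def)
  qed (use t n escape_rate[of a1] in \<open>auto simp: t_def\<close>)
  also have "t / X = localization n c" by (simp add: localization_def t_def X_def Y_def)
  finally show ?thesis by (simp add: t_def ennreal_leI)
qed

section \<open>Balanced paths have probability zero\<close>

definition stay :: "real \<Rightarrow> nat \<Rightarrow> nat \<Rightarrow> (nat \<Rightarrow> config) set" where
  "stay a1 N n = {\<omega>. \<forall>k\<in>{N..n}. \<omega> k \<in> core a1 k}"

lemma past_dep_stay: "past_dep n (\<lambda>\<omega>. \<omega> \<in> stay a1 N n)"
  by (rule past_depI) (simp add: stay_def)

text \<open>Accumulated contraction rates. The clock is linear in time, so this is logarithmic time
  up to constants, and it diverges like the harmonic series.\<close>

definition time_sum :: "real \<Rightarrow> nat \<Rightarrow> nat \<Rightarrow> real" where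
  "time_sum a1 N m = (\<Sum>k<m. escape_rate a1 / clock (N + k))"

lemma time_sum_nonneg: "0 \<le> time_sum a1 N m"
proof -
  have "0 \<le> escape_rate a1 / clock k" for k
    using escape_rate(1)[of a1] clock_ge_2[of k] by simp
  then show ?thesis unfolding time_sum_def by (intro sum_nonneg) blast
qed

lemma time_sum_unbounded: "\<exists>m0. \<forall>m\<ge>m0. B < time_sum a1 N m"
proof -
  have nn: "0 \<le> escape_rate a1 / clock (N + k)" for k
    using escape_rate(1)[of a1] clock_ge_2[of "N + k"] by simp
  have "\<exists>m. B < time_sum a1 N m"
  proof (rule ccontr)
    assume "\<nexists>m. B < time_sum a1 N m"
    then have "summable (\<lambda>k. escape_rate a1 / clock (N + k))"
      using nn by (intro summableI_nonneg_bounded[of _ B]) (auto simp: time_sum_def not_less)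
    then have s: "summable (\<lambda>k. (2 * K / escape_rate a1) * (escape_rate a1 / clock (k + N)))"
      by (intro summable_mult) (simp add: add.commute)
    have "norm (1 / real (Suc (k + N))) \<le> (2 * K / escape_rate a1) * (escape_rate a1 / clock (k + N))" for k
      using inverse_Suc_le[of "k + N"] escape_rate(1)[of a1] by simp
    then have "summable (\<lambda>k. 1 / real (Suc (k + N)))"
      by (intro summable_comparison_test'[OF s, of 0])
    then have "summable (\<lambda>k. 1 / real (Suc k))"
      using summable_iff_shift[of "\<lambda>k. 1 / real (Suc k)" N] by simp
    then have "summable (\<lambda>n. 1 / real n)" using summable_Suc_iff[of "\<lambda>n. 1 / real n"] by simp
    then show False using not_summable_harmonic[where 'a=real] by (simp add: inverse_eq_divide)
  qed
  then obtain m0 where m0: "B < time_sum a1 N m0" by blast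
  have "time_sum a1 N m0 \<le> time_sum a1 N m" if "m0 \<le> m" for m
    unfolding time_sum_def using that nn by (intro sum_mono2) auto
  with m0 show ?thesis by (meson order_less_le_trans)
qed

text \<open>Iterating the one-step contraction gives a product of factors \<open>1 - x\<close>. It
  is kept in the form \<open>1 / (1 + sum)\<close>, which suffices and is preserved because
  \<open>(1 - x) * (1 + w + x) <= 1 + w\<close>.\<close>

lemma localization_decay:
  assumes Kc: "(cosh (al * a1))\<^sup>2 < al * (cosh a1)\<^sup>2"
    and N: "\<And>n. N \<le> n \<Longrightarrow> 2 * (1089 + 2 * (4 * al * K\<^sup>2)\<^sup>2) \<le> noise a1 * clock n"
  shows "(\<integral>\<^sup>+\<omega>. indicator (stay a1 N (N + m)) \<omega> * ennreal (localization (N + m) (\<omega> (N + m))) \<partial>law)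
    \<le> ennreal (1 / (64 * (1 + time_sum a1 N m)))"
proof (induction m)
  case 0
  interpret prob_space law by (rule prob_space_urn_law)
  have "(\<integral>\<^sup>+\<omega>. indicator (stay a1 N (N + 0)) \<omega> * ennreal (localization (N + 0) (\<omega> (N + 0))) \<partial>law) \<le>
      (\<integral>\<^sup>+\<omega>. ennreal (1 / 64) \<partial>law)"
  proof (rule nn_integral_mono)
    fix \<omega>
    show "indicator (stay a1 N (N + 0)) \<omega> * ennreal (localization (N + 0) (\<omega> (N + 0))) \<le> ennreal (1 / 64)"
      using ennreal_leI[OF localization_le] by (cases "\<omega> \<in> stay a1 N (N + 0)") (simp_all del: ennreal_le_iff)
  qed
  also have "\<dots> = ennreal (1 / 64)" by (simp add: emeasure_space_1 del: urn.PF.space_lim)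
  finally show ?case by (simp add: time_sum_def)
next
  case (Suc m)
  let ?n = "N + m" and ?w = "time_sum a1 N m"
  define x where "x = escape_rate a1 / clock ?n"
  have x: "0 \<le> x" "x \<le> 1"
    using escape_rate[of a1] clock_ge_2[of ?n] by (auto simp: x_def divide_le_eq)
  have w: "0 \<le> ?w" by (rule time_sum_nonneg)
  have m: "(\<lambda>\<omega>. indicator (stay a1 N ?n) \<omega> * ennreal (localization ?n (\<omega> ?n))) \<in> borel_measurable law"
  proof -
    have "past_dep ?n (\<lambda>\<omega>. indicator (stay a1 N ?n) \<omega> * ennreal (localization ?n (\<omega> ?n)))"
      using past_dep_stay[of ?n a1 N] by (auto simp: past_dep_def indicator_def)
    from measurable_past_dep[OF this] show ?thesis by (rule measurable_compose) simp
  qed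
  have "(\<integral>\<^sup>+\<omega>. indicator (stay a1 N (N + Suc m)) \<omega> * ennreal (localization (N + Suc m) (\<omega> (N + Suc m))) \<partial>law) \<le>
      (\<integral>\<^sup>+\<omega>. indicator (stay a1 N ?n) \<omega> * ennreal (localization (Suc ?n) (\<omega> (Suc ?n))) \<partial>law)"
    by (rule nn_integral_mono) (auto simp: stay_def split: split_indicator)
  also have "\<dots> = (\<integral>\<^sup>+\<omega>. (\<integral>\<^sup>+c. indicator (stay a1 N ?n) \<omega> * ennreal (localization (Suc ?n) c) \<partial>measure_pmf (urn_step al p (\<omega> ?n))) \<partial>law)"
    by (rule nn_integral_markov)
      (use past_dep_stay[of ?n a1 N] in \<open>auto simp: past_dep_def indicator_def fun_eq_iff\<close>)
  also have "\<dots> \<le> (\<integral>\<^sup>+\<omega>. ennreal (1 - x) * (indicator (stay a1 N ?n) \<omega> * ennreal (localization ?n (\<omega> ?n))) \<partial>law)"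
  proof (rule nn_integral_mono)
    fix \<omega>
    show "(\<integral>\<^sup>+c. indicator (stay a1 N ?n) \<omega> * ennreal (localization (Suc ?n) c) \<partial>measure_pmf (urn_step al p (\<omega> ?n)))
      \<le> ennreal (1 - x) * (indicator (stay a1 N ?n) \<omega> * ennreal (localization ?n (\<omega> ?n)))"
    proof (cases "\<omega> \<in> stay a1 N ?n")
      case True
      then have "\<omega> ?n \<in> core a1 ?n" by (simp add: stay_def)
      from localization_step[OF Kc this N] show ?thesis
        using True x by (simp add: x_def ennreal_mult' localization_nonneg)
    qed simp
  qed
  also have "\<dots> = ennreal (1 - x) * (\<integral>\<^sup>+\<omega>. indicator (stay a1 N ?n) \<omega> * ennreal (localization ?n (\<omega> ?n)) \<partial>law)"
    by (rule nn_integral_cmult[OF m])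
  also have "\<dots> \<le> ennreal (1 - x) * ennreal (1 / (64 * (1 + ?w)))"
    by (rule mult_left_mono[OF Suc]) simp
  also have "\<dots> = ennreal ((1 - x) * (1 / (64 * (1 + ?w))))"
    by (rule ennreal_mult'[symmetric]) (use x in simp)
  also have "\<dots> \<le> ennreal (1 / (64 * (1 + time_sum a1 N (Suc m))))"
  proof (rule ennreal_leI)
    have "time_sum a1 N (Suc m) = ?w + x" by (simp add: time_sum_def x_def)
    moreover have "(1 - x) / (1 + ?w) \<le> 1 / (1 + (?w + x))"
    proof -
      have "(1 - x) * (1 + (?w + x)) = 1 + ?w - x * (?w + x)" by (simp add: algebra_simps)
      moreover have "0 \<le> x * (?w + x)" using x w by simp
      ultimately have "(1 - x) * (1 + (?w + x)) \<le> 1 + ?w" by linarith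
      moreover define W V where "W = 1 + ?w" and "V = 1 + (?w + x)"
      moreover have "0 < W" "0 < V" using x w by (simp_all add: W_def V_def)
      ultimately have "(1 - x) / W \<le> 1 / V" by (simp add: divide_le_eq pos_le_divide_eq)
      then show ?thesis by (simp add: W_def V_def)
    qed
    moreover have "(1 - x) * (1 / (64 * (1 + ?w))) = (1 - x) / (1 + ?w) / 64"
      "1 / (64 * (1 + (?w + x))) = 1 / (1 + (?w + x)) / 64"
      by simp_all
    ultimately show "(1 - x) * (1 / (64 * (1 + ?w))) \<le> 1 / (64 * (1 + time_sum a1 N (Suc m)))"
      by (simp only: divide_right_mono[of "(1 - x) / (1 + ?w)" "1 / (1 + (?w + x))" 64])
  qed
  finally show ?case .
qed


text \<open>Sum of the two errors in one step, in units of \<open>1 / clock^2\<close>: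
  \<open>8 * al * K^2\<close> from the mean drift and \<open>16\<close> from the square of an
  increment of size at most \<open>4 / clock\<close>.\<close>

definition barrier_const :: real where
  "barrier_const = 8 * al * K\<^sup>2 + 16"

lemma barrier_const_pos: "0 < barrier_const"
  using al by (simp add: barrier_const_def add_nonneg_pos)

text \<open>
  The noise still to come after time \<open>n\<close> moves \<open>tprop\<close> by \<open>O(1 / sqrt (clock n))\<close> only; once
  \<open>\<bar>tprop\<bar>\<close> is a large multiple of this, it is unlikely to return to \<open>a / 2\<close>.
\<close>

definition barrier :: "real \<Rightarrow> real \<Rightarrow> nat \<Rightarrow> config \<Rightarrow> real" where
  "barrier \<sigma> a n c = (max 0 (a - \<sigma> * tprop c))\<^sup>2 + barrier_const / clock n"

lemma barrier_nonneg: "0 \<le> barrier \<sigma> a n c"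
  using barrier_const_pos clock_ge_2[of n] by (simp add: barrier_def)

text \<open>By \<open>draw_mean_outward\<close> the first order term cannot increase the truncated
  square beyond an error of order \<open>1 / clock^2\<close>, and the decrease of
  \<open>barrier_const / clock\<close> pays for that error and for the squared increment.\<close>

lemma barrier_step:
  assumes Kc: "(cosh (al * a1))\<^sup>2 < al * (cosh a1)\<^sup>2" and c: "c \<in> core a1 n"
    and \<sigma>: "\<sigma> = 1 \<or> \<sigma> = - 1" and pos: "0 < \<sigma> * tprop c" and a: "0 < a" "a \<le> 1"
  shows "(\<integral>\<^sup>+c'. ennreal (barrier \<sigma> a (Suc n) c') \<partial>measure_pmf (urn_step al p c)) \<le> ennreal (barrier \<sigma> a n c)"
proof -
  define t u r where "t = clock n" and "u = \<sigma> * tprop c" and "r = max 0 (a - u)"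
  let ?m1 = "draw_mean al p c (fst c)" and ?m2 = "draw_mean al p c (snd c)"
  have c': "at_time n c" using c by (simp add: core_def)
  have t: "2 \<le> t" by (simp add: t_def clock_ge_2)
  have r: "0 \<le> r" "r \<le> 1" using a pos by (auto simp: r_def u_def)
  have u1: "\<bar>u\<bar> \<le> 1" using \<sigma> abs_tprop_le_1[of c] by (auto simp: u_def)
  have le: "barrier \<sigma> a (Suc n) (bump c i j) \<le> (r\<^sup>2 + 4 * r * u / (t + 2) + 16 / t\<^sup>2 + barrier_const / (t + 2))
      + (- (2 * r * \<sigma> / (t + 2))) * sg i + (- (2 * r * \<sigma> / (t + 2))) * sg j + 0 * (sg i * sg j)" for i j
  proof -
    define d where "d = (\<sigma> * (sg i + sg j) - 2 * u) / (t + 2)"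
    have "tprop (bump c i j) = (excess c + sg i + sg j) / (t + 2)"
      using tprop_eq[OF at_time_bump[OF c']] by (simp add: excess_bump clock_Suc t_def)
    moreover have "excess c = tprop c * t" using tprop_eq[OF c'] t by (simp add: t_def)
    ultimately have "\<sigma> * tprop (bump c i j) = (u * t + \<sigma> * (sg i + sg j)) / (t + 2)"
      by (simp add: u_def distrib_left mult.assoc)
    also have "\<dots> = u + d" using t by (simp add: d_def field_simps)
    finally have eq: "\<sigma> * tprop (bump c i j) = u + d" .
    have "\<bar>\<sigma> * (sg i + sg j) - 2 * u\<bar> \<le> 4"
      using \<sigma> u1 by (auto simp: sg_def abs_le_iff)
    then have "\<bar>d\<bar> \<le> 4 / t" unfolding d_def abs_divide using t by (intro frac_le) auto
    then have "d\<^sup>2 \<le> (4 / t)\<^sup>2" using t by (metis abs_le_square_iff abs_of_nonneg abs_ge_zero order_trans)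
    then have d2: "d\<^sup>2 \<le> 16 / t\<^sup>2" by (simp add: power_divide)
    have "barrier \<sigma> a (Suc n) (bump c i j) = (max 0 (a - (u + d)))\<^sup>2 + barrier_const / (t + 2)"
      by (simp add: barrier_def eq clock_Suc t_def)
    also have "\<dots> \<le> (r - d)\<^sup>2 + barrier_const / (t + 2)"
      unfolding r_def by (intro add_right_mono truncated_square_step)
    also have "(r - d)\<^sup>2 = r\<^sup>2 - 2 * r * d + d\<^sup>2" by (simp add: power2_diff)
    also have "r\<^sup>2 - 2 * r * d + d\<^sup>2 + barrier_const / (t + 2) \<le> r\<^sup>2 - 2 * r * d + 16 / t\<^sup>2 + barrier_const / (t + 2)"
      using d2 by simp
    also have "2 * r * d = 2 * r * \<sigma> / (t + 2) * sg i + 2 * r * \<sigma> / (t + 2) * sg j - 4 * r * u / (t + 2)"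
      unfolding d_def by (simp add: right_diff_distrib distrib_left diff_divide_distrib add_divide_distrib)
    finally show ?thesis by (simp add: algebra_simps)
  qed
  have p0: "0 \<le> p" "p \<le> 1" using p by simp_all
  have "(\<integral>\<^sup>+c'. ennreal (barrier \<sigma> a (Suc n) c') \<partial>measure_pmf (urn_step al p c)) \<le>
     ennreal ((r\<^sup>2 + 4 * r * u / (t + 2) + 16 / t\<^sup>2 + barrier_const / (t + 2))
      + (- (2 * r * \<sigma> / (t + 2))) * ?m1 + (- (2 * r * \<sigma> / (t + 2))) * ?m2 + 0 * (?m1 * ?m2))"
    by (rule nn_integral_urn_step_le(1)[OF p0 barrier_nonneg le at_timeD(1,2)[OF c']])
  also have "\<dots> \<le> ennreal (r\<^sup>2 + barrier_const / t)"
  proof (rule ennreal_leI)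
    define m where "m = \<sigma> * (?m1 + ?m2)"
    have "2 * al * K * (1 / real (Suc n)) \<le> 2 * al * K * (2 * K / t)"
      unfolding t_def using al K_pos inverse_Suc_le by (intro mult_left_mono) auto
    moreover have "2 * u - 2 * al * K / real (Suc n) \<le> m"
      using draw_mean_outward[OF Kc c \<sigma> pos] by (simp add: u_def m_def)
    ultimately have "2 * u - m \<le> 4 * al * K\<^sup>2 / t" by (simp add: power2_eq_square)
    then have "2 * r / (t + 2) * (2 * u - m) \<le> 2 * r / (t + 2) * (4 * al * K\<^sup>2 / t)"
      using r t by (intro mult_left_mono) auto
    also have "\<dots> \<le> 2 / t * (4 * al * K\<^sup>2 / t)"
      using r t al by (intro mult_right_mono frac_le) auto
    also have "\<dots> = 8 * al * K\<^sup>2 / t\<^sup>2" by (simp add: power2_eq_square)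
    finally have 1: "2 * r / (t + 2) * (2 * u - m) + 16 / t\<^sup>2 \<le> barrier_const / t\<^sup>2"
      by (simp add: barrier_const_def add_divide_distrib)
    \<comment> \<open>The correction drops by \<open>2 * barrier_const / (t * (t + 2))\<close>,
      which suffices because \<open>t >= 2\<close> gives \<open>t + 2 <= 2 * t\<close>.\<close>
    have 2: "barrier_const / t\<^sup>2 \<le> barrier_const / t - barrier_const / (t + 2)"
    proof -
      have "1 / t\<^sup>2 = 2 / (t * (2 * t))" by (simp add: power2_eq_square)
      also have "\<dots> \<le> 2 / (t * (t + 2))" using t by (intro divide_left_mono mult_left_mono) auto
      also have "\<dots> = 1 / t - 1 / (t + 2)" using t by (simp add: divide_simps)
      finally have "1 / t\<^sup>2 \<le> 1 / t - 1 / (t + 2)" .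
      from mult_left_mono[OF this, of barrier_const] show ?thesis
        using barrier_const_pos by (simp add: right_diff_distrib)
    qed
    have "(r\<^sup>2 + 4 * r * u / (t + 2) + 16 / t\<^sup>2 + barrier_const / (t + 2))
      + (- (2 * r * \<sigma> / (t + 2))) * ?m1 + (- (2 * r * \<sigma> / (t + 2))) * ?m2 + 0 * (?m1 * ?m2) =
      r\<^sup>2 + (2 * r / (t + 2) * (2 * u - m) + 16 / t\<^sup>2) + barrier_const / (t + 2)"
      unfolding m_def by (simp add: right_diff_distrib distrib_left diff_divide_distrib add_divide_distrib)
    with 1 2 show "(r\<^sup>2 + 4 * r * u / (t + 2) + 16 / t\<^sup>2 + barrier_const / (t + 2))
      + (- (2 * r * \<sigma> / (t + 2))) * ?m1 + (- (2 * r * \<sigma> / (t + 2))) * ?m2 + 0 * (?m1 * ?m2) \<le> r\<^sup>2 + barrier_const / t"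
      by linarith
  qed
  finally show ?thesis by (simp add: barrier_def r_def u_def t_def)
qed

text \<open>The level \<open>a^2 / 4\<close> is chosen so that below it
  \<open>\<sigma> * tprop\<close> exceeds \<open>a / 2\<close>, which keeps the sign condition of
  \<open>barrier_step\<close> in force. At the start the truncated square vanishes, so only the
  correction enters the bound.\<close>

lemma collapse_bound:
  assumes Kc: "(cosh (al * a1))\<^sup>2 < al * (cosh a1)\<^sup>2"
    and \<sigma>: "\<sigma> = 1 \<or> \<sigma> = - 1" and a: "0 < a" "a \<le> 1"
    and A: "past_dep k (\<lambda>\<omega>. \<omega> \<in> A)" "\<And>\<omega>. \<omega> \<in> A \<Longrightarrow> a \<le> \<sigma> * tprop (\<omega> k)"
  shows "ennreal (a\<^sup>2 / 4) * emeasure law {\<omega> \<in> A. \<exists>j\<ge>k. ennreal (a\<^sup>2 / 4) \<le> ennreal (barrier \<sigma> a j (\<omega> j)) \<and>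
      (\<forall>i\<in>{k..<j}. \<omega> i \<in> core a1 i)} \<le> ennreal (barrier_const / clock k)"
proof -
  interpret prob_space law by (rule prob_space_urn_law)
  have "ennreal (a\<^sup>2 / 4) * emeasure law {\<omega> \<in> A. \<exists>j\<ge>k. ennreal (a\<^sup>2 / 4) \<le> ennreal (barrier \<sigma> a j (\<omega> j)) \<and>
      (\<forall>i\<in>{k..<j}. \<omega> i \<in> core a1 i)} \<le> (\<integral>\<^sup>+\<omega>. indicator A \<omega> * ennreal (barrier \<sigma> a k (\<omega> k)) \<partial>law)"
  proof (rule maximal_inequality[OF A(1)])
    fix n c assume c: "c \<in> core a1 n" and lt: "ennreal (barrier \<sigma> a n c) < ennreal (a\<^sup>2 / 4)"
    from lt have "barrier \<sigma> a n c < a\<^sup>2 / 4" by (simp add: ennreal_less_iff barrier_nonneg)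
    moreover have "0 < barrier_const / clock n" using barrier_const_pos clock_ge_2[of n] by simp
    ultimately have "(max 0 (a - \<sigma> * tprop c))\<^sup>2 < a\<^sup>2 / 4"
      unfolding barrier_def by linarith
    also have "a\<^sup>2 / 4 = (a / 2)\<^sup>2" by (simp add: power_divide)
    finally have "(max 0 (a - \<sigma> * tprop c))\<^sup>2 < (a / 2)\<^sup>2" .
    then have "max 0 (a - \<sigma> * tprop c) < a / 2"
      by (rule power_less_imp_less_base) (use a in simp)
    then have "0 < \<sigma> * tprop c" using a by (simp add: max_def split: if_splits)
    from barrier_step[OF Kc c \<sigma> this a]
    show "(\<integral>\<^sup>+c'. ennreal (barrier \<sigma> a (Suc n) c') \<partial>measure_pmf (urn_step al p c)) \<le> ennreal (barrier \<sigma> a n c)" .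
  qed
  also have "\<dots> \<le> (\<integral>\<^sup>+\<omega>. ennreal (barrier_const / clock k) \<partial>law)"
  proof (rule nn_integral_mono)
    fix \<omega>
    show "indicator A \<omega> * ennreal (barrier \<sigma> a k (\<omega> k)) \<le> ennreal (barrier_const / clock k)"
    proof (cases "\<omega> \<in> A")
      case True
      then have "max 0 (a - \<sigma> * tprop (\<omega> k)) = 0" using A(2) by simp
      then show ?thesis using True by (simp add: barrier_def)
    qed simp
  qed
  also have "\<dots> = ennreal (barrier_const / clock k)"
    by (simp add: emeasure_space_1 del: urn.PF.space_lim)
  finally show ?thesis .
qed

text \<open>The remaining alternative of \<open>drift_to_zero_cases\<close>, with the entrance time
  into the core fixed so that countably many events cover it.\<close>

definition balanced :: "real \<Rightarrow> nat \<Rightarrow> (nat \<Rightarrow> config) set" where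
  "balanced a1 N = {\<omega>. (\<forall>k\<ge>N. \<omega> k \<in> core a1 k) \<and> (\<lambda>n. tprop (\<omega> n)) \<longlonglongrightarrow> 0}"

lemma sets_balanced: "balanced a1 N \<in> sets law"
proof -
  have "balanced a1 N = (\<Inter>m. stay a1 N (N + m)) \<inter> {\<omega>. (\<lambda>n. tprop (\<omega> n)) \<longlonglongrightarrow> 0}"
  proof -
    have "(\<forall>k\<ge>N. \<omega> k \<in> core a1 k) \<longleftrightarrow> (\<forall>m. \<forall>k\<in>{N..N + m}. \<omega> k \<in> core a1 k)" for \<omega>
      by (metis atLeastAtMost_iff le_add_diff_inverse order_refl)
    then show ?thesis unfolding balanced_def stay_def by auto
  qed
  moreover have "(\<Inter>m. stay a1 N (N + m)) \<in> sets law"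
    by (rule sets.countable_INT') (use sets_past_dep[OF past_dep_stay] in \<open>auto simp del: urn.PF.sets_lim\<close>)
  moreover have "{\<omega>. (\<lambda>n. tprop (\<omega> n)) \<longlonglongrightarrow> 0} \<in> sets law"
    by (intro sets_tendsto past_depI) simp
  ultimately show ?thesis by simp
qed

text \<open>Split at time \<open>k\<close> by the window
  \<open>|tprop| < q / sqrt (clock k)\<close>. Inside it \<open>localization\<close> is at least
  \<open>1 / (q^2 + 64)\<close>, so \<open>localization_decay\<close> makes this unlikely. Outside
  it \<open>tprop\<close> must come back to \<open>0\<close>, and \<open>collapse_bound\<close>
  gives at most \<open>4 * barrier_const / q^2\<close> for each sign.\<close>

lemma balanced_bound:
  assumes Kc: "(cosh (al * a1))\<^sup>2 < al * (cosh a1)\<^sup>2"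
    and N: "\<And>n. N \<le> n \<Longrightarrow> 2 * (1089 + 2 * (4 * al * K\<^sup>2)\<^sup>2) \<le> noise a1 * clock n"
    and k: "k = N + m" and q: "0 < q" "q\<^sup>2 \<le> clock k"
  shows "measure law (balanced a1 N) \<le> (q\<^sup>2 + 64) / (64 * (1 + time_sum a1 N m)) + 8 * barrier_const / q\<^sup>2"
proof -
  interpret prob_space law by (rule prob_space_urn_law)
  have ck: "2 \<le> clock k" by (rule clock_ge_2)
  define a where "a = q / sqrt (clock k)"
  have a2: "a\<^sup>2 = q\<^sup>2 / clock k" using ck by (simp add: a_def power_divide)
  have a0: "0 < a" using q ck by (simp add: a_def)
  have "a\<^sup>2 \<le> 1\<^sup>2" unfolding a2 using q ck by simp
  then have a1': "a \<le> 1" by (rule power2_le_imp_le) simp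
  define A where "A \<sigma> = {\<omega> \<in> stay a1 N k. a \<le> \<sigma> * tprop (\<omega> k)}" for \<sigma>
  define B where "B = {\<omega> \<in> stay a1 N k. \<bar>tprop (\<omega> k)\<bar> < a}"
  define R where "R \<sigma> = {\<omega> \<in> A \<sigma>. \<exists>j\<ge>k. ennreal (a\<^sup>2 / 4) \<le> ennreal (barrier \<sigma> a j (\<omega> j)) \<and>
      (\<forall>i\<in>{k..<j}. \<omega> i \<in> core a1 i)}" for \<sigma>
  have depA: "past_dep k (\<lambda>\<omega>. \<omega> \<in> A \<sigma>)" for \<sigma>
    unfolding A_def by (rule past_dep_Collect[OF past_dep_stay])
  have depB: "past_dep k (\<lambda>\<omega>. \<omega> \<in> B)"
    unfolding B_def by (rule past_dep_Collect[OF past_dep_stay])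
  have Bs: "B \<in> sets law" by (rule sets_past_dep[OF depB])
  have Rs: "R \<sigma> \<in> sets law" for \<sigma>
  proof -
    have "R \<sigma> = (\<Union>j\<in>{k..}. {\<omega> \<in> A \<sigma>. ennreal (a\<^sup>2 / 4) \<le> ennreal (barrier \<sigma> a j (\<omega> j)) \<and>
      (\<forall>i\<in>{k..<j}. \<omega> i \<in> core a1 i)})" by (auto simp: R_def)
    also have "\<dots> \<in> sets law"
    proof (rule sets.countable_UN'')
      fix j assume "j \<in> {k..}"
      then have kj: "k \<le> j" by simp
      show "{\<omega> \<in> A \<sigma>. ennreal (a\<^sup>2 / 4) \<le> ennreal (barrier \<sigma> a j (\<omega> j)) \<and> (\<forall>i\<in>{k..<j}. \<omega> i \<in> core a1 i)} \<in> sets law"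
      proof (rule sets_past_dep[of j], rule past_depI)
        fix \<omega> \<omega>' :: "nat \<Rightarrow> config" assume w: "\<And>i. i \<le> j \<Longrightarrow> \<omega> i = \<omega>' i"
        then have "\<omega> \<in> A \<sigma> \<longleftrightarrow> \<omega>' \<in> A \<sigma>" using depA[of \<sigma>] kj by (simp add: past_dep_def)
        moreover have "(\<forall>i\<in>{k..<j}. \<omega> i \<in> core a1 i) \<longleftrightarrow> (\<forall>i\<in>{k..<j}. \<omega>' i \<in> core a1 i)" using w by auto
        ultimately show "(\<omega> \<in> {\<omega> \<in> A \<sigma>. ennreal (a\<^sup>2 / 4) \<le> ennreal (barrier \<sigma> a j (\<omega> j)) \<and> (\<forall>i\<in>{k..<j}. \<omega> i \<in> core a1 i)}) =
          (\<omega>' \<in> {\<omega> \<in> A \<sigma>. ennreal (a\<^sup>2 / 4) \<le> ennreal (barrier \<sigma> a j (\<omega> j)) \<and> (\<forall>i\<in>{k..<j}. \<omega> i \<in> core a1 i)})"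
          using w[of j] by simp
      qed
    qed simp
    finally show ?thesis .
  qed
  have cover: "balanced a1 N \<subseteq> B \<union> (R 1 \<union> R (- 1))"
  proof
    fix \<omega> assume w: "\<omega> \<in> balanced a1 N"
    then have st: "\<omega> \<in> stay a1 N k" and co: "\<And>i. N \<le> i \<Longrightarrow> \<omega> i \<in> core a1 i" and lim: "(\<lambda>n. tprop (\<omega> n)) \<longlonglongrightarrow> 0"
      by (auto simp: balanced_def stay_def)
    have "eventually (\<lambda>n. \<bar>tprop (\<omega> n)\<bar> < a / 2) sequentially"
      using tendstoD[OF lim, of "a / 2"] a0 by simp
    then obtain j where j: "k \<le> j" "\<bar>tprop (\<omega> j)\<bar> < a / 2"
      unfolding eventually_sequentially by (metis nle_le)
    have RR: "\<omega> \<in> R \<sigma>" if "\<sigma> = 1 \<or> \<sigma> = -1" "a \<le> \<sigma> * tprop (\<omega> k)" for \<sigma>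
    proof -
      have "\<sigma> * tprop (\<omega> j) \<le> a / 2" using that(1) j(2) by auto
      then have "(a / 2)\<^sup>2 \<le> (max 0 (a - \<sigma> * tprop (\<omega> j)))\<^sup>2" using a0 by (intro power_mono) auto
      moreover have "0 \<le> barrier_const / clock j" using barrier_const_pos clock_ge_2[of j] by simp
      moreover have "(a / 2)\<^sup>2 = a\<^sup>2 / 4" by (simp add: power_divide)
      ultimately have "a\<^sup>2 / 4 \<le> barrier \<sigma> a j (\<omega> j)" unfolding barrier_def by linarith
      then show ?thesis using that st j(1) co k by (auto simp: R_def A_def intro!: exI[of _ j] ennreal_leI)
    qed
    show "\<omega> \<in> B \<union> (R 1 \<union> R (- 1))"
      using RR[of 1] RR[of "- 1"] st by (force simp: B_def abs_less_iff)
  qed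
  have mR: "measure law (R \<sigma>) \<le> 4 * barrier_const / q\<^sup>2" if "\<sigma> = 1 \<or> \<sigma> = -1" for \<sigma>
  proof -
    have "ennreal (a\<^sup>2 / 4) * emeasure law (R \<sigma>) \<le> ennreal (barrier_const / clock k)"
      unfolding R_def by (rule collapse_bound[OF Kc that a0 a1' depA]) (simp add: A_def)
    then have "ennreal (a\<^sup>2 / 4 * measure law (R \<sigma>)) \<le> ennreal (barrier_const / clock k)"
      by (simp add: emeasure_eq_measure ennreal_mult'[symmetric])
    then have "a\<^sup>2 / 4 * measure law (R \<sigma>) \<le> barrier_const / clock k"
      using barrier_const_pos ck by (subst (asm) ennreal_le_iff) auto
    then show ?thesis unfolding a2 using q ck by (simp add: field_simps)
  qed
  have mB: "measure law B \<le> (q\<^sup>2 + 64) / (64 * (1 + time_sum a1 N m))"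
  proof -
    have loc: "1 / (q\<^sup>2 + 64) \<le> localization k (\<omega> k)" if "\<omega> \<in> B" for \<omega>
    proof -
      have "at_time k (\<omega> k)" using that k by (auto simp: B_def stay_def core_def)
      then have "excess (\<omega> k) = tprop (\<omega> k) * clock k" using tprop_eq ck by simp
      then have e: "(excess (\<omega> k))\<^sup>2 = (tprop (\<omega> k))\<^sup>2 * (clock k * clock k)"
        by (simp add: power_mult_distrib power2_eq_square)
      have "\<bar>tprop (\<omega> k)\<bar> \<le> \<bar>a\<bar>" using that a0 by (auto simp: B_def)
      then have "(tprop (\<omega> k))\<^sup>2 \<le> q\<^sup>2 / clock k" unfolding a2[symmetric] by (simp add: abs_le_square_iff)
      then have "(excess (\<omega> k))\<^sup>2 \<le> q\<^sup>2 / clock k * (clock k * clock k)"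
        unfolding e by (rule mult_right_mono) simp
      also have "\<dots> = q\<^sup>2 * clock k" using ck by simp
      finally have "clock k / (q\<^sup>2 * clock k + 64 * clock k) \<le> localization k (\<omega> k)"
        unfolding localization_def using ck
        by (intro divide_left_mono) (auto intro!: mult_pos_pos add_nonneg_pos)
      also have "clock k / (q\<^sup>2 * clock k + 64 * clock k) = 1 / (q\<^sup>2 + 64)"
        using ck by (simp flip: distrib_right)
      finally show ?thesis .
    qed
    have "ennreal (1 / (q\<^sup>2 + 64)) * emeasure law B = (\<integral>\<^sup>+\<omega>. ennreal (1 / (q\<^sup>2 + 64)) * indicator B \<omega> \<partial>law)"
      using Bs by (simp add: nn_integral_cmult_indicator)
    also have "\<dots> \<le> (\<integral>\<^sup>+\<omega>. indicator (stay a1 N k) \<omega> * ennreal (localization k (\<omega> k)) \<partial>law)"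
    proof (rule nn_integral_mono)
      fix \<omega>
      show "ennreal (1 / (q\<^sup>2 + 64)) * indicator B \<omega> \<le> indicator (stay a1 N k) \<omega> * ennreal (localization k (\<omega> k))"
      proof (cases "\<omega> \<in> B")
        case True
        then have "\<omega> \<in> stay a1 N k" by (simp add: B_def)
        with True show ?thesis using ennreal_leI[OF loc[OF True]] by simp
      qed simp
    qed
    also have "\<dots> \<le> ennreal (1 / (64 * (1 + time_sum a1 N m)))"
      unfolding k by (rule localization_decay[OF Kc N])
    finally have "ennreal (1 / (q\<^sup>2 + 64) * measure law B) \<le> ennreal (1 / (64 * (1 + time_sum a1 N m)))"
      by (simp add: emeasure_eq_measure ennreal_mult'[symmetric])
    then have "1 / (q\<^sup>2 + 64) * measure law B \<le> 1 / (64 * (1 + time_sum a1 N m))"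
      using time_sum_nonneg[of a1 N m] by (subst (asm) ennreal_le_iff) auto
    moreover have "0 < q\<^sup>2 + 64" by (simp add: add_nonneg_pos)
    ultimately show ?thesis by (simp add: divide_le_eq mult.commute)
  qed
  have "measure law (balanced a1 N) \<le> measure law (B \<union> (R 1 \<union> R (- 1)))"
    using Bs Rs by (intro finite_measure_mono cover) auto
  also have "\<dots> \<le> measure law B + measure law (R 1 \<union> R (- 1))"
    using Bs Rs by (intro measure_Un_le) auto
  also have "measure law (R 1 \<union> R (- 1)) \<le> measure law (R 1) + measure law (R (- 1))"
    using Rs by (intro measure_Un_le) auto
  finally show ?thesis using mB mR[of 1] mR[of "- 1"] by simp
qed

lemma balanced_null:
  assumes Kc: "(cosh (al * a1))\<^sup>2 < al * (cosh a1)\<^sup>2"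
  shows "AE \<omega> in law. \<omega> \<notin> balanced a1 N"
proof -
  interpret prob_space law by (rule prob_space_urn_law)
  have "filterlim (\<lambda>n. noise a1 * clock n) at_top sequentially"
    by (rule filterlim_tendsto_pos_mult_at_top[OF tendsto_const noise_pos filterlim_clock])
  then have "eventually (\<lambda>n. 2 * (1089 + 2 * (4 * al * K\<^sup>2)\<^sup>2) \<le> noise a1 * clock n) sequentially"
    by (simp add: filterlim_at_top)
  then obtain N0 where N0: "\<And>n. N0 \<le> n \<Longrightarrow> 2 * (1089 + 2 * (4 * al * K\<^sup>2)\<^sup>2) \<le> noise a1 * clock n"
    by (auto simp: eventually_sequentially)
  define N' where "N' = max N N0"
  have N': "2 * (1089 + 2 * (4 * al * K\<^sup>2)\<^sup>2) \<le> noise a1 * clock n" if "N' \<le> n" for n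
    using N0 that by (simp add: N'_def)
  have small: "measure law (balanced a1 N') \<le> e" if e: "0 < e" for e :: real
  proof -
    \<comment> \<open>This makes the return probability equal to \<open>e / 2\<close>. Only then is
      \<open>m\<close> taken large, since the other term grows with \<open>q\<close>.\<close>
    define q where "q = sqrt (16 * barrier_const / e)"
    have q2: "q\<^sup>2 = 16 * barrier_const / e" and q0: "0 < q"
      using barrier_const_pos e by (simp_all add: q_def)
    obtain m0 where m0: "\<And>m. m0 \<le> m \<Longrightarrow> 2 * (q\<^sup>2 + 64) / e < time_sum a1 N' m"
      using time_sum_unbounded by blast
    have "eventually (\<lambda>n. q\<^sup>2 \<le> clock n) sequentially" using filterlim_clock by (simp add: filterlim_at_top)
    then obtain n0 where n0: "\<And>n. n0 \<le> n \<Longrightarrow> q\<^sup>2 \<le> clock n" by (auto simp: eventually_sequentially)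
    define m where "m = max m0 n0"
    have "measure law (balanced a1 N') \<le> (q\<^sup>2 + 64) / (64 * (1 + time_sum a1 N' m)) + 8 * barrier_const / q\<^sup>2"
      by (rule balanced_bound[OF Kc N' refl q0]) (auto intro!: n0 simp: m_def)
    moreover have "8 * barrier_const / q\<^sup>2 = e / 2"
      unfolding q2 using barrier_const_pos e by simp
    moreover have "(q\<^sup>2 + 64) / (64 * (1 + time_sum a1 N' m)) \<le> e / 2"
    proof -
      have "2 * (q\<^sup>2 + 64) / e \<le> time_sum a1 N' m" using m0[of m] by (simp add: m_def)
      then have "q\<^sup>2 + 64 \<le> e / 2 * time_sum a1 N' m" using e by (simp add: field_simps)
      also have "\<dots> \<le> e / 2 * (64 * (1 + time_sum a1 N' m))"
        using e time_sum_nonneg[of a1 N' m] by (intro mult_left_mono) auto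
      finally show ?thesis using time_sum_nonneg[of a1 N' m] by (simp add: divide_le_eq)
    qed
    ultimately show ?thesis by linarith
  qed
  have "measure law (balanced a1 N') = 0"
    using small measure_nonneg[of law "balanced a1 N'"] by (meson antisym dense_ge)
  then have "AE \<omega> in law. \<omega> \<notin> balanced a1 N'"
    using sets_balanced by (simp add: prob_eq_0)
  moreover have "balanced a1 N \<subseteq> balanced a1 N'" by (auto simp: balanced_def N'_def)
  ultimately show ?thesis by (auto elim!: eventually_mono)
qed

end

section \<open>Domination\<close>

lemma sets_domination: "domination \<in> sets (urn_law al p c0)"
proof -
  have dep: "past_dep n (\<lambda>\<omega>. black_prop u \<omega> n)" for n u
    by (rule past_depI) (simp add: black_prop_def)
  have "domination = ({\<omega>. (\<lambda>n. black_prop fst \<omega> n) \<longlonglongrightarrow> 0} \<inter> {\<omega>. (\<lambda>n. black_prop snd \<omega> n) \<longlonglongrightarrow> 0}) \<union>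
    ({\<omega>. (\<lambda>n. black_prop fst \<omega> n) \<longlonglongrightarrow> 1} \<inter> {\<omega>. (\<lambda>n. black_prop snd \<omega> n) \<longlonglongrightarrow> 1})"
    unfolding domination_def by (auto intro: tendsto_Pair dest: tendsto_fst tendsto_snd)
  also have "\<dots> \<in> sets (urn_law al p c0)"
    by (intro sets.Un sets.Int sets_tendsto dep)
  finally show ?thesis .
qed

context two_urns
begin

lemma black_prop_eq:
  assumes "\<And>n. at_time n (\<omega> n)"
  shows "black_prop fst \<omega> n = (1 + prop1 (\<omega> n)) / 2" "black_prop snd \<omega> n = (1 + prop2 (\<omega> n)) / 2"
proof -
  have "real (black u) / N = (1 + sprop u) / 2" if "real (black u) + real (red u) = N" "0 < N" for u N
    using that by (simp add: sprop_def field_simps)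
  then have *: "real (black u) / N = (1 + sprop u) / 2" if "real (black u) + real (red u) = M" "N = M" "0 < M" for u N M
    using that by blast
  have "0 < real n + real (b1 + r1)" "0 < real n + real (b2 + r2)" using r1 b2 by simp_all
  then show "black_prop fst \<omega> n = (1 + prop1 (\<omega> n)) / 2" "black_prop snd \<omega> n = (1 + prop2 (\<omega> n)) / 2"
    unfolding black_prop_def
    by (intro *[OF at_timeD(3)[OF assms]] *[OF at_timeD(4)[OF assms]];
        use at_timeD(3,4)[OF assms[of 0]] in simp)+
qed

lemma domination_iff:
  assumes "\<And>n. at_time n (\<omega> n)"
  shows "\<omega> \<in> domination \<longleftrightarrow>
    ((\<lambda>n. prop1 (\<omega> n)) \<longlonglongrightarrow> -1 \<and> (\<lambda>n. prop2 (\<omega> n)) \<longlonglongrightarrow> -1) \<or>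
    ((\<lambda>n. prop1 (\<omega> n)) \<longlonglongrightarrow> 1 \<and> (\<lambda>n. prop2 (\<omega> n)) \<longlonglongrightarrow> 1)"
proof -
  have pair: "(\<lambda>n. (f n, g n)) \<longlonglongrightarrow> (x, y) \<longleftrightarrow> f \<longlonglongrightarrow> x \<and> g \<longlonglongrightarrow> y" for f g :: "nat \<Rightarrow> real" and x y
    using tendsto_fst[of "\<lambda>n. (f n, g n)"] tendsto_snd[of "\<lambda>n. (f n, g n)"] by (auto intro: tendsto_Pair)
  have half: "(\<lambda>n. (1 + f n) / 2) \<longlonglongrightarrow> x \<longleftrightarrow> f \<longlonglongrightarrow> 2 * x - 1" for f :: "nat \<Rightarrow> real" and x
  proof
    assume "(\<lambda>n. (1 + f n) / 2) \<longlonglongrightarrow> x"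
    then have "(\<lambda>n. 2 * ((1 + f n) / 2) - 1) \<longlonglongrightarrow> 2 * x - 1" by (intro tendsto_intros)
    then show "f \<longlonglongrightarrow> 2 * x - 1" by (simp add: add_divide_distrib)
  next
    assume "f \<longlonglongrightarrow> 2 * x - 1"
    then have "(\<lambda>n. (1 + f n) / 2) \<longlonglongrightarrow> (1 + (2 * x - 1)) / 2" by (intro tendsto_intros) auto
    then show "(\<lambda>n. (1 + f n) / 2) \<longlonglongrightarrow> x" by simp
  qed
  show ?thesis
    unfolding domination_def black_prop_eq[OF assms] mem_Collect_eq Un_iff pair half by simp
qed

lemma prob_domination_eq_1:
  assumes al3: "al < 3" and a1: "0 < a1" and Kc: "(cosh (al * a1))\<^sup>2 < al * (cosh a1)\<^sup>2"
    and pl: "(1 - p) * (2 * sinh ((al - 1) * a1)) < p * sinh (2 * a1)"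
  shows "measure law domination = 1"
proof -
  interpret prob_space law by (rule prob_space_urn_law)
  have "AE \<omega> in law. \<forall>N. \<omega> \<notin> balanced a1 N"
    using balanced_null[OF Kc] by (simp add: AE_all_countable)
  with AE_path AE_drift_tendsto_0 have "AE \<omega> in law. \<omega> \<in> domination"
  proof eventually_elim
    case (elim \<omega>)
    then have at: "\<And>n. at_time n (\<omega> n)" and bump: "\<And>n. \<exists>i j. \<omega> (Suc n) = bump (\<omega> n) i j" by blast+
    have step: "\<bar>(prop1 (\<omega> (Suc n)) + prop2 (\<omega> (Suc n))) - (prop1 (\<omega> n) + prop2 (\<omega> n))\<bar> \<le> 4 / real (Suc n)" for n
    proof -
      obtain i j where "\<omega> (Suc n) = bump (\<omega> n) i j" using bump by blast
      then have "\<bar>prop1 (\<omega> (Suc n)) - prop1 (\<omega> n)\<bar> \<le> 2 / real (Suc n)" "\<bar>prop2 (\<omega> (Suc n)) - prop2 (\<omega> n)\<bar> \<le> 2 / real (Suc n)"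
        using prop_bump_diff[OF at[of n]] by metis+
      moreover have "4 / real (Suc n) = 2 / real (Suc n) + 2 / real (Suc n)" by simp
      ultimately show ?thesis by linarith
    qed
    from drift_to_zero_cases[OF al al3 a1 Kc p pl abs_sprop_le_1 abs_sprop_le_1 step] elim
    consider "(\<lambda>n. prop1 (\<omega> n)) \<longlonglongrightarrow> 1 \<and> (\<lambda>n. prop2 (\<omega> n)) \<longlonglongrightarrow> 1"
      | "(\<lambda>n. prop1 (\<omega> n)) \<longlonglongrightarrow> -1 \<and> (\<lambda>n. prop2 (\<omega> n)) \<longlonglongrightarrow> -1"
      | "(\<lambda>n. prop1 (\<omega> n) + prop2 (\<omega> n)) \<longlonglongrightarrow> 0"
        "eventually (\<lambda>n. \<bar>prop1 (\<omega> n)\<bar> < tanh a1 \<and> \<bar>prop2 (\<omega> n)\<bar> < tanh a1) sequentially"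
      by blast
    then show ?case
    proof cases
      case 3
      have K0: "(\<lambda>n. K / real (Suc n)) \<longlonglongrightarrow> 0"
        using tendsto_mult_right_zero[OF LIMSEQ_inverse_real_of_nat, of K] by (simp add: divide_inverse)
      have "(\<lambda>n. tprop (\<omega> n) - (prop1 (\<omega> n) + prop2 (\<omega> n)) / 2) \<longlonglongrightarrow> 0"
        by (rule Lim_null_comparison[OF _ K0]) (use tprop_near[OF at] in simp)
      moreover have "(\<lambda>n. (prop1 (\<omega> n) + prop2 (\<omega> n)) / 2) \<longlonglongrightarrow> 0"
        using tendsto_divide[OF 3(1) tendsto_const, of 2] by simp
      ultimately have "(\<lambda>n. tprop (\<omega> n) - (prop1 (\<omega> n) + prop2 (\<omega> n)) / 2 + (prop1 (\<omega> n) + prop2 (\<omega> n)) / 2) \<longlonglongrightarrow> 0 + 0"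
        by (rule tendsto_add)
      then have "(\<lambda>n. tprop (\<omega> n)) \<longlonglongrightarrow> 0" by simp
      moreover obtain N where "\<And>n. N \<le> n \<Longrightarrow> \<bar>prop1 (\<omega> n)\<bar> < tanh a1 \<and> \<bar>prop2 (\<omega> n)\<bar> < tanh a1"
        using 3(2) by (auto simp: eventually_sequentially)
      ultimately have "\<omega> \<in> balanced a1 N" using at by (simp add: balanced_def core_def)
      with elim show ?thesis by blast
    qed (auto simp: domination_iff[OF at])
  qed
  then show ?thesis by (simp add: prob_eq_1[OF sets_domination])
qed

text \<open>An urn may hold one colour only, but the red ball of urn 1 and the black ball of urn 2
  keep the total proportion strictly inside, and the interaction enters every draw with weight
  \<open>p > 0\<close>.\<close>

lemma draw_prob_interior:
  assumes "1 \<le> red (fst c)" "1 \<le> black (snd c)" "at_time n c"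
  shows "0 < draw_prob al p c (fst c)" "draw_prob al p c (fst c) < 1"
    "0 < draw_prob al p c (snd c)" "draw_prob al p c (snd c) < 1"
proof -
  have bt: "1 \<le> black_total c" "1 \<le> red_total c" using assms by (simp_all add: black_total_def red_total_def)
  then have "\<bar>tprop c\<bar> < 1" by (simp add: tprop_def abs_less_iff divide_less_eq)
  then have F: "\<bar>reinf al (tprop c)\<bar> < 1" by (rule abs_reinf_less)
  have "\<bar>draw_mean al p c u\<bar> < 1" for u
  proof -
    have "\<bar>reinf al (sprop u)\<bar> \<le> 1" using al abs_sprop_le_1 by (intro abs_reinf_le) auto
    then have "\<bar>(1 - p) * reinf al (sprop u)\<bar> \<le> 1 - p" unfolding abs_mult using p by (simp add: mult_left_le)
    moreover have "\<bar>p * reinf al (tprop c)\<bar> < p" unfolding abs_mult using p F by simp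
    ultimately show ?thesis
      unfolding draw_mean_def using abs_triangle_ineq[of "p * reinf al (tprop c)" "(1 - p) * reinf al (sprop u)"] by linarith
  qed
  note m = this[THEN abs_less_iff[THEN iffD1]]
  have "0 < black_total c + red_total c" using bt by simp
  note q = draw_prob_eq[OF at_timeD(1)[OF assms(3)] this] draw_prob_eq[OF at_timeD(2)[OF assms(3)] this]
  show "0 < draw_prob al p c (fst c)" "draw_prob al p c (fst c) < 1"
    "0 < draw_prob al p c (snd c)" "draw_prob al p c (snd c) < 1"
    unfolding q using m[of "fst c"] m[of "snd c"] by auto
qed

lemma reach_step:
  assumes c: "1 \<le> red (fst c)" "1 \<le> black (snd c)" "at_time n c"
    and pos: "0 < measure law {\<omega>. \<omega> n = c}"
  shows "0 < measure law {\<omega>. \<omega> (Suc n) = bump c i j}"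
proof -
  interpret prob_space law by (rule prob_space_urn_law)
  have S: "{\<omega>. \<omega> m = d} \<in> sets law" for m d
    by (rule sets_past_dep[of m]) (auto simp: past_dep_def)
  let ?h = "\<lambda>\<omega> c'. indicator {c} (\<omega> n) * indicator {bump c i j} c' :: ennreal"
  have "bump c i j \<in> set_pmf (urn_step al p c)"
    using draw_prob_interior[OF c] by (auto simp: urn_step_def bump_def)
  then have w: "0 < pmf (urn_step al p c) (bump c i j)" by (simp add: pmf_positive_iff)
  have "0 < ennreal (pmf (urn_step al p c) (bump c i j)) * emeasure law {\<omega>. \<omega> n = c}"
    using w pos by (simp add: emeasure_eq_measure ennreal_zero_less_mult_iff)
  also have "\<dots> = (\<integral>\<^sup>+\<omega>. ennreal (pmf (urn_step al p c) (bump c i j)) * indicator {\<omega>. \<omega> n = c} \<omega> \<partial>law)"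
    using S by (simp add: nn_integral_cmult_indicator)
  also have "\<dots> = (\<integral>\<^sup>+\<omega>. (\<integral>\<^sup>+c'. ?h \<omega> c' \<partial>measure_pmf (urn_step al p (\<omega> n))) \<partial>law)"
    by (rule nn_integral_cong) (auto simp: emeasure_pmf_single split: split_indicator)
  also have "\<dots> = (\<integral>\<^sup>+\<omega>. ?h \<omega> (\<omega> (Suc n)) \<partial>law)"
    by (rule nn_integral_markov[symmetric]) (auto simp: past_dep_def fun_eq_iff)
  also have "\<dots> \<le> (\<integral>\<^sup>+\<omega>. indicator {\<omega>. \<omega> (Suc n) = bump c i j} \<omega> \<partial>law)"
    by (rule nn_integral_mono) (auto split: split_indicator)
  also have "\<dots> = ennreal (measure law {\<omega>. \<omega> (Suc n) = bump c i j})"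
    using S[of "Suc n" "bump c i j"] by (simp add: emeasure_eq_measure)
  finally show ?thesis by simp
qed

text \<open>No draw has a forced outcome, so each urn can be given any number of black balls among
  its \<open>n\<close> draws, independently of the other urn.\<close>

lemma reach:
  assumes "i \<le> n" "j \<le> n"
  shows "0 < measure law {\<omega>. \<omega> n = ((b1 + i, r1 + (n - i)), (b2 + j, r2 + (n - j)))}"
  using assms
proof (induction n arbitrary: i j)
  case 0
  then show ?case
    using emeasure_urn_law_path[where \<alpha>=al and p=p and ?c0.0="((b1, r1), (b2, r2))" and n=0 and a="\<lambda>_. ((b1, r1), (b2, r2))"]
    by (simp add: measure_def)
next
  case (Suc n)
  \<comment> \<open>The path draws all black balls first: the last draw is black only if all
    \<open>Suc n\<close> draws are.\<close>
  define i' where "i' = min i n"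
  define j' where "j' = min j n"
  have ij: "i' \<le> n" "j' \<le> n" by (simp_all add: i'_def j'_def)
  let ?c = "((b1 + i', r1 + (n - i')), (b2 + j', r2 + (n - j')))"
  have "0 < measure law {\<omega>. \<omega> (Suc n) = bump ?c (i = Suc n) (j = Suc n)}"
    by (rule reach_step[OF _ _ _ Suc.IH[OF ij]]) (use r1 b2 ij in \<open>auto simp: at_time_def\<close>)
  also have "bump ?c (i = Suc n) (j = Suc n) = ((b1 + i, r1 + (Suc n - i)), (b2 + j, r2 + (Suc n - j)))"
    using Suc.prems by (auto simp: bump_def add_ball_def i'_def j'_def min_def)
  finally show ?case .
qed

end

section \<open>Stable antisymmetric equilibria\<close>

text \<open>Together with \<open>reach\<close> this brings the process as close as desired to any
  prescribed point at late times: the rounding and the initial balls change the proportion by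
  \<open>O(1 / n)\<close>.\<close>

lemma sprop_floor_tendsto:
  fixes y :: real and b r :: nat
  assumes y: "0 \<le> y" "y \<le> 1"
  shows "(\<lambda>n. sprop (b + nat \<lfloor>y * real n\<rfloor>, r + (n - nat \<lfloor>y * real n\<rfloor>))) \<longlonglongrightarrow> 2 * y - 1"
proof -
  let ?f = "\<lambda>n. sprop (b + nat \<lfloor>y * real n\<rfloor>, r + (n - nat \<lfloor>y * real n\<rfloor>))"
  define C where "C = 2 * real b + 2 * real r + 2"
  have bnd: "norm (?f n - (2 * y - 1)) \<le> C / real n" if n: "1 \<le> n" for n
  proof -
    define i where "i = nat \<lfloor>y * real n\<rfloor>"
    have i: "real i \<le> y * real n" "y * real n < real i + 1"
      unfolding i_def using y by (simp_all add: of_nat_nat)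
    have "y * real n \<le> real n" using y by (simp add: mult_left_le_one_le)
    with i have "i \<le> n" by simp
    define N where "N = real b + real r + real n"
    have N: "real n \<le> N" "0 < N" using n by (simp_all add: N_def)
    have "sprop (b + i, r + (n - i)) = (real b - real r + 2 * real i - real n) / N"
      using \<open>i \<le> n\<close> by (simp add: sprop_def N_def of_nat_diff algebra_simps)
    then have "sprop (b + i, r + (n - i)) - (2 * y - 1) =
        ((real b - real r) - (2 * y - 1) * (real b + real r) + 2 * (real i - y * real n)) / N"
      using N(2) by (simp add: divide_simps) (simp add: N_def algebra_simps)
    also have "\<bar>\<dots>\<bar> \<le> C / real n"
      unfolding abs_divide
    proof (rule frac_le)
      define P Q where "P = (2 * y - 1) * (real b + real r)" and "Q = real i - y * real n"
      have "\<bar>P\<bar> \<le> 1 * (real b + real r)"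
        unfolding P_def abs_mult using y by (intro mult_mono) auto
      moreover have "\<bar>Q\<bar> \<le> 1" unfolding Q_def using i by linarith
      moreover have "\<bar>real b - real r\<bar> \<le> real b + real r" by linarith
      ultimately have "P \<le> real b + real r" "- P \<le> real b + real r" "Q \<le> 1" "- Q \<le> 1"
        by (simp_all only: abs_le_iff mult_1)
      then have "\<bar>(real b - real r) - P + 2 * Q\<bar> \<le> C"
        unfolding C_def by (intro abs_leI) linarith+
      then show "\<bar>(real b - real r) - (2 * y - 1) * (real b + real r) + 2 * (real i - y * real n)\<bar> \<le> C"
        unfolding P_def Q_def .
    qed (use N n in \<open>auto simp: C_def\<close>)
    finally show ?thesis by (simp add: i_def)
  qed
  have "(\<lambda>n. ?f n - (2 * y - 1)) \<longlonglongrightarrow> 0"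
    by (rule Lim_null_comparison[OF _ lim_const_over_n[of C]])
      (use bnd in \<open>auto simp: eventually_sequentially intro!: exI[of _ 1]\<close>)
  then show ?thesis by (simp add: LIM_zero_iff)
qed

lemma reinf_first_order:
  assumes "0 < e"
  obtains d where "0 < d"
    "\<And>h. \<bar>h\<bar> < d \<Longrightarrow> \<bar>reinf al (tanh x + h) - reinf al (tanh x) - al * (cosh x)\<^sup>2 / (cosh (al * x))\<^sup>2 * h\<bar> \<le> e * \<bar>h\<bar>"
proof -
  have "(reinf al has_derivative (*) (al * (cosh x)\<^sup>2 / (cosh (al * x))\<^sup>2)) (at (tanh x))"
    using reinf_has_derivative by (simp add: has_field_derivative_def)
  then obtain d where d: "0 < d" "\<And>y. norm (y - tanh x) < d \<Longrightarrow>
      norm (reinf al y - reinf al (tanh x) - al * (cosh x)\<^sup>2 / (cosh (al * x))\<^sup>2 * (y - tanh x)) \<le> e * norm (y - tanh x)"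
    unfolding has_derivative_at_alt using assms by blast
  show ?thesis
  proof (rule that[OF d(1)])
    fix h assume "\<bar>h\<bar> < d"
    then show "\<bar>reinf al (tanh x + h) - reinf al (tanh x) - al * (cosh x)\<^sup>2 / (cosh (al * x))\<^sup>2 * h\<bar> \<le> e * \<bar>h\<bar>"
      using d(2)[of "tanh x + h"] by simp
  qed
qed

text \<open>Only the sum of the two products \<open>h * H\<close> over the urns has a sign, so both
  urns need the common denominator \<open>N\<close>. Exchanging \<open>T\<close> for
  \<open>N\<close> costs at most \<open>8 * k / N^2\<close>, because sizes differ from
  \<open>N\<close> by a bounded amount.\<close>

lemma trap_gain:
  fixes h H e E T N k :: real
  assumes h: "\<bar>h\<bar> \<le> 2" "\<bar>H\<bar> \<le> 2" "\<bar>e\<bar> \<le> E / N" and N: "0 < N" "N \<le> T" "T - N \<le> k"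
  shows "2 * h * (H + e) / T \<le> 2 * h * H / N + (8 * k + 4 * E) / N\<^sup>2"
proof -
  have T: "0 < T" using N by linarith
  have E0: "0 \<le> E / N" using h(3) by linarith
  have eq: "2 * h * (H + e) / T = 2 * h * H / N - 2 * (h * H) * ((T - N) / (T * N)) + 2 * (h * e) / T"
    using T N by (simp add: field_simps)
  have hH: "\<bar>h * H\<bar> \<le> 4" unfolding abs_mult using h mult_mono[of "\<bar>h\<bar>" 2 "\<bar>H\<bar>" 2] by simp
  have r: "0 \<le> (T - N) / (T * N)" "(T - N) / (T * N) \<le> k / (N * N)"
    using N T by (auto intro!: frac_le mult_right_mono)
  have "\<bar>2 * (h * H) * ((T - N) / (T * N))\<bar> \<le> 8 * (k / (N * N))"
  proof -
    define X where "X = h * H"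
    have "\<bar>2 * X\<bar> \<le> 8" using hH by (simp add: X_def)
    then have "\<bar>2 * X\<bar> * \<bar>(T - N) / (T * N)\<bar> \<le> 8 * (k / (N * N))"
      using r by (intro mult_mono) auto
    then show ?thesis unfolding X_def abs_mult[of "2 * (h * H)"] .
  qed
  moreover have "\<bar>h * e\<bar> \<le> 2 * (E / N)" unfolding abs_mult using h by (intro mult_mono) auto
  then have "2 * (h * e) / T \<le> 4 * (E / N) / T" using T by (intro divide_right_mono) auto
  moreover have "4 * (E / N) / T \<le> 4 * (E / N) / N" using E0 N T by (intro divide_left_mono) auto
  moreover have "(8 * k + 4 * E) / N\<^sup>2 = 8 * (k / (N * N)) + 4 * (E / N) / N"
    by (simp add: power2_eq_square add_divide_distrib)
  ultimately show ?thesis unfolding eq by linarith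
qed

section \<open>Trapping near a stable zero\<close>

context two_urns
begin

text \<open>Squared distance to \<open>(s, -s)\<close> plus a correction that absorbs the noise.
  With \<open>B = 16 * K + 8 * (al * K) + 8\<close> one step costs at most \<open>B / N^2\<close>:
  twice the error of \<open>trap_gain\<close>, and \<open>8\<close> for the two squared increments.
  The correction \<open>2 * B / N\<close> drops by at least this much.\<close>

definition trap :: "real \<Rightarrow> nat \<Rightarrow> config \<Rightarrow> real" where
  "trap s n c = (prop1 c - s)\<^sup>2 + (prop2 c + s)\<^sup>2 + 2 * (16 * K + 8 * (al * K) + 8) / real (Suc n)"

lemma trap_nonneg: "0 \<le> trap s n c"
  using al K_pos by (simp add: trap_def)

lemma trap_step:
  assumes c: "at_time n c" and s: "\<bar>s\<bar> \<le> 1"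
    and inward: "(prop1 c - s) * drift1 c + (prop2 c + s) * drift2 c \<le> 0"
  shows "(\<integral>\<^sup>+c'. ennreal (trap s (Suc n) c') \<partial>measure_pmf (urn_step al p c)) \<le> ennreal (trap s n c)"
proof -
  let ?x = "prop1 c" and ?y = "prop2 c" and ?H = "drift1 c" and ?G = "drift2 c"
  let ?T1 = "real n + real (b1 + r1) + 1" and ?T2 = "real n + real (b2 + r2) + 1"
  let ?m1 = "draw_mean al p c (fst c)" and ?m2 = "draw_mean al p c (snd c)"
  define N h k B where "N = real (Suc n)" and "h = ?x - s" and "k = ?y + s" and "B = 16 * K + 8 * (al * K) + 8"
  have N: "1 \<le> N" "0 < N" by (simp_all add: N_def)
  have B0: "0 \<le> B" using al K_pos by (simp add: B_def)
  have hk: "\<bar>h\<bar> \<le> 2" "\<bar>k\<bar> \<le> 2"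
    unfolding h_def k_def using s abs_sprop_le_1[of "fst c"] abs_sprop_le_1[of "snd c"] by linarith+
  have le: "trap s (Suc n) (bump c i j) \<le> (h\<^sup>2 + k\<^sup>2 - 2 * h * ?x / ?T1 - 2 * k * ?y / ?T2 + 8 / N\<^sup>2 + 2 * B / (N + 1))
      + (2 * h / ?T1) * sg i + (2 * k / ?T2) * sg j + 0 * (sg i * sg j)" for i j
  proof -
    let ?d = "prop1 (bump c i j) - ?x" and ?e = "prop2 (bump c i j) - ?y"
    have "?d\<^sup>2 \<le> (2 / N)\<^sup>2" "?e\<^sup>2 \<le> (2 / N)\<^sup>2"
      unfolding N_def using prop_bump_diff[OF c, of i j] by (metis abs_le_square_iff abs_of_nonneg divide_nonneg_nonneg of_nat_0_le_iff zero_le_numeral)+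
    then have de: "?d\<^sup>2 + ?e\<^sup>2 \<le> 8 / N\<^sup>2" by (simp add: power_divide)
    have hd: "prop1 (bump c i j) - s = h + ?d" "prop2 (bump c i j) + s = k + ?e"
      by (simp_all add: h_def k_def)
    have "trap s (Suc n) (bump c i j) = (h + ?d)\<^sup>2 + (k + ?e)\<^sup>2 + 2 * B / (N + 1)"
      unfolding trap_def hd B_def N_def by simp
    also have "\<dots> = h\<^sup>2 + k\<^sup>2 + 2 * h * ?d + 2 * k * ?e + (?d\<^sup>2 + ?e\<^sup>2) + 2 * B / (N + 1)"
      by (simp only: power2_sum)
    also have "\<dots> \<le> h\<^sup>2 + k\<^sup>2 + 2 * h * ?d + 2 * k * ?e + 8 / N\<^sup>2 + 2 * B / (N + 1)"
      using de by simp
    also have "2 * h * ?d = 2 * h / ?T1 * sg i - 2 * h * ?x / ?T1"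
      unfolding prop_bump[OF c] by (simp add: diff_divide_distrib right_diff_distrib del: of_nat_add)
    also have "2 * k * ?e = 2 * k / ?T2 * sg j - 2 * k * ?y / ?T2"
      unfolding prop_bump[OF c] by (simp add: diff_divide_distrib right_diff_distrib del: of_nat_add)
    finally show ?thesis by simp
  qed
  have p0: "0 \<le> p" "p \<le> 1" using p by simp_all
  have "(\<integral>\<^sup>+c'. ennreal (trap s (Suc n) c') \<partial>measure_pmf (urn_step al p c)) \<le>
     ennreal ((h\<^sup>2 + k\<^sup>2 - 2 * h * ?x / ?T1 - 2 * k * ?y / ?T2 + 8 / N\<^sup>2 + 2 * B / (N + 1))
      + (2 * h / ?T1) * ?m1 + (2 * k / ?T2) * ?m2 + 0 * (?m1 * ?m2))"
    by (rule nn_integral_urn_step_le(1)[OF p0 trap_nonneg le at_timeD(1,2)[OF c]])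
  also have "\<dots> \<le> ennreal (trap s n c)"
  proof (rule ennreal_leI)
    have "2 * h * (?H + (?m1 - ?x - ?H)) / ?T1 \<le> 2 * h * ?H / N + (8 * K + 4 * (al * K)) / N\<^sup>2"
      using hk draw_mean_near(1)[OF c] time_scale(1)[of n] abs_drift_le abs_sprop_le_1
      by (intro trap_gain) (auto simp: N_def K_def)
    moreover have "2 * k * (?G + (?m2 - ?y - ?G)) / ?T2 \<le> 2 * k * ?G / N + (8 * K + 4 * (al * K)) / N\<^sup>2"
      using hk draw_mean_near(2)[OF c] time_scale(3)[of n] abs_drift_le abs_sprop_le_1
      by (intro trap_gain) (auto simp: N_def K_def)
    moreover have "2 * h * ?H / N + 2 * k * ?G / N \<le> 0"
    proof -
      have "2 * h * ?H / N + 2 * k * ?G / N = 2 * (h * ?H + k * ?G) / N"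
        by (simp add: add_divide_distrib)
      also have "\<dots> \<le> 0" using inward N by (intro divide_nonpos_pos) (auto simp: h_def k_def)
      finally show ?thesis .
    qed
    moreover have "(8 * K + 4 * (al * K)) / N\<^sup>2 + (8 * K + 4 * (al * K)) / N\<^sup>2 + 8 / N\<^sup>2 = B / N\<^sup>2"
      by (simp add: B_def flip: add_divide_distrib)
    moreover have "B / N\<^sup>2 + 2 * B / (N + 1) \<le> 2 * B / N"
    proof -
      have "1 / N\<^sup>2 = 2 / (N * (2 * N))" by (simp add: power2_eq_square)
      also have "\<dots> \<le> 2 / (N * (N + 1))" using N by (intro divide_left_mono mult_left_mono) auto
      also have "\<dots> = 2 / N - 2 / (N + 1)" using N by (simp add: divide_simps)
      finally have "B * (1 / N\<^sup>2) \<le> B * (2 / N - 2 / (N + 1))" using B0 by (rule mult_left_mono)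
      then show ?thesis by (simp add: right_diff_distrib mult.commute)
    qed
    moreover have "(h\<^sup>2 + k\<^sup>2 - 2 * h * ?x / ?T1 - 2 * k * ?y / ?T2 + 8 / N\<^sup>2 + 2 * B / (N + 1))
      + (2 * h / ?T1) * ?m1 + (2 * k / ?T2) * ?m2 + 0 * (?m1 * ?m2) =
      h\<^sup>2 + k\<^sup>2 + 2 * h * (?H + (?m1 - ?x - ?H)) / ?T1 + 2 * k * (?G + (?m2 - ?y - ?G)) / ?T2 + 8 / N\<^sup>2 + 2 * B / (N + 1)"
      by (simp add: right_diff_distrib diff_divide_distrib del: of_nat_add)
    moreover have "trap s n c = h\<^sup>2 + k\<^sup>2 + 2 * B / N"
      by (simp add: trap_def h_def k_def B_def N_def)
    ultimately show "(h\<^sup>2 + k\<^sup>2 - 2 * h * ?x / ?T1 - 2 * k * ?y / ?T2 + 8 / N\<^sup>2 + 2 * B / (N + 1))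
      + (2 * h / ?T1) * ?m1 + (2 * k / ?T2) * ?m2 + 0 * (?m1 * ?m2) \<le> trap s n c"
      by linarith
  qed
  finally show ?thesis .
qed

text \<open>At the zero the linearisation uses slope \<open>al\<close> for the midpoint, which is
  \<open>0\<close> there, and the common slope \<open>D\<close> at both urns. Since
  \<open>2 * m^2 <= h^2 + k^2\<close>, the worst direction is \<open>(1, 1)\<close>, and
  \<open>stable\<close> is negativity of the linearised drift in it.\<close>

lemma inward_near_stable_zero:
  assumes fix_pt: "(1 - p) * tanh (al * a2) = tanh a2"
    and stable: "p * al + (1 - p) * (al * (cosh a2)\<^sup>2 / (cosh (al * a2))\<^sup>2) < 1"
  obtains d where "0 < d" "\<And>s t. \<bar>s - tanh a2\<bar> < d \<Longrightarrow> \<bar>t + tanh a2\<bar> < d \<Longrightarrow>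
    (s - tanh a2) * drift al p s t + (t + tanh a2) * drift al p t s \<le> 0"
proof -
  define D where "D = al * (cosh a2)\<^sup>2 / (cosh (al * a2))\<^sup>2"
  \<comment> \<open>The whole stability margin serves as tolerance for the first order expansions,
    so the final quadratic bound has coefficient exactly \<open>0\<close>.\<close>
  define e where "e = 1 - (p * al + (1 - p) * D)"
  have e: "0 < e" using stable by (simp add: e_def D_def)
  obtain d1 where d1: "0 < d1" "\<And>h. \<bar>h\<bar> < d1 \<Longrightarrow> \<bar>reinf al h - al * h\<bar> \<le> e * \<bar>h\<bar>"
    using reinf_first_order[OF e, of al 0] by (auto simp: )
  obtain d2 where d2: "0 < d2" "\<And>h. \<bar>h\<bar> < d2 \<Longrightarrow> \<bar>reinf al (tanh a2 + h) - reinf al (tanh a2) - D * h\<bar> \<le> e * \<bar>h\<bar>"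
    using reinf_first_order[OF e, of al a2] unfolding D_def by metis
  have quad: "x * F \<le> (A + e) * x\<^sup>2" if "\<bar>F - A * x\<bar> \<le> e * \<bar>x\<bar>" for x F A :: real
  proof -
    have "x * (F - A * x) \<le> \<bar>x\<bar> * (e * \<bar>x\<bar>)"
      using that by (metis abs_ge_self abs_ge_zero abs_mult mult_left_mono order_trans)
    also have "\<dots> = e * x\<^sup>2" by (simp add: power2_eq_square mult_ac)
    finally show ?thesis by (simp add: power2_eq_square algebra_simps)
  qed
  show ?thesis
  proof (rule that[of "min d1 d2"])
    show "0 < min d1 d2" using d1 d2 by simp
    fix s t assume st: "\<bar>s - tanh a2\<bar> < min d1 d2" "\<bar>t + tanh a2\<bar> < min d1 d2"
    define h k m where "h = s - tanh a2" and "k = t + tanh a2" and "m = (s + t) / 2"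
    have hk: "2 * m = h + k" by (simp add: h_def k_def m_def)
    have "\<bar>m\<bar> < d1" using st hk unfolding h_def k_def by linarith
    then have 1: "m * reinf al m \<le> (al + e) * m\<^sup>2" by (intro quad d1)
    have "tanh a2 + h = s" by (simp add: h_def)
    then have 2: "h * (reinf al s - reinf al (tanh a2)) \<le> (D + e) * h\<^sup>2"
      using d2(2)[of h] st by (intro quad) (simp add: h_def)
    have "tanh a2 + - k = - t" by (simp add: k_def)
    then have "(- k) * (reinf al (- t) - reinf al (tanh a2)) \<le> (D + e) * (- k)\<^sup>2"
    proof (intro quad)
      have "\<bar>- k\<bar> < d2" using st unfolding k_def by linarith
      from d2(2)[OF this] show "\<bar>reinf al (- t) - reinf al (tanh a2) - D * (- k)\<bar> \<le> e * \<bar>- k\<bar>"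
        unfolding \<open>tanh a2 + - k = - t\<close> .
    qed
    then have 3: "k * (reinf al t + reinf al (tanh a2)) \<le> (D + e) * k\<^sup>2" by (simp add: algebra_simps)
    have m2: "2 * m\<^sup>2 \<le> h\<^sup>2 + k\<^sup>2"
    proof -
      have "(2 * m)\<^sup>2 = (h + k)\<^sup>2" using hk by simp
      then have "4 * m\<^sup>2 = h\<^sup>2 + k\<^sup>2 + 2 * h * k" by (simp add: power_mult_distrib power2_sum)
      moreover have "2 * h * k \<le> h\<^sup>2 + k\<^sup>2" by (rule sum_squares_bound)
      ultimately show ?thesis by linarith
    qed
    have fx: "tanh a2 = (1 - p) * reinf al (tanh a2)" using fix_pt by (simp add: reinf_tanh)
    have d1': "drift al p s t = p * reinf al m + (1 - p) * (reinf al s - reinf al (tanh a2)) - h"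
      using fx by (simp add: drift_def m_def h_def right_diff_distrib)
    have d2': "drift al p t s = p * reinf al m + (1 - p) * (reinf al t + reinf al (tanh a2)) - k"
      using fx by (simp add: drift_def m_def k_def distrib_left add.commute)
    have "h * drift al p s t + k * drift al p t s = 2 * p * (m * reinf al m)
      + (1 - p) * (h * (reinf al s - reinf al (tanh a2)) + k * (reinf al t + reinf al (tanh a2))) - (h\<^sup>2 + k\<^sup>2)"
    proof -
      have "h * drift al p s t + k * drift al p t s = p * ((h + k) * reinf al m)
        + (1 - p) * (h * (reinf al s - reinf al (tanh a2)) + k * (reinf al t + reinf al (tanh a2))) - (h\<^sup>2 + k\<^sup>2)"
        unfolding d1' d2' by (simp add: algebra_simps power2_eq_square)
      then show ?thesis unfolding hk[symmetric] by simp
    qed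
    also have "\<dots> \<le> p * (al + e) * (h\<^sup>2 + k\<^sup>2) + (1 - p) * ((D + e) * h\<^sup>2 + (D + e) * k\<^sup>2) - (h\<^sup>2 + k\<^sup>2)"
    proof -
      have "2 * p * (m * reinf al m) \<le> 2 * p * ((al + e) * m\<^sup>2)" using 1 p by (intro mult_left_mono) auto
      also have "\<dots> = p * (al + e) * (2 * m\<^sup>2)" by simp
      also have "\<dots> \<le> p * (al + e) * (h\<^sup>2 + k\<^sup>2)" using m2 p al e by (intro mult_left_mono) auto
      finally have "2 * p * (m * reinf al m) \<le> p * (al + e) * (h\<^sup>2 + k\<^sup>2)" .
      moreover have "(1 - p) * (h * (reinf al s - reinf al (tanh a2)) + k * (reinf al t + reinf al (tanh a2)))
         \<le> (1 - p) * ((D + e) * h\<^sup>2 + (D + e) * k\<^sup>2)"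
        using 2 3 p by (intro mult_left_mono add_mono) auto
      ultimately show ?thesis by linarith
    qed
    also have "\<dots> = (p * al + (1 - p) * D + e - 1) * (h\<^sup>2 + k\<^sup>2)" by (simp add: algebra_simps)
    also have "\<dots> = 0" by (simp add: e_def)
    finally show "(s - tanh a2) * drift al p s t + (t + tanh a2) * drift al p t s \<le> 0"
      by (simp add: h_def k_def)
  qed
qed

text \<open>With positive probability the process is close to the stable zero at a late time; from
  there the maximal inequality confines it forever with conditional probability at least
  \<open>1/2\<close>, and a confined path cannot dominate.\<close>

lemma prob_domination_less_1:
  assumes a2: "0 < a2" and fix_pt: "(1 - p) * tanh (al * a2) = tanh a2"
    and stable: "p * al + (1 - p) * (al * (cosh a2)\<^sup>2 / (cosh (al * a2))\<^sup>2) < 1"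
  shows "measure law domination < 1"
proof -
  interpret prob_space law by (rule prob_space_urn_law)
  define z where "z = tanh a2"
  have z: "0 < z" "z < 1" using a2 tanh_real_lt_1 by (auto simp: z_def)
  obtain d0 where d0: "0 < d0" "\<And>s t. \<bar>s - z\<bar> < d0 \<Longrightarrow> \<bar>t + z\<bar> < d0 \<Longrightarrow>
    (s - z) * drift al p s t + (t + z) * drift al p t s \<le> 0"
    using inward_near_stable_zero[OF fix_pt stable] unfolding z_def by metis
  \<comment> \<open>The bound \<open>d <= z\<close> keeps \<open>prop1\<close> positive and
    \<open>prop2\<close> negative on the ball, which contradicts both ways of domination.\<close>
  define d where "d = min d0 z"
  have d: "0 < d" "d \<le> d0" "d \<le> z" using d0 z by (auto simp: d_def)
  define i where "i n = nat \<lfloor>(1 + z) / 2 * real n\<rfloor>" for n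
  define j where "j n = nat \<lfloor>(1 - z) / 2 * real n\<rfloor>" for n
  define cf where "cf n = ((b1 + i n, r1 + (n - i n)), (b2 + j n, r2 + (n - j n)))" for n
  have l1: "(\<lambda>n. prop1 (cf n)) \<longlonglongrightarrow> z"
  proof -
    have e: "2 * ((1 + z) / 2) - 1 = z" by (simp add: add_divide_distrib)
    show ?thesis
      using sprop_floor_tendsto[of "(1 + z) / 2" b1 r1] z unfolding e by (simp add: cf_def i_def)
  qed
  have l2: "(\<lambda>n. prop2 (cf n)) \<longlonglongrightarrow> - z"
  proof -
    have e: "2 * ((1 - z) / 2) - 1 = - z" by (simp add: diff_divide_distrib)
    show ?thesis
      using sprop_floor_tendsto[of "(1 - z) / 2" b2 r2] z unfolding e by (simp add: cf_def j_def)
  qed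
  have l3: "(\<lambda>n. 2 * (16 * K + 8 * (al * K) + 8) / real (Suc n)) \<longlonglongrightarrow> 0"
    using tendsto_mult_right_zero[OF LIMSEQ_inverse_real_of_nat, of "2 * (16 * K + 8 * (al * K) + 8)"]
    by (simp add: divide_inverse)
  have "(\<lambda>n. trap z n (cf n)) \<longlonglongrightarrow> (z - z)\<^sup>2 + (- z + z)\<^sup>2 + 0"
    unfolding trap_def by (intro tendsto_intros l1 l2 l3)
  \<comment> \<open>Starting below half of the exit level \<open>d^2\<close> bounds the conditional
    exit probability by \<open>1/2\<close>.\<close>
  then have "eventually (\<lambda>n. trap z n (cf n) < d\<^sup>2 / 2) sequentially"
    using d by (intro order_tendstoD(2)) auto
  then obtain n where n: "trap z n (cf n) < d\<^sup>2 / 2"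
    by (auto simp: eventually_sequentially)
  define A where "A = {\<omega> :: nat \<Rightarrow> config. \<omega> n = cf n}"
  have depA: "past_dep n (\<lambda>\<omega>. \<omega> \<in> A)" by (auto simp: past_dep_def A_def)
  have As: "A \<in> sets law" by (rule sets_past_dep[OF depA])
  have leq: "i n \<le> n" "j n \<le> n"
  proof -
    have nb: "nat \<lfloor>y * real n\<rfloor> \<le> n" if "0 \<le> y" "y \<le> 1" for y
    proof -
      have "y * real n \<le> real n" using that by (simp add: mult_left_le_one_le)
      then show ?thesis by (simp add: nat_le_iff floor_le_iff)
    qed
    show "i n \<le> n" unfolding i_def by (rule nb) (use z in auto)
    show "j n \<le> n" unfolding j_def by (rule nb) (use z in auto)
  qed
  have Apos: "0 < measure law A"
    unfolding A_def cf_def using reach[OF leq] .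
  \<comment> \<open>No distance condition is put into \<open>G\<close>: being below the level
    already confines the path to the ball, by \<open>close\<close>.\<close>
  define G where "G = (\<lambda>m. {c. at_time m c})"
  define E where "E = {\<omega> \<in> A. \<exists>m\<ge>n. ennreal (d\<^sup>2) \<le> ennreal (trap z m (\<omega> m)) \<and> (\<forall>l\<in>{n..<m}. \<omega> l \<in> G l)}"
  have close: "\<bar>prop1 c - z\<bar> < d \<and> \<bar>prop2 c + z\<bar> < d" if "trap z m c < d\<^sup>2" for m c
  proof -
    have "0 \<le> 2 * (16 * K + 8 * (al * K) + 8) / real (Suc m)" using al K_pos by simp
    then have "(prop1 c - z)\<^sup>2 < d\<^sup>2" "(prop2 c + z)\<^sup>2 < d\<^sup>2"
      using that zero_le_power2[of "prop1 c - z"] zero_le_power2[of "prop2 c + z"] unfolding trap_def by linarith+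
    then have "\<bar>prop1 c - z\<bar>\<^sup>2 < d\<^sup>2" "\<bar>prop2 c + z\<bar>\<^sup>2 < d\<^sup>2" by simp_all
    then show ?thesis using d(1) by (meson power_less_imp_less_base less_imp_le)
  qed
  have "ennreal (d\<^sup>2) * emeasure law E \<le> (\<integral>\<^sup>+\<omega>. indicator A \<omega> * ennreal (trap z n (\<omega> n)) \<partial>law)"
    unfolding E_def
  proof (rule maximal_inequality[OF depA])
    fix m c assume c: "c \<in> G m" and lt: "ennreal (trap z m c) < ennreal (d\<^sup>2)"
    from lt have "trap z m c < d\<^sup>2" by (simp add: ennreal_less_iff trap_nonneg)
    from close[OF this] d have "(prop1 c - z) * drift1 c + (prop2 c + z) * drift2 c \<le> 0"
      by (intro d0(2)) auto
    then show "(\<integral>\<^sup>+c'. ennreal (trap z (Suc m) c') \<partial>measure_pmf (urn_step al p c)) \<le> ennreal (trap z m c)"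
      using c z by (intro trap_step) (auto simp: G_def)
  qed
  also have "\<dots> \<le> (\<integral>\<^sup>+\<omega>. ennreal (d\<^sup>2 / 2) * indicator A \<omega> \<partial>law)"
    by (rule nn_integral_mono) (use n in \<open>auto simp: A_def split: split_indicator intro!: ennreal_leI\<close>)
  also have "\<dots> = ennreal (d\<^sup>2 / 2) * emeasure law A"
    by (rule nn_integral_cmult_indicator[OF As])
  finally have "ennreal (d\<^sup>2 * measure law E) \<le> ennreal (d\<^sup>2 / 2 * measure law A)"
    by (simp only: emeasure_eq_measure ennreal_mult'[symmetric] zero_le_power2 divide_nonneg_nonneg zero_le_numeral)
  then have "d\<^sup>2 * measure law E \<le> d\<^sup>2 / 2 * measure law A"
    by (subst (asm) ennreal_le_iff) auto
  then have EA: "measure law E \<le> measure law A / 2"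
    using d(1) by (simp add: field_simps)
  have "AE \<omega> in law. \<omega> \<in> domination \<longrightarrow> \<omega> \<notin> A - E"
    using AE_path
  proof eventually_elim
    case (elim \<omega>)
    then have at: "\<And>m. at_time m (\<omega> m)" by blast
    show ?case
    proof (intro impI notI)
      assume D: "\<omega> \<in> domination" and w: "\<omega> \<in> A - E"
      have in_ball: "\<bar>prop1 (\<omega> m) - z\<bar> < d \<and> \<bar>prop2 (\<omega> m) + z\<bar> < d" if "n \<le> m" for m
      proof (rule close, rule ccontr)
        assume "\<not> trap z m (\<omega> m) < d\<^sup>2"
        then have "ennreal (d\<^sup>2) \<le> ennreal (trap z m (\<omega> m))" by (intro ennreal_leI) simp
        with w that at show False by (auto simp: E_def G_def)
      qed
      have "\<not> (\<lambda>m. prop1 (\<omega> m)) \<longlonglongrightarrow> -1"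
      proof
        assume "(\<lambda>m. prop1 (\<omega> m)) \<longlonglongrightarrow> -1"
        then have "eventually (\<lambda>m. prop1 (\<omega> m) < 0) sequentially" by (rule order_tendstoD) simp
        then obtain m where "n \<le> m" "prop1 (\<omega> m) < 0" unfolding eventually_sequentially by (metis nle_le)
        with in_ball[of m] d show False by linarith
      qed
      moreover have "\<not> (\<lambda>m. prop2 (\<omega> m)) \<longlonglongrightarrow> 1"
      proof
        assume "(\<lambda>m. prop2 (\<omega> m)) \<longlonglongrightarrow> 1"
        then have "eventually (\<lambda>m. 0 < prop2 (\<omega> m)) sequentially" by (rule order_tendstoD) simp
        then obtain m where "n \<le> m" "0 < prop2 (\<omega> m)" unfolding eventually_sequentially by (metis nle_le)
        with in_ball[of m] d show False by linarith
      qed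
      ultimately show False using D domination_iff[OF at] by blast
    qed
  qed
  then have AEc: "AE \<omega> in law. \<omega> \<in> domination \<longrightarrow> \<omega> \<notin> A \<or> \<omega> \<in> E" by eventually_elim blast
  show ?thesis
  proof (rule ccontr)
    assume "\<not> measure law domination < 1"
    then have "measure law domination = 1" using prob_le_1[of domination] by linarith
    then have "AE \<omega> in law. \<omega> \<in> domination" by (simp add: prob_eq_1[OF sets_domination])
    with AEc have AEE: "AE \<omega> in law. \<omega> \<in> A \<longrightarrow> \<omega> \<in> E" by eventually_elim blast
    have Es: "E \<in> sets law"
    proof -
      have "E = (\<Union>m\<in>{n..}. {\<omega> \<in> A. ennreal (d\<^sup>2) \<le> ennreal (trap z m (\<omega> m)) \<and> (\<forall>l\<in>{n..<m}. \<omega> l \<in> G l)})"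
        by (auto simp: E_def)
      also have "\<dots> \<in> sets law"
      proof (rule sets.countable_UN'')
        fix m assume "m \<in> {n..}"
        then have nm: "n \<le> m" by simp
        show "{\<omega> \<in> A. ennreal (d\<^sup>2) \<le> ennreal (trap z m (\<omega> m)) \<and> (\<forall>l\<in>{n..<m}. \<omega> l \<in> G l)} \<in> sets law"
        proof (rule sets_past_dep[of m], rule past_depI)
          fix \<omega> \<omega>' :: "nat \<Rightarrow> config" assume w: "\<And>l. l \<le> m \<Longrightarrow> \<omega> l = \<omega>' l"
          then have "(\<forall>l\<in>{n..<m}. \<omega> l \<in> G l) \<longleftrightarrow> (\<forall>l\<in>{n..<m}. \<omega>' l \<in> G l)" by auto
          then show "(\<omega> \<in> {\<omega> \<in> A. ennreal (d\<^sup>2) \<le> ennreal (trap z m (\<omega> m)) \<and> (\<forall>l\<in>{n..<m}. \<omega> l \<in> G l)}) =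
            (\<omega>' \<in> {\<omega> \<in> A. ennreal (d\<^sup>2) \<le> ennreal (trap z m (\<omega> m)) \<and> (\<forall>l\<in>{n..<m}. \<omega> l \<in> G l)})"
            using w[of m] w[of n] nm by (simp add: A_def)
        qed
      qed simp
      finally show ?thesis .
    qed
    have "measure law A \<le> measure law E" by (rule finite_measure_mono_AE[OF AEE Es])
    with EA Apos show False by linarith
  qed
qed

end

section \<open>The critical parameter\<close>

lemma mult_tanh_strict_mono:
  fixes a b :: real
  assumes "0 \<le> a" "a < b"
  shows "2 * a * tanh a < 2 * b * tanh b"
proof -
  have "a * tanh a \<le> a * tanh b" using assms by (intro mult_left_mono) auto
  also have "\<dots> < b * tanh b" using assms by (intro mult_strict_right_mono) auto
  finally show ?thesis by simp
qed

lemma ex_mult_tanh_eq_1: obtains a :: real where "0 < a" "2 * a * tanh a = 1"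
proof -
  define x where "x = exp (- 4 :: real)"
  have "x \<le> 1/5"
    unfolding x_def using exp_ge_add_one_self[of "4 :: real"] by (simp add: exp_minus field_simps)
  moreover have "0 < x" by (simp add: x_def)
  ultimately have "1/2 \<le> (1 - x) / (1 + x)" by (simp add: field_simps)
  then have "1/2 \<le> tanh (2 :: real)"
    by (simp add: tanh_real_altdef x_def)
  then have "\<exists>a. 0 \<le> a \<and> a \<le> 2 \<and> 2 * a * tanh a = (1 :: real)"
    by (intro IVT') (auto intro!: continuous_intros)
  then obtain a :: real where "0 \<le> a" "2 * a * tanh a = 1" by blast
  moreover from this have "a \<noteq> 0" by auto
  ultimately show ?thesis by (intro that) auto
qed

lemma artanh_equation_iff:
  fixes a s :: real
  assumes a: "0 < a" "2 * a * tanh a = 1"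
  shows "s \<in> {0<..<1} \<and> 2 * s * artanh s = 1 \<longleftrightarrow> s = tanh a"
proof
  assume s: "s \<in> {0<..<1} \<and> 2 * s * artanh s = 1"
  then obtain b where b: "s = tanh b" using obtain_tanh[of s] by auto
  then have "0 < b" "2 * b * tanh b = 1" using s by (auto simp: artanh_tanh_real mult_ac)
  then have "b = a"
    using mult_tanh_strict_mono[of a b] mult_tanh_strict_mono[of b a] a by (cases a b rule: linorder_cases) auto
  with b show "s = tanh a" by simp
next
  assume "s = tanh a"
  then show "s \<in> {0<..<1} \<and> 2 * s * artanh s = 1"
    using a tanh_real_lt_1 by (auto simp: artanh_tanh_real mult_ac)
qed

lemma s0_eq: "0 < a \<Longrightarrow> 2 * a * tanh a = 1 \<Longrightarrow> s0 = tanh a"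
  unfolding s0_def artanh_equation_iff by simp

text \<open>The equation for \<open>a\<close> reads \<open>cosh a = 2 * a * sinh a\<close>, and with
  it both sides equal \<open>1 / (2 * (sinh a)^2)\<close>.\<close>

lemma limit_value_eq:
  fixes a :: real
  assumes a: "0 < a" "2 * a * tanh a = 1"
  shows "(1 - (tanh a)\<^sup>2) / (2 * (tanh a)\<^sup>2) = 2 * a / sinh (2 * a)"
proof -
  have s: "0 < sinh a" using a by simp
  have e: "cosh a = 2 * a * sinh a" using a(2) by (simp add: tanh_def field_simps)
  have "2 * a / sinh (2 * a) = a / (sinh a * cosh a)"
    by (simp add: sinh_double)
  also have "\<dots> = 1 / (2 * (sinh a)\<^sup>2)" unfolding e using a s by (simp add: power2_eq_square)
  also have "\<dots> = (1 - (tanh a)\<^sup>2) / (2 * (tanh a)\<^sup>2)"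
    using s unfolding one_minus_tanh_square by (simp add: tanh_def power_divide)
  finally show ?thesis by simp
qed

lemma eventually_at_right_1_if_DERIV_pos:
  fixes f :: "real \<Rightarrow> real"
  assumes "(f has_real_derivative D) (at 1)" "0 < D" "f 1 = 0"
  shows "eventually (\<lambda>x. 0 < f x) (at_right 1)"
proof -
  obtain d where d: "0 < d" "\<And>h. 0 < h \<Longrightarrow> h < d \<Longrightarrow> f 1 < f (1 + h)"
    using DERIV_pos_inc_right[OF assms(1,2)] by blast
  show ?thesis
    unfolding eventually_at_right_field
  proof (intro exI conjI allI impI)
    show "1 < 1 + d" using d by simp
    fix x assume "1 < x" "x < 1 + d"
    then show "0 < f x" using d(2)[of "x - 1"] assms(3) by simp
  qed
qed

definition always_dominating :: "real \<Rightarrow> config \<Rightarrow> real set" where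
  "always_dominating al c0 = {q \<in> {0..1}. \<forall>p\<in>{q..1}. measure (urn_law al p c0) domination = 1}"

lemma p_crit_eq: "p_crit al c0 = Inf (always_dominating al c0)"
  by (simp add: p_crit_def always_dominating_def)

lemma always_dominating_lower_bound:
  assumes "p \<in> {0..1}" "measure (urn_law al p c0) domination < 1" "q \<in> always_dominating al c0"
  shows "p < q"
proof (rule ccontr)
  assume "\<not> p < q"
  then have "measure (urn_law al p c0) domination = 1" using assms by (auto simp: always_dominating_def)
  with assms(2) show False by simp
qed

text \<open>Both strict inequalities required for domination become equalities at
  \<open>al = 1\<close>, so the signs of the derivatives there decide:
  \<open>(cosh a)^2 * (1 - 2 * a * tanh a)\<close> and \<open>c * sinh (2 * a) - 2 * a\<close>. The
  factor \<open>1 - p\<close> is simply bounded by \<open>1\<close>.\<close>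

lemma eventually_dominating:
  fixes b1 r1 b2 r2 :: nat and a c :: real
  assumes r1: "1 \<le> r1" and b2: "1 \<le> b2" and a: "0 < a" "2 * a * tanh a < 1" and c: "2 * a / sinh (2 * a) < c"
  shows "eventually (\<lambda>al. c * (al - 1) \<in> always_dominating al ((b1, r1), (b2, r2))) (at_right 1)"
proof -
  have sa: "0 < sinh (2 * a)" using a by simp
  have c0: "0 < c" using a sa c by (meson divide_pos_pos less_trans mult_pos_pos zero_less_numeral)
  have "((\<lambda>al. al * (cosh a)\<^sup>2 - (cosh (al * a))\<^sup>2) has_real_derivative
      (cosh a)\<^sup>2 - 2 * (cosh (1 * a) * (sinh (1 * a) * a))) (at 1)"
    by (auto intro!: derivative_eq_intros)
  moreover have "0 < (cosh a)\<^sup>2 - 2 * (cosh (1 * a) * (sinh (1 * a) * a))"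
  proof -
    have "(cosh a)\<^sup>2 * (2 * a * tanh a) < (cosh a)\<^sup>2 * 1" using a(2) by (intro mult_strict_left_mono) auto
    then show ?thesis by (simp add: tanh_def power2_eq_square mult_ac)
  qed
  ultimately have 1: "eventually (\<lambda>al. 0 < al * (cosh a)\<^sup>2 - (cosh (al * a))\<^sup>2) (at_right 1)"
    by (rule eventually_at_right_1_if_DERIV_pos) simp
  have "((\<lambda>al. c * (al - 1) * sinh (2 * a) - 2 * sinh ((al - 1) * a)) has_real_derivative
      c * sinh (2 * a) - 2 * a) (at 1)"
    by (auto intro!: derivative_eq_intros)
  moreover have "0 < c * sinh (2 * a) - 2 * a" using c sa by (simp add: divide_less_eq)
  ultimately have 2: "eventually (\<lambda>al. 0 < c * (al - 1) * sinh (2 * a) - 2 * sinh ((al - 1) * a)) (at_right 1)"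
    by (rule eventually_at_right_1_if_DERIV_pos) simp
  \<comment> \<open>The bound \<open>1 + 1 / c\<close> ensures \<open>c * (al - 1) < 1\<close>, so
    that the candidate lies in the unit interval.\<close>
  have 3: "eventually (\<lambda>al. al < min 3 (1 + 1 / c)) (at_right (1 :: real))"
    by (rule order_tendstoD(2)[OF tendsto_ident_at]) (use c0 in simp)
  have 4: "eventually (\<lambda>al. 1 < al) (at_right (1 :: real))"
    by (simp add: eventually_at_right_less)
  from 1 2 3 4 show ?thesis
  proof eventually_elim
    case (elim al)
    have "al - 1 < 1 / c" using elim by simp
    then have "c * (al - 1) < 1" using c0 by (simp add: pos_less_divide_eq mult.commute)
    moreover have pos: "0 < c * (al - 1)" using c0 elim by simp
    moreover have "measure (urn_law al p ((b1, r1), (b2, r2))) domination = 1" if pc: "p \<in> {c * (al - 1)..1}" for p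
    proof -
      have p0: "0 < p" "p \<le> 1" using pc pos by auto
      interpret two_urns al p b1 r1 b2 r2
        by unfold_locales (use elim p0 r1 b2 in auto)
      show ?thesis
      proof (rule prob_domination_eq_1)
        have "0 \<le> sinh ((al - 1) * a)" using elim a by simp
        then have "(1 - p) * (2 * sinh ((al - 1) * a)) \<le> 1 * (2 * sinh ((al - 1) * a))"
          using p0 by (intro mult_right_mono) auto
        also have "\<dots> < c * (al - 1) * sinh (2 * a)" using elim by simp
        also have "\<dots> \<le> p * sinh (2 * a)" using pc sa by (intro mult_right_mono) auto
        finally show "(1 - p) * (2 * sinh ((al - 1) * a)) < p * sinh (2 * a)" .
      qed (use elim a in auto)
    qed
    ultimately show ?case by (simp add: always_dominating_def)
  qed
qed

text \<open>The parameter \<open>P al\<close> is the one for which \<open>(tanh a, - tanh a)\<close>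
  is exactly a zero of the drift, and its derivative at \<open>al = 1\<close> is
  \<open>2 * a / sinh (2 * a)\<close>.\<close>

lemma eventually_not_dominating:
  fixes b1 r1 b2 r2 :: nat and a c :: real
  assumes r1: "1 \<le> r1" and b2: "1 \<le> b2" and a: "0 < a" "1 < 2 * a * tanh a" and c: "c < 2 * a / sinh (2 * a)"
  shows "eventually (\<lambda>al. \<exists>p\<in>{0..1}. c * (al - 1) < p \<and>
    measure (urn_law al p ((b1, r1), (b2, r2))) domination < 1) (at_right 1)"
proof -
  define P where "P al = 1 - tanh a / tanh (al * a)" for al
  have t: "0 < tanh a" using a by simp
  define P' where "P' = a * (1 - (tanh a)\<^sup>2) / tanh a"
  have DP: "(P has_real_derivative P') (at 1)"
    unfolding P_def P'_def using t
    by (auto intro!: derivative_eq_intros simp: power2_eq_square field_simps)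
  have P1: "P 1 = 0" using t by (simp add: P_def)
  have P'eq: "P' = 2 * a / sinh (2 * a)"
    using a unfolding P'_def one_minus_tanh_square by (simp add: tanh_def sinh_double power2_eq_square)
  have "((\<lambda>al. P al - c * (al - 1)) has_real_derivative P' - c) (at 1)"
    by (auto intro!: derivative_eq_intros DP)
  then have 1: "eventually (\<lambda>al. 0 < P al - c * (al - 1)) (at_right 1)"
    by (rule eventually_at_right_1_if_DERIV_pos) (use P'eq c P1 in auto)
  \<comment> \<open>At \<open>al = 1\<close> both slopes are \<open>1\<close>, so the two
    contributions of the derivative of \<open>P\<close> cancel and only the slope at
    \<open>tanh a\<close> is left.\<close>
  have "((\<lambda>al. 1 - (P al * al + (1 - P al) * (al * (cosh a)\<^sup>2 / (cosh (al * a))\<^sup>2))) has_real_derivative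
      2 * a * tanh a - 1) (at 1)"
    by (auto intro!: derivative_eq_intros DP simp: P1 tanh_def power2_eq_square field_simps)
  then have 2: "eventually (\<lambda>al. 0 < 1 - (P al * al + (1 - P al) * (al * (cosh a)\<^sup>2 / (cosh (al * a))\<^sup>2))) (at_right 1)"
    by (rule eventually_at_right_1_if_DERIV_pos) (use a P1 in auto)
  have 3: "eventually (\<lambda>al. 1 < al) (at_right (1 :: real))"
    by (simp add: eventually_at_right_less)
  from 1 2 3 show ?thesis
  proof eventually_elim
    case (elim al)
    have "a < al * a" using a elim by simp
    then have lt: "tanh a < tanh (al * a)" by simp
    then have p: "0 < P al" "P al \<le> 1" using t by (auto simp: P_def)
    interpret two_urns al "P al" b1 r1 b2 r2
      by unfold_locales (use elim p r1 b2 in auto)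
    have "measure (urn_law al (P al) ((b1, r1), (b2, r2))) domination < 1"
    proof (rule prob_domination_less_1[OF a(1)])
      show "(1 - P al) * tanh (al * a) = tanh a" using lt t by (simp add: P_def)
      show "P al * al + (1 - P al) * (al * (cosh a)\<^sup>2 / (cosh (al * a))\<^sup>2) < 1" using elim by simp
    qed
    then show ?case using p elim by (intro bexI[of _ "P al"]) auto
  qed
qed

theorem proposition10p1:
  fixes b1 r1 b2 r2 :: nat
  assumes "r1 \<ge> 1" and "b2 \<ge> 1"
  shows "(\<exists>!s::real. s \<in> {0<..<1} \<and> 2 * s * artanh s = 1) \<and>
    ((\<lambda>\<alpha>. p_crit \<alpha> ((b1, r1), (b2, r2)) / (\<alpha> - 1)) \<longlongrightarrow> (1 - s0\<^sup>2) / (2 * s0\<^sup>2)) (at_right 1)"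
proof
  obtain a0 :: real where a0: "0 < a0" "2 * a0 * tanh a0 = 1" by (rule ex_mult_tanh_eq_1)
  show "\<exists>!s::real. s \<in> {0<..<1} \<and> 2 * s * artanh s = 1"
    unfolding artanh_equation_iff[OF a0] by simp
  define g where "g = (\<lambda>a :: real. 2 * a / sinh (2 * a))"
  have limit_eq: "(1 - s0\<^sup>2) / (2 * s0\<^sup>2) = g a0"
    unfolding s0_eq[OF a0] g_def by (rule limit_value_eq[OF a0])
  have "isCont g a0" unfolding g_def using a0 by (intro continuous_intros) auto
  then have cont: "(g \<longlongrightarrow> g a0) (at a0)" by (simp add: isCont_def)
  let ?S = "\<lambda>al. always_dominating al ((b1, r1), (b2, r2))"
  have bdd: "bdd_below (?S al)" for al
    by (rule bdd_belowI[of _ 0]) (auto simp: always_dominating_def)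
  \<comment> \<open>A point slightly below \<open>a0\<close> satisfies
    \<open>2 * a * tanh a < 1\<close> strictly and, by continuity of \<open>g\<close>, still has
    \<open>g a < c\<close>; a point slightly above \<open>a0\<close> serves in the same way for the
    lower bound.\<close>
  have up: "eventually (\<lambda>al. c * (al - 1) \<in> ?S al) (at_right 1)" if c: "g a0 < c" for c
  proof -
    have "eventually (\<lambda>a. g a < c) (at_left a0)"
      using order_tendstoD(2)[OF cont c] by (simp add: eventually_at_split)
    moreover have "eventually (\<lambda>a. a \<in> {0<..<a0}) (at_left a0)"
      using a0 by (intro eventually_at_left_real)
    ultimately obtain a where "g a < c" "0 < a" "a < a0"
      using eventually_happens[OF eventually_conj] by (metis (mono_tags, lifting) greaterThanLessThan_iff trivial_limit_at_left_real)
    then show ?thesis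
      using mult_tanh_strict_mono[of a a0] a0 by (intro eventually_dominating[OF assms]) (auto simp: g_def)
  qed
  have low: "eventually (\<lambda>al. \<exists>p\<in>{0..1}. c * (al - 1) < p \<and>
      measure (urn_law al p ((b1, r1), (b2, r2))) domination < 1) (at_right 1)" if c: "c < g a0" for c
  proof -
    have "eventually (\<lambda>a. c < g a) (at_right a0)"
      using order_tendstoD(1)[OF cont c] by (simp add: eventually_at_split)
    moreover have "eventually (\<lambda>a. a0 < a) (at_right a0)"
      by (simp add: eventually_at_right_less)
    ultimately obtain a where "c < g a" "a0 < a"
      using eventually_happens[OF eventually_conj] by (metis (mono_tags, lifting) trivial_limit_at_right_real)
    then show ?thesis
      using mult_tanh_strict_mono[of a0 a] a0 by (intro eventually_not_dominating[OF assms]) (auto simp: g_def)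
  qed
  have gt1: "eventually (\<lambda>al. 1 < al) (at_right (1 :: real))"
    by (simp add: eventually_at_right_less)
  show "((\<lambda>\<alpha>. p_crit \<alpha> ((b1, r1), (b2, r2)) / (\<alpha> - 1)) \<longlongrightarrow> (1 - s0\<^sup>2) / (2 * s0\<^sup>2)) (at_right 1)"
    unfolding limit_eq
  proof (rule order_tendstoI)
    fix l assume "l < g a0"
    then obtain c where c: "l < c" "c < g a0" using dense by blast
    \<comment> \<open>Any constant above \<open>g a0\<close> will do: \<open>up\<close> then shows
      that the set is nonempty, without which its real infimum could not be bounded from
      below.\<close>
    have "g a0 < g a0 + 1" by simp
    from low[OF c(2)] up[OF this] gt1
    show "eventually (\<lambda>\<alpha>. l < p_crit \<alpha> ((b1, r1), (b2, r2)) / (\<alpha> - 1)) (at_right 1)"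
    proof eventually_elim
      case (elim al)
      then obtain p where p: "p \<in> {0..1}" "c * (al - 1) < p"
        "measure (urn_law al p ((b1, r1), (b2, r2))) domination < 1" by blast
      have "p \<le> p_crit al ((b1, r1), (b2, r2))"
        unfolding p_crit_eq
        using elim always_dominating_lower_bound[OF p(1,3)] by (intro cInf_greatest) (auto intro: less_imp_le)
      then have "c * (al - 1) < p_crit al ((b1, r1), (b2, r2))" using p(2) by simp
      then have "c < p_crit al ((b1, r1), (b2, r2)) / (al - 1)"
        using elim by (simp add: pos_less_divide_eq)
      with c show ?case by simp
    qed
  next
    fix u assume "g a0 < u"
    then obtain c where c: "g a0 < c" "c < u" using dense by blast
    from up[OF c(1)] gt1
    show "eventually (\<lambda>\<alpha>. p_crit \<alpha> ((b1, r1), (b2, r2)) / (\<alpha> - 1) < u) (at_right 1)"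
    proof eventually_elim
      case (elim al)
      have "p_crit al ((b1, r1), (b2, r2)) \<le> c * (al - 1)"
        unfolding p_crit_eq by (rule cInf_lower[OF elim(1) bdd])
      then have "p_crit al ((b1, r1), (b2, r2)) / (al - 1) \<le> c"
        using elim by (simp add: pos_divide_le_eq)
      with c show ?case by simp
    qed
  qed
qed

end
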